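(* Let $G/H$ be one of the Wallach spaces $W_{12}=Sp(3)/Sp(1)\times Sp(1)\times Sp(1)$ and $W_{24}=F_4/Spin(8)$. Then the normalized Ricci flow evolves all generic $G$-invariant Riemannian metrics on $G/H$ with positive Ricci curvature into metrics with mixed Ricci curvature. That is, if $\mathbf{g}_0$ is a generic $G$-invariant Riemannian metric on $G/H$ with positive Ricci curvature and $\mathbf{g}(t)$, $t\in[0,T)$, is the maximal solution of the normalized Ricci flow with $\mathbf{g}(0)=\mathbf{g}_0$, then there is $t_0\in(0,T)$ such that $\mathbf{g}(t)$ has mixed Ricci curvature for all $t\in(t_0,T)$.
   Context: The embeddings are the standard ones: $Sp(1)\times Sp(1)\times Sp(1)$ is the diagonal subgroup of $Sp(3)$, and $Spin(8)\subset Spin(9)\subset F_4$. Let $\mathfrak{g},\mathfrak{h}$ be the Lie algebras of $G,H$, let $\langle\cdot,\cdot\rangle=-B$ where $B$ is the Killing form of $\mathfrak{g}$, and let $\mathfrak{p}$ be the $\langle\cdot,\cdot\rangle$-orthogonal complement of $\mathfrak{h}$ in $\mathfrak{g}$. For these spaces, $\mathfrak{p}=\mathfrak{p}_1\oplus\mathfrak{p}_2\oplus\mathfrak{p}_3$ is an orthogonal sum of three pairwise inequivalent irreducible $\mathrm{Ad}(H)$-modules of the same dimension $\mathbf d$ ($\mathbf d=4$ for $W_{12}$ and $\mathbf d=8$ for $W_{24}$), with $[\mathfrak{p}_i,\mathfrak{p}_i]\subset\mathfrak{h}$. Every $G$-invariant Riemannian metric on $G/H$ is determined by an $\mathrm{Ad}(H)$-invariant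 inner product on $\mathfrak p$ $$(\cdot,\cdot)=x_1\langle\cdot,\cdot\rangle|_{\mathfrak{p}_1}+x_2\langle\cdot,\cdot\rangle|_{\mathfrak{p}_2}+x_3\langle\cdot,\cdot\rangle|_{\mathfrak{p}_3},\qquad x_1,x_2,x_3>0.$$ The metric is called generic if $x_1,x_2,x_3$ are pairwise distinct. Its Ricci operator is $\mathbf{r}_i\,\mathrm{Id}$ on $\mathfrak{p}_i$, with principal Ricci curvatures $\mathbf{r}_i=\frac{x_jx_k+a(x_i^2-x_j^2-x_k^2)}{2x_1x_2x_3}$, $\{i,j,k\}=\{1,2,3\}$, where $a=1/8$ for $W_{12}$ and $a=1/9$ for $W_{24}$; its scalar curvature is $S=\mathbf d(\mathbf r_1+\mathbf r_2+\mathbf r_3)$. The normalized Ricci flow is $\frac{\partial}{\partial t}\mathbf{g}(t)=-2\,\mathrm{Ric}_{\mathbf{g}}+2\,\mathbf{g}(t)\frac{S_{\mathbf{g}}}{n}$, where $\mathrm{Ric}_{\mathbf g}$ is the Ricci tensor, $S_{\mathbf g}$ the scalar curvature, and $n=\dim(G/H)=3\mathbf d$. On invariant metrics it is the system $\frac{dx_i}{dt}=-2x_i\left(\mathbf r_i-\frac{S}{n}\right)$, $i=1,2,3$. A metric has positive Ricci curvature if $\mathbf r_1,\mathbf r_2,\mathbf r_3>0$, and mixed Ricci curvature if its Ricci curvature takes both positive and negative values. *)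

theory Defs
  imports "HOL-Analysis.Analysis"
begin

section \<open>Quaternions and octonions\<close>

text \<open>Cayley--Dickson doubling: \<open>(a, b) (c, d) = (a c - d\<^sup>* b, d a + b c\<^sup>*)\<close> and
  \<open>(a, b)\<^sup>* = (a\<^sup>*, - b)\<close>. Addition and scaling are the componentwise ones of the product type.\<close>

type_synonym quat = "complex \<times> complex"
type_synonym oct = "quat \<times> quat"

fun qcnj :: "quat \<Rightarrow> quat" where
  "qcnj (a, b) = (cnj a, - b)"

fun qmul :: "quat \<Rightarrow> quat \<Rightarrow> quat" where
  "qmul (a, b) (c, d) = (a * c - cnj d * b, d * a + b * cnj c)"

fun ocnj :: "oct \<Rightarrow> oct" where
  "ocnj (a, b) = (qcnj a, - b)"

fun omul :: "oct \<Rightarrow> oct \<Rightarrow> oct" where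
  "omul (a, b) (c, d) = (qmul a c - qmul (qcnj d) b, qmul d a + qmul b (qcnj c))"

definition oct_of_real :: "real \<Rightarrow> oct" where
  "oct_of_real r = ((of_real r, 0), (0, 0))"

definition oct_Re :: "oct \<Rightarrow> real" where
  "oct_Re a = Re (fst (fst a))"


section \<open>Homogeneous spaces, infinitesimally\<close>

text \<open>The pair \<open>(\<gg>, \<hh>)\<close> of a homogeneous space \<open>G/H\<close>, with \<open>\<gg>\<close> and \<open>\<hh>\<close> subspaces of an ambient
  vector space, together with three intermediate subalgebras
  \<open>\<hh> \<subseteq> \<kk>\<^sub>i \<subseteq> \<gg>\<close>; the modules \<open>\<pp>\<^sub>i\<close> are cut out of the orthogonal complement \<open>\<pp>\<close> of \<open>\<hh>\<close>
  as \<open>\<pp> \<inter> \<kk>\<^sub>i\<close>.\<close>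

record 'v hom_space =
  bracket :: "'v \<Rightarrow> 'v \<Rightarrow> 'v"
  lie_alg :: "'v set"
  isotropy :: "'v set"
  intermediate :: "3 \<Rightarrow> 'v set"

text \<open>Trace of a linear endomorphism of the finite-dimensional subspace \<open>V\<close>; only the values of
  \<open>f\<close> on \<open>V\<close> matter.\<close>

definition trace_on :: "'v::real_vector set \<Rightarrow> ('v \<Rightarrow> 'v) \<Rightarrow> real" where
  "trace_on V f =
     (let B = (SOME B. independent B \<and> span B = V) in \<Sum>b\<in>B. representation B (f b) b)"

definition killing :: "'v::real_vector hom_space \<Rightarrow> 'v \<Rightarrow> 'v \<Rightarrow> real" where
  "killing M X Y = trace_on (lie_alg M) (\<lambda>Z. bracket M X (bracket M Y Z))"

definition ip :: "'v::real_vector hom_space \<Rightarrow> 'v \<Rightarrow> 'v \<Rightarrow> real" where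
  "ip M X Y = - killing M X Y"

definition pp :: "'v::real_vector hom_space \<Rightarrow> 'v set" where
  "pp M = {X \<in> lie_alg M. \<forall>Y \<in> isotropy M. ip M X Y = 0}"

definition pmod :: "'v::real_vector hom_space \<Rightarrow> 3 \<Rightarrow> 'v set" where
  "pmod M i = pp M \<inter> intermediate M i"

text \<open>Components along \<open>\<pp>\<close> and \<open>\<hh>\<close> with respect to \<open>\<gg> = \<hh> \<oplus> \<pp>\<close>.\<close>

definition proj_p :: "'v::real_vector hom_space \<Rightarrow> 'v \<Rightarrow> 'v" where
  "proj_p M X = (THE Y. Y \<in> pp M \<and> X - Y \<in> isotropy M)"

definition proj_h :: "'v::real_vector hom_space \<Rightarrow> 'v \<Rightarrow> 'v" where
  "proj_h M X = X - proj_p M X"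


section \<open>Invariant metrics and their Ricci curvature\<close>

text \<open>A bilinear form on \<open>\<pp>\<close> is a function \<open>m\<close> of two vectors, of which only the values on \<open>\<pp>\<close>
  are ever used. The next predicate says that \<open>m\<close> is
  \<open>x\<^sub>1 \<langle>\<cdot>,\<cdot>\<rangle>|\<pp>\<^sub>1 + x\<^sub>2 \<langle>\<cdot>,\<cdot>\<rangle>|\<pp>\<^sub>2 + x\<^sub>3 \<langle>\<cdot>,\<cdot>\<rangle>|\<pp>\<^sub>3\<close> on \<open>\<pp> = \<pp>\<^sub>1 \<oplus> \<pp>\<^sub>2 \<oplus> \<pp>\<^sub>3\<close>.\<close>

definition metric_params ::
    "'v::real_vector hom_space \<Rightarrow> ('v \<Rightarrow> 'v \<Rightarrow> real) \<Rightarrow> real ^ 3 \<Rightarrow> bool" where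
  "metric_params M m x \<longleftrightarrow>
     (\<forall>X Y :: 3 \<Rightarrow> 'v. (\<forall>i. X i \<in> pmod M i \<and> Y i \<in> pmod M i) \<longrightarrow>
        m (\<Sum>i\<in>UNIV. X i) (\<Sum>i\<in>UNIV. Y i) = (\<Sum>i\<in>UNIV. x $ i * ip M (X i) (Y i)))"

definition invariant_metric :: "'v::real_vector hom_space \<Rightarrow> ('v \<Rightarrow> 'v \<Rightarrow> real) \<Rightarrow> bool" where
  "invariant_metric M m \<longleftrightarrow> (\<exists>x. (\<forall>i. x $ i > 0) \<and> metric_params M m x)"

definition generic_metric :: "'v::real_vector hom_space \<Rightarrow> ('v \<Rightarrow> 'v \<Rightarrow> real) \<Rightarrow> bool" where
  "generic_metric M m \<longleftrightarrow>
     (\<exists>x. (\<forall>i. x $ i > 0) \<and> (\<forall>i j. i \<noteq> j \<longrightarrow> x $ i \<noteq> x $ j) \<and> metric_params M m x)"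

text \<open>Levi-Civita connection of the invariant metric \<open>m\<close> at the base point, as the bilinear map
  \<open>\<Lambda>(X) Y = [X, Y]\<^sub>\<pp> / 2 + U(X, Y)\<close> on \<open>\<pp>\<close> (Nomizu), where
  \<open>2 m(U(X, Y), Z) = m([Z, X]\<^sub>\<pp>, Y) + m(X, [Z, Y]\<^sub>\<pp>)\<close>; and its curvature tensor.\<close>

definition levi_civita ::
    "'v::real_vector hom_space \<Rightarrow> ('v \<Rightarrow> 'v \<Rightarrow> real) \<Rightarrow> 'v \<Rightarrow> 'v \<Rightarrow> 'v" where
  "levi_civita M m X Y = (THE W. W \<in> pp M \<and> (\<forall>Z \<in> pp M.
     2 * m W Z = m (proj_p M (bracket M X Y)) Z
       + m (proj_p M (bracket M Z X)) Y + m X (proj_p M (bracket M Z Y))))"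

definition curvature ::
    "'v::real_vector hom_space \<Rightarrow> ('v \<Rightarrow> 'v \<Rightarrow> real) \<Rightarrow> 'v \<Rightarrow> 'v \<Rightarrow> 'v \<Rightarrow> 'v" where
  "curvature M m X Y Z =
     levi_civita M m X (levi_civita M m Y Z) - levi_civita M m Y (levi_civita M m X Z)
     - levi_civita M m (proj_p M (bracket M X Y)) Z
     - bracket M (proj_h M (bracket M X Y)) Z"

definition Ric :: "'v::real_vector hom_space \<Rightarrow> ('v \<Rightarrow> 'v \<Rightarrow> real) \<Rightarrow> 'v \<Rightarrow> 'v \<Rightarrow> real" where
  "Ric M m Y Z = trace_on (pp M) (\<lambda>X. curvature M m X Y Z)"

definition ricci_operator ::
    "'v::real_vector hom_space \<Rightarrow> ('v \<Rightarrow> 'v \<Rightarrow> real) \<Rightarrow> 'v \<Rightarrow> 'v" where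
  "ricci_operator M m X = (THE Y. Y \<in> pp M \<and> (\<forall>Z \<in> pp M. m Y Z = Ric M m X Z))"

definition scalar_curvature ::
    "'v::real_vector hom_space \<Rightarrow> ('v \<Rightarrow> 'v \<Rightarrow> real) \<Rightarrow> real" where
  "scalar_curvature M m = trace_on (pp M) (ricci_operator M m)"

definition principal_ricci_curvatures ::
    "'v::real_vector hom_space \<Rightarrow> ('v \<Rightarrow> 'v \<Rightarrow> real) \<Rightarrow> real set" where
  "principal_ricci_curvatures M m =
     {r. \<exists>X \<in> pp M. X \<noteq> 0 \<and> ricci_operator M m X = r *\<^sub>R X}"

definition positive_ricci :: "'v::real_vector hom_space \<Rightarrow> ('v \<Rightarrow> 'v \<Rightarrow> real) \<Rightarrow> bool" where
  "positive_ricci M m \<longleftrightarrow> (\<forall>r \<in> principal_ricci_curvatures M m. r > 0)"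

definition mixed_ricci :: "'v::real_vector hom_space \<Rightarrow> ('v \<Rightarrow> 'v \<Rightarrow> real) \<Rightarrow> bool" where
  "mixed_ricci M m \<longleftrightarrow> (\<exists>X \<in> pp M. Ric M m X X > 0) \<and> (\<exists>X \<in> pp M. Ric M m X X < 0)"


section \<open>Normalized Ricci flow\<close>

text \<open>Solutions live on \<open>[0, T)\<close> with \<open>T\<close> possibly infinite; the derivative at \<open>0\<close> is one-sided.\<close>

definition normalized_ricci_flow ::
    "'v::real_vector hom_space \<Rightarrow> (real \<Rightarrow> 'v \<Rightarrow> 'v \<Rightarrow> real) \<Rightarrow> ereal \<Rightarrow> bool" where
  "normalized_ricci_flow M g T \<longleftrightarrow> 0 < T \<and>
     (\<forall>t. 0 \<le> t \<and> ereal t < T \<longrightarrow> invariant_metric M (g t) \<and>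
        (\<forall>X \<in> pp M. \<forall>Y \<in> pp M.
           ((\<lambda>s. g s X Y) has_real_derivative
              - 2 * Ric M (g t) X Y
              + 2 * g t X Y * (scalar_curvature M (g t) / real (dim (pp M))))
           (at t within {s. 0 \<le> s \<and> ereal s < T})))"

definition maximal_ricci_flow ::
    "'v::real_vector hom_space \<Rightarrow> (real \<Rightarrow> 'v \<Rightarrow> 'v \<Rightarrow> real) \<Rightarrow> ereal \<Rightarrow> bool" where
  "maximal_ricci_flow M g T \<longleftrightarrow> normalized_ricci_flow M g T \<and>
     \<not> (\<exists>g' T'. T < T' \<and> normalized_ricci_flow M g' T' \<and>
          (\<forall>t. 0 \<le> t \<and> ereal t < T \<longrightarrow> (\<forall>X \<in> pp M. \<forall>Y \<in> pp M. g' t X Y = g t X Y)))"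


section \<open>The Wallach space of dimension 12\<close>

definition qmat_mult :: "quat ^ 3 ^ 3 \<Rightarrow> quat ^ 3 ^ 3 \<Rightarrow> quat ^ 3 ^ 3" where
  "qmat_mult A B = (\<chi> i j. \<Sum>k\<in>UNIV. qmul (A $ i $ k) (B $ k $ j))"

text \<open>\<open>\<ss>\<pp>(3)\<close>: the skew-Hermitian quaternionic \<open>3 \<times> 3\<close> matrices.\<close>

definition sp3 :: "(quat ^ 3 ^ 3) set" where
  "sp3 = {A. \<forall>i j. A $ j $ i = - qcnj (A $ i $ j)}"

text \<open>The intermediate algebras are \<open>\<ss>\<pp>(1) \<oplus> \<ss>\<pp>(2)\<close>, embedded blockwise, with \<open>\<ss>\<pp>(1)\<close> in the
  \<open>i\<close>-th diagonal entry; so \<open>\<pp>\<^sub>i\<close> consists of the matrices supported on the two off-diagonal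
  entries outside row and column \<open>i\<close>.\<close>

definition W12 :: "(quat ^ 3 ^ 3) hom_space" where
  "W12 = \<lparr> bracket = (\<lambda>A B. qmat_mult A B - qmat_mult B A),
           lie_alg = sp3,
           isotropy = {A \<in> sp3. \<forall>i j. i \<noteq> j \<longrightarrow> A $ i $ j = 0},
           intermediate = (\<lambda>i. {A \<in> sp3. \<forall>j. j \<noteq> i \<longrightarrow> A $ i $ j = 0}) \<rparr>"


section \<open>The Wallach space of dimension 24\<close>

text \<open>The Albert algebra of Hermitian octonionic \<open>3 \<times> 3\<close> matrices, in coordinates \<open>(\<xi>, x)\<close>:
  \<open>\<xi>\<close> is the diagonal, and \<open>x\<^sub>1, x\<^sub>2, x\<^sub>3\<close> are the entries at \<open>(2,3), (3,1), (1,2)\<close>. Arithmetic on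
  the index type is modulo 3, so \<open>x\<^sub>i\<close> is the entry at \<open>(i+1, i+2)\<close>.\<close>

type_synonym albert = "(real ^ 3) \<times> (oct ^ 3)"

definition herm :: "albert \<Rightarrow> oct ^ 3 ^ 3" where
  "herm a = (\<chi> i j. if i = j then oct_of_real (fst a $ i)
                    else if j = i + 1 then snd a $ (i + 2)
                    else ocnj (snd a $ (i + 1)))"

definition herm_coords :: "oct ^ 3 ^ 3 \<Rightarrow> albert" where
  "herm_coords A = (\<chi> i. oct_Re (A $ i $ i), \<chi> i. A $ (i + 1) $ (i + 2))"

definition omat_mult :: "oct ^ 3 ^ 3 \<Rightarrow> oct ^ 3 ^ 3 \<Rightarrow> oct ^ 3 ^ 3" where
  "omat_mult A B = (\<chi> i j. \<Sum>k\<in>UNIV. omul (A $ i $ k) (B $ k $ j))"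

definition jordan :: "albert \<Rightarrow> albert \<Rightarrow> albert" where
  "jordan a b =
     herm_coords ((1/2) *\<^sub>R (omat_mult (herm a) (herm b) + omat_mult (herm b) (herm a)))"

definition idem :: "3 \<Rightarrow> albert" where
  "idem i = (axis i 1, 0)"

text \<open>\<open>F\<^sub>4\<close> is the automorphism group of the Albert algebra, \<open>Spin(9)\<close> the stabilizer of one
  diagonal idempotent, and \<open>Spin(8)\<close> the stabilizer of all three. Their Lie algebras are the
  derivations, and the derivations annihilating the respective idempotents.\<close>

definition f4 :: "(albert \<Rightarrow>\<^sub>L albert) set" where
  "f4 = {D. \<forall>a b. blinfun_apply D (jordan a b) =
              jordan (blinfun_apply D a) b + jordan a (blinfun_apply D b)}"

definition W24 :: "(albert \<Rightarrow>\<^sub>L albert) hom_space" where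
  "W24 = \<lparr> bracket = (\<lambda>C D. (C o\<^sub>L D) - (D o\<^sub>L C)),
           lie_alg = f4,
           isotropy = {D \<in> f4. \<forall>i. blinfun_apply D (idem i) = 0},
           intermediate = (\<lambda>i. {D \<in> f4. blinfun_apply D (idem i) = 0}) \<rparr>"

end

theory Submission
  imports Defs
begin

text \<open>
  Both Wallach spaces carry the same algebraic structure. The complement \<open>\<pp>\<close> of the isotropy
  algebra consists of three copies of a Euclidean space of dimension \<open>d\<close> (the quaternions for
  \<open>W12\<close>, the octonions for \<open>W24\<close>) that carries a symmetric composition algebra \<open>\<star>\<close>. The bracket of
  the copies \<open>i\<close> and \<open>i + 1\<close> lies in the copy \<open>i + 2\<close> and is a composition product; the bracket of
  two vectors of one copy lies in \<open>\<hh>\<close> and acts on that copy like the curvature of a sphere. This is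
  the locale \<open>wallach_pair\<close>, and \<open>W12\<close> and \<open>W24\<close> are instances of it. In the locale every trace can
  be evaluated: the Killing form on \<open>\<pp>\<close> is \<open>-(10 d - 8)\<close> times the Euclidean inner product
  (\<open>killing_\<Phi>\<close>), and the Ricci form is diagonal, with the principal curvatures
  \<open>r\<^sub>i = (x\<^sub>j x\<^sub>k + a (x\<^sub>i\<^sup>2 - x\<^sub>j\<^sup>2 - x\<^sub>k\<^sup>2)) / (2 x\<^sub>1 x\<^sub>2 x\<^sub>3)\<close> for \<open>a = d / (10 d - 8)\<close> (\<open>Ric_\<Phi>\<close>). For
  \<open>d = 4\<close> and \<open>d = 8\<close> this constant is \<open>1/8\<close> and \<open>1/9\<close>, and in both cases \<open>a < 1/6\<close>.

  The flow thus becomes an ordinary differential equation for the three parameters of the metric. It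
  preserves their order, say \<open>x < y < z\<close>, and their product. For the ratios \<open>u = x / z\<close> and
  \<open>v = y / z\<close> the quotient \<open>v / u\<close> grows, \<open>u\<close> tends to 0 and \<open>v\<close> to 1. Near that limit \<open>u\<close> decays with
  rate \<open>1 - 2 a\<close> and \<open>1 - v\<close> with rate \<open>4 a\<close>, so \<open>u / (1 - v)\<close> tends to 0 precisely because
  \<open>6 a < 1\<close>. The curvature in the direction of \<open>y\<close> has the sign of \<open>u - a (1 - v\<^sup>2 + u\<^sup>2)\<close>, hence is
  eventually negative for good, while the one in the direction of \<open>z\<close> is always positive
  (\<open>eventually_mixed\<close>).

  These rates refer to a rescaled time, which must run to infinity as \<open>t\<close> approaches \<open>T\<close>. For
  \<open>T = \<infinity>\<close> this follows from the conservation of \<open>x y z\<close>. For finite \<open>T\<close> it follows from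
  maximality: otherwise the parameters would stay in a compact part of the positive octant, and the
  Picard theorem would prolong the solution (\<open>ode_extension\<close>, \<open>maximal_flow_not_compact\<close>).
\<close>

section \<open>Traces on subspaces\<close>

text \<open>Linearity on a subspace only: the two projections of \<open>\<gg> = \<hh> \<oplus> \<pp>\<close>, and everything composed
  with them, are linear on \<open>\<gg>\<close> but have arbitrary values outside.\<close>

definition linear_into :: "'a::real_vector set \<Rightarrow> 'b::real_vector set \<Rightarrow> ('a \<Rightarrow> 'b) \<Rightarrow> bool" where
  "linear_into V W f \<longleftrightarrow> f ` V \<subseteq> W \<and> (\<forall>x\<in>V. \<forall>y\<in>V. f (x + y) = f x + f y)
     \<and> (\<forall>c. \<forall>x\<in>V. f (c *\<^sub>R x) = c *\<^sub>R f x)"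

definition basis_of :: "'a::real_vector set \<Rightarrow> 'a set \<Rightarrow> bool" where
  "basis_of V B \<longleftrightarrow> finite B \<and> independent B \<and> span B = V"

text \<open>The sum in \<open>trace_on\<close> for a prescribed basis in place of the chosen one.\<close>

definition trace_wrt :: "'a::real_vector set \<Rightarrow> ('a \<Rightarrow> 'a) \<Rightarrow> real" where
  "trace_wrt B f = (\<Sum>b\<in>B. representation B (f b) b)"

lemma linear_intoI:
  assumes "\<And>x. x \<in> V \<Longrightarrow> f x \<in> W" "\<And>x y. x \<in> V \<Longrightarrow> y \<in> V \<Longrightarrow> f (x + y) = f x + f y"
    "\<And>c x. x \<in> V \<Longrightarrow> f (c *\<^sub>R x) = c *\<^sub>R f x"
  shows "linear_into V W f"
  using assms unfolding linear_into_def by auto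

lemma linear_into_mem: "linear_into V W f \<Longrightarrow> x \<in> V \<Longrightarrow> f x \<in> W"
  unfolding linear_into_def by auto

lemma linear_imp_linear_into: "linear f \<Longrightarrow> f ` V \<subseteq> W \<Longrightarrow> linear_into V W f"
  unfolding linear_into_def by (auto simp: linear_add linear_scale)

lemma linear_into_subset: "linear_into V W f \<Longrightarrow> V' \<subseteq> V \<Longrightarrow> linear_into V' W f"
  by (auto simp: linear_into_def Ball_def subset_eq)

lemma linear_into_compose:
  "linear_into U V f \<Longrightarrow> linear_into V W g \<Longrightarrow> linear_into U W (\<lambda>x. g (f x))"
  unfolding linear_into_def by (auto simp: image_subset_iff)

lemma linear_into_sum:
  assumes "linear_into V W f" "subspace V" "finite S" "\<And>s. s \<in> S \<Longrightarrow> h s \<in> V"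
  shows "f (\<Sum>s\<in>S. c s *\<^sub>R h s) = (\<Sum>s\<in>S. c s *\<^sub>R f (h s))"
  using assms(3,4)
proof (induction S rule: finite_induct)
  case empty
  have "f (0 *\<^sub>R 0) = 0 *\<^sub>R f 0"
    using assms(1,2) unfolding linear_into_def by (meson subspace_0)
  then show ?case by simp
next
  case (insert s S)
  have "(\<Sum>s\<in>S. c s *\<^sub>R h s) \<in> V" "c s *\<^sub>R h s \<in> V"
    using insert.prems assms(2) by (auto intro!: subspace_sum subspace_scale)
  then show ?case
    using insert assms(1) unfolding linear_into_def by simp
qed

lemma basis_of_subspace: "basis_of V B \<Longrightarrow> subspace V"
  unfolding basis_of_def by (auto intro: subspace_span)

lemma basis_of_mem: "basis_of V B \<Longrightarrow> b \<in> B \<Longrightarrow> b \<in> V"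
  unfolding basis_of_def using span_base by auto

lemma basis_of_expand:
  "basis_of V B \<Longrightarrow> v \<in> V \<Longrightarrow> (\<Sum>b\<in>B. representation B v b *\<^sub>R b) = v"
  unfolding basis_of_def by (auto intro!: real_vector.sum_representation_eq)

lemma representation_sum_scale:
  assumes "basis_of V B" "finite S" "\<And>s. s \<in> S \<Longrightarrow> h s \<in> V"
  shows "representation B (\<Sum>s\<in>S. c s *\<^sub>R h s) b = (\<Sum>s\<in>S. c s * representation B (h s) b)"
proof -
  have i: "independent B" and sp: "\<And>s. s \<in> S \<Longrightarrow> h s \<in> span B"
    using assms unfolding basis_of_def by auto
  have "representation B (\<Sum>s\<in>S. c s *\<^sub>R h s) = (\<lambda>b. \<Sum>s\<in>S. representation B (c s *\<^sub>R h s) b)"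
    using i sp by (intro real_vector.representation_sum) (auto intro: span_scale)
  also have "\<dots> = (\<lambda>b. \<Sum>s\<in>S. c s * representation B (h s) b)"
    using i sp by (intro ext sum.cong) (auto simp: real_vector.representation_scale)
  finally show ?thesis by simp
qed

text \<open>Cyclicity of the trace, with bases of both spaces arbitrary; basis independence is the
  special case of two bases of one space and \<open>g = id\<close>.\<close>

lemma trace_wrt_cyclic:
  assumes B: "basis_of V B" and C: "basis_of W C"
    and f: "linear_into V W f" and g: "linear_into W V g"
  shows "trace_wrt B (\<lambda>x. g (f x)) = trace_wrt C (\<lambda>x. f (g x))"
proof -
  have *: "representation B (g (f b)) b
      = (\<Sum>c\<in>C. representation C (f b) c * representation B (g c) b)"
    if "basis_of V B" "basis_of W C" "linear_into V W f" "linear_into W V g" "b \<in> B"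
    for V W and B :: "'x::real_vector set" and C :: "'y::real_vector set" and f g b
  proof -
    have fb: "f b \<in> W" using that basis_of_mem linear_into_mem by metis
    have "g (f b) = g (\<Sum>c\<in>C. representation C (f b) c *\<^sub>R c)"
      by (simp add: basis_of_expand[OF that(2) fb])
    also have "\<dots> = (\<Sum>c\<in>C. representation C (f b) c *\<^sub>R g c)"
      using that by (intro linear_into_sum[OF that(4)])
        (auto simp: basis_of_def intro: basis_of_subspace basis_of_mem span_base)
    finally show ?thesis
      using that by (simp, subst representation_sum_scale[OF that(1)])
        (auto simp: basis_of_def intro: basis_of_mem linear_into_mem span_base)
  qed
  show ?thesis
    unfolding trace_wrt_def
    using *[OF B C f g] *[OF C B g f]
    by (simp add: sum.swap[of _ C B] mult.commute)
qed

lemma linear_into_id: "linear_into V V (\<lambda>x. x)"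
  unfolding linear_into_def by auto

text \<open>The basis chosen in \<open>trace_on\<close> could a priori be infinite, with a sum equal to 0 by default; it is
  finite because it is independent and spans the same space as a finite set.\<close>

lemma trace_on_eq_trace_wrt:
  assumes B: "basis_of V B" and f: "linear_into V V f"
  shows "trace_on V f = trace_wrt B f"
proof -
  define B' where "B' = (SOME B. independent B \<and> span B = V)"
  have ex: "independent B \<and> span B = V" using B unfolding basis_of_def by auto
  have B': "independent B' \<and> span B' = V"
    unfolding B'_def by (rule someI[where P = "\<lambda>B. independent B \<and> span B = V", OF ex])
  have "finite B'"
    using independent_span_bound[of B B'] B B' span_superset[of B']
    unfolding basis_of_def by auto
  then have "basis_of V B'" using B' unfolding basis_of_def by auto
  then show ?thesis
    using trace_wrt_cyclic[OF B _ f linear_into_id, of B']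
    unfolding trace_on_def Let_def B'_def[symmetric] trace_wrt_def by simp
qed

definition fin_dim :: "'a::real_vector set \<Rightarrow> bool" where
  "fin_dim V \<longleftrightarrow> (\<exists>B. basis_of V B)"

lemma fin_dim_subset:
  assumes "subspace V" "V \<subseteq> span S" "finite S"
  shows "fin_dim V"
proof -
  obtain B where B: "B \<subseteq> V" "independent B" "V \<subseteq> span B"
    using real_vector.maximal_independent_subset[of V] by blast
  have "span B = V" using B span_minimal[OF B(1) assms(1)] by auto
  moreover have "finite B"
    using independent_span_bound[of S B] assms B by auto
  ultimately show ?thesis using B unfolding fin_dim_def basis_of_def by auto
qed

lemma fin_dim_subspace: "fin_dim V \<Longrightarrow> subspace V"
  unfolding fin_dim_def using basis_of_subspace by auto

lemma trace_on_cyclic: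
  assumes "fin_dim V" "fin_dim W" and f: "linear_into V W f" and g: "linear_into W V g"
  shows "trace_on V (\<lambda>x. g (f x)) = trace_on W (\<lambda>x. f (g x))"
proof -
  obtain B C where "basis_of V B" "basis_of W C" using assms unfolding fin_dim_def by auto
  then show ?thesis
    using trace_on_eq_trace_wrt linear_into_compose trace_wrt_cyclic f g by metis
qed

lemma trace_on_add:
  assumes "fin_dim V" "linear_into V V f" "linear_into V V g"
  shows "trace_on V (\<lambda>x. f x + g x) = trace_on V f + trace_on V g"
proof -
  obtain B where B: "basis_of V B" using assms unfolding fin_dim_def by auto
  have V: "subspace V" using B basis_of_subspace by auto
  have fg: "linear_into V V (\<lambda>x. f x + g x)"
    using assms(2,3) V unfolding linear_into_def
    by (auto simp: image_subset_iff subspace_add scaleR_add_right)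
  have "trace_wrt B (\<lambda>x. f x + g x) = trace_wrt B f + trace_wrt B g"
    unfolding trace_wrt_def sum.distrib[symmetric]
  proof (rule sum.cong[OF refl])
    fix b assume "b \<in> B"
    then have "f b \<in> span B" "g b \<in> span B"
      using assms B basis_of_mem linear_into_mem unfolding basis_of_def by metis+
    then show "representation B (f b + g b) b = representation B (f b) b + representation B (g b) b"
      using B real_vector.representation_add unfolding basis_of_def by metis
  qed
  then show ?thesis using trace_on_eq_trace_wrt[OF B] assms fg by simp
qed

lemma trace_on_scale:
  assumes "fin_dim V" "linear_into V V f"
  shows "trace_on V (\<lambda>x. c *\<^sub>R f x) = c * trace_on V f"
proof -
  obtain B where B: "basis_of V B" using assms unfolding fin_dim_def by auto
  have V: "subspace V" using B basis_of_subspace by auto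
  have fg: "linear_into V V (\<lambda>x. c *\<^sub>R f x)"
    using assms(2) V unfolding linear_into_def
    by (auto simp: image_subset_iff subspace_scale scaleR_add_right)
  have "trace_wrt B (\<lambda>x. c *\<^sub>R f x) = c * trace_wrt B f"
    unfolding trace_wrt_def sum_distrib_left
  proof (rule sum.cong[OF refl])
    fix b assume "b \<in> B"
    then have "f b \<in> span B"
      using assms B basis_of_mem linear_into_mem unfolding basis_of_def by metis
    then show "representation B (c *\<^sub>R f b) b = c * representation B (f b) b"
      using B by (simp add: real_vector.representation_scale basis_of_def)
  qed
  then show ?thesis using trace_on_eq_trace_wrt[OF B] assms fg by simp
qed

lemma trace_on_diff:
  assumes "fin_dim V" "linear_into V V f" "linear_into V V g"
  shows "trace_on V (\<lambda>x. f x - g x) = trace_on V f - trace_on V g"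
proof -
  have "linear_into V V (\<lambda>x. (-1) *\<^sub>R g x)"
    using assms(3) fin_dim_subspace[OF assms(1)] unfolding linear_into_def
    by (auto simp: image_subset_iff intro: subspace_neg)
  then have "trace_on V (\<lambda>x. f x + (-1) *\<^sub>R g x) = trace_on V f + (-1) * trace_on V g"
    using trace_on_add[OF assms(1,2), of "\<lambda>x. (-1) *\<^sub>R g x"] trace_on_scale[OF assms(1,3)] by metis
  then show ?thesis by simp
qed

lemma trace_wrt_cong:
  "(\<And>x. x \<in> B \<Longrightarrow> f x = g x) \<Longrightarrow> trace_wrt B f = trace_wrt B g"
  unfolding trace_wrt_def by (auto intro: sum.cong)

lemma trace_on_cong:
  assumes "fin_dim V" "linear_into V V f" "\<And>x. x \<in> V \<Longrightarrow> f x = g x"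
  shows "trace_on V f = trace_on V g"
proof -
  obtain B where B: "basis_of V B" using assms unfolding fin_dim_def by auto
  have V: "subspace V" using B basis_of_subspace by auto
  have "linear_into V V g"
    using assms(2,3) V by (auto simp: linear_into_def image_subset_iff subspace_add subspace_scale)
  then show ?thesis
    using trace_on_eq_trace_wrt[OF B] assms trace_wrt_cong[of B f g] basis_of_mem[OF B] by auto
qed

lemma trace_on_eq_0:
  assumes "fin_dim V" "\<And>x. x \<in> V \<Longrightarrow> f x = 0"
  shows "trace_on V f = 0"
proof -
  obtain B where B: "basis_of V B" using assms unfolding fin_dim_def by auto
  have "linear_into V V f"
    using assms(2) basis_of_subspace[OF B]
    by (auto simp: linear_into_def subspace_0 subspace_add subspace_scale)
  then show ?thesis
    using B assms(2) by (simp add: trace_on_eq_trace_wrt trace_wrt_def basis_of_mem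
      real_vector.representation_zero)
qed

text \<open>A complementary pair of projections splits a trace into its diagonal blocks: each block
  \<open>f \<circ> P\<close> is moved from \<open>V\<close> to the image of \<open>P\<close> by cyclicity.\<close>

lemma trace_on_blocks:
  assumes V: "fin_dim V" "fin_dim V\<^sub>1" "fin_dim V\<^sub>2" "V\<^sub>1 \<subseteq> V" "V\<^sub>2 \<subseteq> V"
    and P: "linear_into V V\<^sub>1 P" and Q: "linear_into V V\<^sub>2 Q"
    and PQ: "\<And>x. x \<in> V \<Longrightarrow> P x + Q x = x"
    and f: "linear_into V V f"
  shows "trace_on V f = trace_on V\<^sub>1 (\<lambda>x. P (f x)) + trace_on V\<^sub>2 (\<lambda>x. Q (f x))"
proof -
  have into: "linear_into V V P" "linear_into V V Q"
    using P Q V unfolding linear_into_def by auto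
  have restr: "linear_into V\<^sub>1 V f" "linear_into V\<^sub>2 V f"
    using f V linear_into_subset by blast+
  have "trace_on V f = trace_on V (\<lambda>x. f (P x) + f (Q x))"
  proof (rule trace_on_cong[OF V(1) f])
    fix x assume x: "x \<in> V"
    then have "f (P x + Q x) = f (P x) + f (Q x)"
      using f linear_into_mem[OF into(1) x] linear_into_mem[OF into(2) x]
      unfolding linear_into_def by blast
    then show "f x = f (P x) + f (Q x)" using PQ x by simp
  qed
  also have "\<dots> = trace_on V (\<lambda>x. f (P x)) + trace_on V (\<lambda>x. f (Q x))"
    using into f linear_into_compose by (intro trace_on_add V) blast+
  also have "trace_on V (\<lambda>x. f (P x)) = trace_on V\<^sub>1 (\<lambda>x. P (f x))"
    using trace_on_cyclic[OF V(1,2) P restr(1)] by simp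
  also have "trace_on V (\<lambda>x. f (Q x)) = trace_on V\<^sub>2 (\<lambda>x. Q (f x))"
    using trace_on_cyclic[OF V(1,3) Q restr(2)] by simp
  finally show ?thesis .
qed

lemma trace_wrt_Basis:
  "trace_wrt (Basis :: 'a::euclidean_space set) A = (\<Sum>b\<in>Basis. A b \<bullet> b)"
proof -
  have "representation Basis v b = v \<bullet> b" if "b \<in> Basis" for v b :: 'a
  proof -
    have "(\<Sum>b\<in>Basis. representation Basis v b *\<^sub>R b) = v"
      by (rule real_vector.sum_representation_eq) (auto simp: independent_Basis)
    then have "v \<bullet> b = (\<Sum>c\<in>Basis. representation Basis v c *\<^sub>R c) \<bullet> b" by simp
    also have "\<dots> = representation Basis v b" using that by simp
    finally show ?thesis by simp
  qed
  then show ?thesis unfolding trace_wrt_def by simp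
qed

lemma basis_of_Basis: "basis_of (UNIV :: 'a::euclidean_space set) Basis"
  unfolding basis_of_def by (auto simp: independent_Basis)

lemma basis_of_image:
  fixes \<Phi> :: "'a::euclidean_space \<Rightarrow> 'v::real_vector"
  assumes "linear \<Phi>" "inj \<Phi>"
  shows "basis_of (range \<Phi>) (\<Phi> ` Basis)"
  unfolding basis_of_def using assms
  by (auto simp: linear_independent_injective_image independent_Basis linear_span_image)

text \<open>Every trace over \<open>\<pp>\<close> is computed through this lemma, in the coordinates \<open>\<Phi>\<close>.\<close>

lemma trace_on_range:
  fixes \<Phi> :: "'a::euclidean_space \<Rightarrow> 'v::real_vector"
  assumes \<Phi>: "linear \<Phi>" "inj \<Phi>" and A: "linear A" and f: "\<And>a. f (\<Phi> a) = \<Phi> (A a)"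
  shows "trace_on (range \<Phi>) f = (\<Sum>b\<in>Basis. A b \<bullet> b)"
proof -
  define \<Psi> where "\<Psi> = inv \<Phi>"
  have \<Psi>: "\<Psi> (\<Phi> a) = a" for a using \<Phi>(2) unfolding \<Psi>_def by simp
  have add: "\<Phi> a + \<Phi> b = \<Phi> (a + b)" and scale: "c *\<^sub>R \<Phi> a = \<Phi> (c *\<^sub>R a)" for a b c
    using \<Phi>(1) by (simp_all add: linear_add linear_scale)
  have l: "linear_into (range \<Phi>) UNIV (\<lambda>x. A (\<Psi> x))"
    by (auto simp: linear_into_def add scale \<Psi> linear_add[OF A] linear_scale[OF A])
  have fl: "linear_into (range \<Phi>) (range \<Phi>) f"
    by (auto simp: linear_into_def add scale f linear_add[OF A] linear_scale[OF A])
  have B: "basis_of (range \<Phi>) (\<Phi> ` Basis)" by (rule basis_of_image[OF \<Phi>])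
  have "trace_on (range \<Phi>) f = trace_wrt (\<Phi> ` Basis) (\<lambda>x. \<Phi> (A (\<Psi> x)))"
    unfolding trace_on_eq_trace_wrt[OF B fl] by (rule trace_wrt_cong) (auto simp: \<Psi> f)
  also have "\<dots> = trace_wrt Basis (\<lambda>a. A (\<Psi> (\<Phi> a)))"
    by (rule trace_wrt_cyclic[OF B basis_of_Basis l]) (rule linear_imp_linear_into[OF \<Phi>(1)], simp)
  finally show ?thesis by (simp add: \<Psi> trace_wrt_Basis)
qed

section \<open>Symmetric composition algebras\<close>

lemma index_3_simps [simp]:
  fixes i :: 3
  shows "i + 1 + 1 = i + 2" "i + 1 + 2 = i" "i + 2 + 1 = i" "i + 2 + 2 = i + 1"
    "i + 1 \<noteq> i" "i \<noteq> i + 1" "i + 2 \<noteq> i" "i \<noteq> i + 2" "i + 1 \<noteq> i + 2" "i + 2 \<noteq> i + 1"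
  using exhaust_3[of i] by auto

lemma numeral_3_wrap [simp]: "(4 :: 3) = 1" "(5 :: 3) = 2"
  by simp_all

lemma cases_cyclic_3:
  fixes i j :: 3 obtains "j = i" | "j = i + 1" | "j = i + 2"
  using exhaust_3[of i] exhaust_3[of j] by auto

lemma sum_Basis_vec:
  "(\<Sum>e\<in>(Basis :: ('e::euclidean_space ^ 3) set). f e) = (\<Sum>i\<in>UNIV. \<Sum>e\<in>Basis. f (axis i e))"
proof -
  have "(Basis :: ('e ^ 3) set) = (\<lambda>p. axis (fst p) (snd p)) ` (UNIV \<times> Basis)"
    unfolding Basis_vec_def by force
  moreover have "inj_on (\<lambda>p. axis (fst p) (snd p)) ((UNIV :: 3 set) \<times> (Basis :: 'e set))"
    by (auto simp: inj_on_def axis_eq_axis)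
  ultimately show ?thesis
    by (subst \<open>Basis = _\<close>, subst sum.reindex) (simp_all add: sum.cartesian_product case_prod_beta)
qed

text \<open>The para-Hurwitz product \<open>u \<star> v = u\<^sup>* v\<^sup>*\<close> of a normed division algebra has these properties. It is
  preferred to the division algebra product because it makes the three summands of \<open>\<pp>\<close>
  interchangeable: no conjugations and no distinguished index appear in the brackets.\<close>

locale symmetric_composition =
  fixes star :: "'e::euclidean_space \<Rightarrow> 'e \<Rightarrow> 'e" (infixl "\<star>" 70)
  assumes bilinear_star: "bilinear (\<star>)"
    and inner_star_assoc: "(u \<star> v) \<bullet> w = u \<bullet> (v \<star> w)"
    and norm_star: "norm (u \<star> v) = norm u * norm v"
begin

lemmas star_simps [simp] =
  bilinear_ladd[OF bilinear_star] bilinear_radd[OF bilinear_star]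
  bilinear_lmul[OF bilinear_star] bilinear_rmul[OF bilinear_star]
  bilinear_lneg[OF bilinear_star] bilinear_rneg[OF bilinear_star]
  bilinear_lsub[OF bilinear_star] bilinear_rsub[OF bilinear_star]
  bilinear_lzero[OF bilinear_star] bilinear_rzero[OF bilinear_star]

lemma star_inner_star_same: "(u \<star> v) \<bullet> (u \<star> v) = (u \<bullet> u) * (v \<bullet> v)"
  using norm_star[of u v] by (simp add: power2_norm_eq_inner[symmetric] power_mult_distrib)

lemma star_inner_left: "(u \<star> v) \<bullet> (u \<star> w) = (u \<bullet> u) * (v \<bullet> w)"
  using star_inner_star_same[of u "v + w"] star_inner_star_same[of u v] star_inner_star_same[of u w]
  by (simp add: inner_simps inner_commute algebra_simps)

lemma star_inner_right: "(v \<star> u) \<bullet> (w \<star> u) = (v \<bullet> w) * (u \<bullet> u)"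
  using star_inner_star_same[of "v + w" u] star_inner_star_same[of v u] star_inner_star_same[of w u]
  by (simp add: inner_simps inner_commute algebra_simps)

lemma star_absorb_left: "(u \<star> v) \<star> u = (u \<bullet> u) *\<^sub>R v"
proof (rule vector_eq_rdot[THEN iffD1], rule allI)
  fix w show "((u \<star> v) \<star> u) \<bullet> w = ((u \<bullet> u) *\<^sub>R v) \<bullet> w"
    by (simp add: inner_star_assoc[of "u \<star> v"] star_inner_left)
qed

lemma star_absorb_right: "u \<star> (v \<star> u) = (u \<bullet> u) *\<^sub>R v"
proof (rule vector_eq_ldot[THEN iffD1], rule allI)
  fix w show "w \<bullet> (u \<star> (v \<star> u)) = w \<bullet> ((u \<bullet> u) *\<^sub>R v)"
    using inner_star_assoc[of w u "v \<star> u"] by (simp add: star_inner_right mult.commute)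
qed

text \<open>The polarized absorption laws; they take the place of associativity.\<close>

lemma star_flip_left: "(u \<star> v) \<star> w + (w \<star> v) \<star> u = (2 * (u \<bullet> w)) *\<^sub>R v"
  using star_absorb_left[of "u + w" v] star_absorb_left[of u v] star_absorb_left[of w v]
  by (simp add: inner_simps inner_commute algebra_simps)

lemma star_flip_right: "u \<star> (v \<star> w) + w \<star> (v \<star> u) = (2 * (u \<bullet> w)) *\<^sub>R v"
  using star_absorb_right[of "u + w" v] star_absorb_right[of u v] star_absorb_right[of w v]
  by (simp add: inner_simps inner_commute algebra_simps)

text \<open>Left and right multiplications by unit vectors are isometries, so every summand of these traces
  equals \<open>b \<bullet> c\<close>.\<close>

lemma trace_star:
  "(\<Sum>e\<in>Basis. (b \<star> (e \<star> c)) \<bullet> e) = real DIM('e) * (b \<bullet> c)"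
  "(\<Sum>e\<in>Basis. ((b \<star> e) \<star> c) \<bullet> e) = real DIM('e) * (b \<bullet> c)"
proof -
  have "(b \<star> (e \<star> c)) \<bullet> e = b \<bullet> c" if "e \<in> Basis" for e
  proof -
    have "(b \<star> (e \<star> c)) \<bullet> e = (e \<star> b) \<bullet> (e \<star> c)"
      by (simp only: inner_star_assoc[of e b] inner_commute[of _ e])
    then show ?thesis using that by (simp add: star_inner_left)
  qed
  then show "(\<Sum>e\<in>Basis. (b \<star> (e \<star> c)) \<bullet> e) = real DIM('e) * (b \<bullet> c)" by simp
  have "((b \<star> e) \<star> c) \<bullet> e = b \<bullet> c" if "e \<in> Basis" for e
    using that inner_star_assoc[of "b \<star> e" c e] by (simp add: star_inner_right)
  then show "(\<Sum>e\<in>Basis. ((b \<star> e) \<star> c) \<bullet> e) = real DIM('e) * (b \<bullet> c)" by simp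
qed

end

section \<open>Three-summand pairs over a composition algebra\<close>

text \<open>The structure shared by the two Wallach spaces: \<open>\<gg>\<close> is the direct sum of \<open>\<hh>\<close> and of three copies
  \<open>\<iota>\<^sub>i(E)\<close> of a Euclidean space, with indices modulo 3. Distinct copies bracket by a composition
  algebra product. Two vectors of one copy bracket into \<open>\<hh>\<close>, and the assumption \<open>triple\<close> says how
  the result acts back: \<open>\<hh> \<oplus> \<iota>\<^sub>i(E)\<close> is the symmetric pair of a sphere of curvature 4. The
  relative size of these two kinds of bracket (1 against 4) is what determines the constant \<open>a\<close> of
  the Ricci curvature. The algebra \<open>\<hh>\<close> enters through its
  faithful action on the copies.\<close>

locale wallach_pair = symmetric_composition star
  for star :: "'e::euclidean_space \<Rightarrow> 'e \<Rightarrow> 'e" (infixl "\<star>" 70) +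
  fixes M :: "'v::real_vector hom_space" and \<iota> :: "3 \<Rightarrow> 'e \<Rightarrow> 'v"
  assumes bilinear_bracket: "bilinear (bracket M)"
    and bracket_anti: "bracket M X Y = - bracket M Y X"
    and jacobi: "bracket M (bracket M X Y) Z = bracket M X (bracket M Y Z) - bracket M Y (bracket M X Z)"
    and fin_dim_lie: "fin_dim (lie_alg M)"
    and subspace_iso: "subspace (isotropy M)"
    and iso_subset: "isotropy M \<subseteq> lie_alg M"
    and lie_closed: "X \<in> lie_alg M \<Longrightarrow> Y \<in> lie_alg M \<Longrightarrow> bracket M X Y \<in> lie_alg M"
    and iso_closed: "X \<in> isotropy M \<Longrightarrow> Y \<in> isotropy M \<Longrightarrow> bracket M X Y \<in> isotropy M"
    and linear_\<iota>: "linear (\<iota> i)"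
    and \<iota>_mem: "\<iota> i u \<in> lie_alg M"
    and decompose: "X \<in> lie_alg M \<Longrightarrow> \<exists>a. X - (\<Sum>i\<in>UNIV. \<iota> i (a $ i)) \<in> isotropy M"
    and direct: "(\<Sum>i\<in>UNIV. \<iota> i (a $ i)) \<in> isotropy M \<Longrightarrow> a = 0"
    and bracket_same: "bracket M (\<iota> i u) (\<iota> i v) \<in> isotropy M"
    and triple: "bracket M (\<iota> i u) (bracket M (\<iota> i v) (\<iota> i w))
                   = \<iota> i ((4 * (w \<bullet> u)) *\<^sub>R v - (4 * (v \<bullet> u)) *\<^sub>R w)"
    and bracket_next: "bracket M (\<iota> i u) (\<iota> (i + 1) v) = - \<iota> (i + 2) (v \<star> u)"
    and iso_action: "h \<in> isotropy M \<Longrightarrow> bracket M h (\<iota> i u) \<in> range (\<iota> i)"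
    and faithful: "h \<in> isotropy M \<Longrightarrow> (\<And>i u. bracket M h (\<iota> i u) = 0) \<Longrightarrow> h = 0"
    and intermediate_iff: "(\<Sum>j\<in>UNIV. \<iota> j (a $ j)) \<in> intermediate M i \<longleftrightarrow> (\<forall>j. j \<noteq> i \<longrightarrow> a $ j = 0)"
begin

abbreviation br :: "'v \<Rightarrow> 'v \<Rightarrow> 'v" where "br \<equiv> bracket M"

lemmas br_simps [simp] =
  bilinear_ladd[OF bilinear_bracket] bilinear_radd[OF bilinear_bracket]
  bilinear_lmul[OF bilinear_bracket] bilinear_rmul[OF bilinear_bracket]
  bilinear_lneg[OF bilinear_bracket] bilinear_rneg[OF bilinear_bracket]
  bilinear_lsub[OF bilinear_bracket] bilinear_rsub[OF bilinear_bracket]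
  bilinear_lzero[OF bilinear_bracket] bilinear_rzero[OF bilinear_bracket]

lemmas \<iota>_simps [simp] =
  linear_add[OF linear_\<iota>] linear_diff[OF linear_\<iota>] linear_neg[OF linear_\<iota>]
  linear_0[OF linear_\<iota>] linear_scale[OF linear_\<iota>]

lemma subspace_lie: "subspace (lie_alg M)"
  using fin_dim_lie fin_dim_subspace by auto

lemma fin_dim_iso: "fin_dim (isotropy M)"
proof -
  obtain B where "basis_of (lie_alg M) B" using fin_dim_lie unfolding fin_dim_def by auto
  then show ?thesis using fin_dim_subset[OF subspace_iso] iso_subset unfolding basis_of_def by metis
qed

text \<open>Coordinates on \<open>\<pp>\<close>: once \<open>\<pp> = range \<Phi>\<close> is known, the Killing form, the connection and the
  Ricci form are all pulled back along \<open>\<Phi>\<close>.\<close>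

definition \<Phi> :: "'e ^ 3 \<Rightarrow> 'v" where "\<Phi> a = (\<Sum>i\<in>UNIV. \<iota> i (a $ i))"

lemma \<Phi>_axis: "\<Phi> (axis i u) = \<iota> i u"
  using exhaust_3[of i] by (auto simp: \<Phi>_def sum_3 axis_def)

lemma linear_\<Phi>: "linear \<Phi>"
  by (rule linearI) (simp_all add: \<Phi>_def sum.distrib scaleR_right.sum)

lemmas \<Phi>_simps =
  linear_add[OF linear_\<Phi>] linear_diff[OF linear_\<Phi>] linear_neg[OF linear_\<Phi>]
  linear_0[OF linear_\<Phi>] linear_scale[OF linear_\<Phi>]

lemma \<Phi>_iso: "\<Phi> a \<in> isotropy M \<longleftrightarrow> a = 0"
  using direct[of a] subspace_0[OF subspace_iso] by (auto simp: \<Phi>_def[symmetric] \<Phi>_simps)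

lemma inj_\<Phi>: "inj \<Phi>"
  unfolding linear_injective_0[OF linear_\<Phi>] using \<Phi>_iso subspace_0[OF subspace_iso] by metis

lemma \<Phi>_eq_iff [simp]: "\<Phi> a = \<Phi> b \<longleftrightarrow> a = b"
  using inj_\<Phi> by (auto dest: injD)

lemma \<iota>_eq_iff [simp]: "\<iota> i u = \<iota> i v \<longleftrightarrow> u = v"
  by (auto simp: \<Phi>_axis[symmetric] axis_eq_axis)

lemma \<Phi>_lie: "\<Phi> a \<in> lie_alg M"
  unfolding \<Phi>_def by (intro subspace_sum subspace_lie \<iota>_mem)

text \<open>The two components of an element of \<open>\<gg>\<close>, the first one in coordinates. That they are the
  orthogonal components is the content of \<open>pp_eq\<close> below.\<close>

definition p_coords :: "'v \<Rightarrow> 'e ^ 3" where "p_coords X = (THE a. X - \<Phi> a \<in> isotropy M)"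
definition h_part :: "'v \<Rightarrow> 'v" where "h_part X = X - \<Phi> (p_coords X)"

lemma p_coords_eqI: assumes "X - \<Phi> a \<in> isotropy M" shows "p_coords X = a"
  unfolding p_coords_def
proof (rule the_equality)
  show "X - \<Phi> a \<in> isotropy M" by (rule assms)
next
  fix b assume "X - \<Phi> b \<in> isotropy M"
  then have "(X - \<Phi> b) - (X - \<Phi> a) \<in> isotropy M" using assms subspace_diff[OF subspace_iso] by blast
  then have "\<Phi> (a - b) \<in> isotropy M" by (simp add: \<Phi>_simps)
  then show "b = a" by (simp add: \<Phi>_iso)
qed

lemma h_part_iso: "X \<in> lie_alg M \<Longrightarrow> h_part X \<in> isotropy M"
  using decompose[of X] p_coords_eqI unfolding h_part_def \<Phi>_def[symmetric] by metis

lemma p_coords_split [simp]: "h \<in> isotropy M \<Longrightarrow> p_coords (h + \<Phi> a) = a"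
  by (rule p_coords_eqI) simp

lemma h_part_split [simp]: "h \<in> isotropy M \<Longrightarrow> h_part (h + \<Phi> a) = h"
  by (simp add: h_part_def)

lemma components_\<Phi> [simp]: "p_coords (\<Phi> a) = a" "h_part (\<Phi> a) = 0"
  using p_coords_split[OF subspace_0[OF subspace_iso], of a] by (simp_all add: h_part_def)

lemma components_iso [simp]: "h \<in> isotropy M \<Longrightarrow> p_coords h = 0" "h \<in> isotropy M \<Longrightarrow> h_part h = h"
  using p_coords_split[of h 0] by (simp_all add: h_part_def \<Phi>_simps)

lemma lie_cases:
  assumes "X \<in> lie_alg M" obtains h a where "h \<in> isotropy M" "X = h + \<Phi> a"
  using h_part_iso[OF assms] by (metis h_part_def diff_add_cancel)

lemma linear_into_p_coords: "linear_into (lie_alg M) UNIV p_coords"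
proof (rule linear_intoI)
  fix X Y c assume "X \<in> lie_alg M"
  from this show "p_coords (c *\<^sub>R X) = c *\<^sub>R p_coords X"
    by (auto elim!: lie_cases simp: scaleR_add_right \<Phi>_simps(5)[symmetric] subspace_scale[OF subspace_iso])
  assume "X \<in> lie_alg M" "Y \<in> lie_alg M"
  then obtain h a k b where "h \<in> isotropy M" "X = h + \<Phi> a" "k \<in> isotropy M" "Y = k + \<Phi> b"
    by (metis lie_cases)
  then show "p_coords (X + Y) = p_coords X + p_coords Y"
    using p_coords_split[of "h + k" "a + b"] by (simp add: \<Phi>_simps subspace_add[OF subspace_iso] algebra_simps)
qed auto

lemma linear_into_h_part: "linear_into (lie_alg M) (isotropy M) h_part"
  using linear_into_p_coords h_part_iso
  by (auto simp: linear_into_def h_part_def \<Phi>_simps algebra_simps)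

subsection \<open>The bracket in coordinates\<close>

text \<open>\<open>[\<Phi> a, \<Phi> b]\<close> has \<open>\<hh>\<close>-component \<open>h_bracket a b\<close> and \<open>\<pp>\<close>-component \<open>\<Phi> (\<beta> a b)\<close>, and \<open>h_action h\<close> is the
  isotropy action \<open>ad h\<close> on \<open>\<pp>\<close>.\<close>

definition h_bracket :: "'e ^ 3 \<Rightarrow> 'e ^ 3 \<Rightarrow> 'v" where
  "h_bracket a b = (\<Sum>i\<in>UNIV. br (\<iota> i (a $ i)) (\<iota> i (b $ i)))"

definition \<beta> :: "'e ^ 3 \<Rightarrow> 'e ^ 3 \<Rightarrow> 'e ^ 3" where
  "\<beta> a b = (\<chi> l. a $ (l + 2) \<star> b $ (l + 1) - b $ (l + 2) \<star> a $ (l + 1))"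

definition h_action :: "'v \<Rightarrow> 'e ^ 3 \<Rightarrow> 'e ^ 3" where
  "h_action h c = (\<chi> i. SOME v. br h (\<iota> i (c $ i)) = \<iota> i v)"

lemma h_bracket_iso: "h_bracket a b \<in> isotropy M"
  unfolding h_bracket_def by (intro subspace_sum subspace_iso bracket_same)

lemma bracket_prev: "br (\<iota> (i + 1) v) (\<iota> i u) = \<iota> (i + 2) (v \<star> u)"
  using bracket_next[of i u v] bracket_anti[of "\<iota> (i + 1) v" "\<iota> i u"] by simp

lemma br_\<Phi>: "br (\<Phi> a) (\<Phi> b) = h_bracket a b + \<Phi> (\<beta> a b)"
  using bracket_next[of 1] bracket_next[of 2] bracket_next[of 3]
    bracket_prev[of 1] bracket_prev[of 2] bracket_prev[of 3]
  by (simp add: \<Phi>_def h_bracket_def \<beta>_def sum_3)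

lemma br_iso_\<iota>:
  assumes "h \<in> isotropy M" shows "br h (\<iota> i (c $ i)) = \<iota> i (h_action h c $ i)"
proof -
  have "\<exists>v. br h (\<iota> i (c $ i)) = \<iota> i v" using iso_action[OF assms] by auto
  then show ?thesis unfolding h_action_def vec_lambda_beta by (rule someI_ex)
qed

lemma br_iso_\<Phi>:
  assumes "h \<in> isotropy M" shows "br h (\<Phi> c) = \<Phi> (h_action h c)"
  using br_iso_\<iota>[OF assms] by (simp add: \<Phi>_def sum_3)

lemma br_\<Phi>_iso:
  assumes "h \<in> isotropy M" shows "br (\<Phi> c) h = \<Phi> (- h_action h c)"
  using br_iso_\<Phi>[OF assms] bracket_anti[of "\<Phi> c" h] by (simp add: \<Phi>_simps)

lemma h_action_component:
  assumes "h \<in> isotropy M" "br h (\<iota> i (c $ i)) = \<iota> i v" shows "h_action h c $ i = v"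
  using br_iso_\<iota>[OF assms(1), of i c] assms(2) by simp

lemma linear_h_action: "h \<in> isotropy M \<Longrightarrow> linear (h_action h)"
  by (intro linearI; subst \<Phi>_eq_iff[symmetric])
    (simp_all only: \<Phi>_simps br_iso_\<Phi>[symmetric] br_simps)

lemma linear_h_bracket_left: "linear (\<lambda>a. h_bracket a b)"
  by (rule linearI) (simp_all add: h_bracket_def sum.distrib scaleR_right.sum)

lemma linear_h_bracket_right: "linear (\<lambda>b. h_bracket a b)"
  by (rule linearI) (simp_all add: h_bracket_def sum.distrib scaleR_right.sum)

lemma linear_\<beta>_left: "linear (\<lambda>a. \<beta> a b)"
  by (rule linearI) (simp_all add: \<beta>_def vec_eq_iff algebra_simps)

lemma linear_\<beta>_right: "linear (\<lambda>b. \<beta> a b)"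
  by (rule linearI) (simp_all add: \<beta>_def vec_eq_iff algebra_simps)

lemma linear_h_action_h_bracket:
  shows "linear (\<lambda>a. h_action (h_bracket a b) c)" "linear (\<lambda>b. h_action (h_bracket a b) c)"
proof -
  show "linear (\<lambda>a. h_action (h_bracket a b) c)"
    by (intro linearI; subst \<Phi>_eq_iff[symmetric]; simp only: \<Phi>_simps br_iso_\<Phi>[symmetric] h_bracket_iso)
      (simp_all add: linear_add[OF linear_h_bracket_left] linear_scale[OF linear_h_bracket_left])
  show "linear (\<lambda>b. h_action (h_bracket a b) c)"
    by (intro linearI; subst \<Phi>_eq_iff[symmetric]; simp only: \<Phi>_simps br_iso_\<Phi>[symmetric] h_bracket_iso)
      (simp_all add: linear_add[OF linear_h_bracket_right] linear_scale[OF linear_h_bracket_right])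
qed

lemma h_bracket_axis: "h_bracket (axis i e) b = br (\<iota> i e) (\<iota> i (b $ i))"
  using exhaust_3[of i] by (auto simp: h_bracket_def sum_3 axis_def)

lemma h_action_h_bracket_axis:
  "h_action (h_bracket (axis i e) b) c $ i = (4 * (e \<bullet> c $ i)) *\<^sub>R (b $ i) - (4 * (b $ i \<bullet> c $ i)) *\<^sub>R e"
proof (rule h_action_component[OF h_bracket_iso])
  show "br (h_bracket (axis i e) b) (\<iota> i (c $ i))
      = \<iota> i ((4 * (e \<bullet> c $ i)) *\<^sub>R (b $ i) - (4 * (b $ i \<bullet> c $ i)) *\<^sub>R e)"
    using triple[of i "c $ i" e "b $ i"] bracket_anti[of "h_bracket (axis i e) b" "\<iota> i (c $ i)"]
    by (simp add: h_bracket_axis)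
qed

lemma h_bracket_anti: "h_bracket a b = - h_bracket b a"
  unfolding h_bracket_def sum_negf[symmetric] by (intro sum.cong refl bracket_anti)

lemma h_action_h_bracket_anti: "h_action (h_bracket a b) c = - h_action (h_bracket b a) c"
  by (subst \<Phi>_eq_iff[symmetric], simp only: \<Phi>_simps br_iso_\<Phi>[symmetric] h_bracket_iso, subst h_bracket_anti)
    simp

text \<open>Only the part of \<open>e\<close> in the \<open>i\<close>-th summand contributes to the \<open>i\<close>-th component, and there the triple
  bracket is known explicitly.\<close>

lemma trace_h_action_h_bracket:
  "(\<Sum>e\<in>Basis. h_action (h_bracket e b) c \<bullet> e) = - (4 * (real DIM('e) - 1)) * (b \<bullet> c)"
proof -
  have "(\<Sum>e\<in>Basis. h_action (h_bracket (axis i e) b) c $ i \<bullet> e) = - (4 * (real DIM('e) - 1)) * (b $ i \<bullet> c $ i)"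
    for i
  proof -
    have "(\<Sum>e\<in>Basis. h_action (h_bracket (axis i e) b) c $ i \<bullet> e)
        = (\<Sum>e\<in>Basis. 4 * ((b $ i \<bullet> e) * (c $ i \<bullet> e)) - 4 * (b $ i \<bullet> c $ i))"
      by (intro sum.cong refl) (simp add: h_action_h_bracket_axis inner_simps inner_commute)
    also have "\<dots> = 4 * (b $ i \<bullet> c $ i) - 4 * real DIM('e) * (b $ i \<bullet> c $ i)"
      unfolding sum_subtractf sum_distrib_left[symmetric] by (simp add: euclidean_inner[of "b $ i" "c $ i"])
    finally show ?thesis by (simp add: algebra_simps)
  qed
  then show ?thesis
    unfolding inner_vec_def[of b c] by (simp add: sum_Basis_vec inner_axis sum_distrib_left)
qed

subsection \<open>The Killing form\<close>

lemma trace_range_\<Phi>: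
  "linear A \<Longrightarrow> (\<And>a. f (\<Phi> a) = \<Phi> (A a)) \<Longrightarrow> trace_on (range \<Phi>) f = (\<Sum>e\<in>Basis. A e \<bullet> e)"
  using trace_on_range[OF linear_\<Phi> inj_\<Phi>] by blast

lemma fin_dim_range: "fin_dim (range \<Phi>)"
  unfolding fin_dim_def using basis_of_image[OF linear_\<Phi> inj_\<Phi>] by blast

lemma linear_into_br: "X \<in> lie_alg M \<Longrightarrow> linear_into (lie_alg M) (lie_alg M) (br X)"
  by (rule linear_intoI) (auto intro: lie_closed)

lemma linear_into_br2:
  "X \<in> lie_alg M \<Longrightarrow> Y \<in> lie_alg M \<Longrightarrow> linear_into (lie_alg M) (lie_alg M) (\<lambda>Z. br X (br Y Z))"
  by (rule linear_into_compose[OF linear_into_br linear_into_br])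

lemma linear_into_br3:
  "X \<in> lie_alg M \<Longrightarrow> Y \<in> lie_alg M \<Longrightarrow> Z \<in> lie_alg M \<Longrightarrow>
    linear_into (lie_alg M) (lie_alg M) (\<lambda>W. br X (br Y (br Z W)))"
  by (rule linear_into_compose[OF linear_into_br2 linear_into_br])

lemma killing_sym:
  "X \<in> lie_alg M \<Longrightarrow> Y \<in> lie_alg M \<Longrightarrow> killing M X Y = killing M Y X"
  unfolding killing_def
  by (rule trace_on_cyclic[OF fin_dim_lie fin_dim_lie linear_into_br linear_into_br])

text \<open>Cyclicity of the trace turns the Jacobi identity into invariance.\<close>

lemma killing_invariant:
  assumes "X \<in> lie_alg M" "Y \<in> lie_alg M" "Z \<in> lie_alg M"
  shows "killing M (br X Y) Z = killing M X (br Y Z)"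
proof -
  have "killing M (br X Y) Z
      = trace_on (lie_alg M) (\<lambda>W. br X (br Y (br Z W))) - trace_on (lie_alg M) (\<lambda>W. br Y (br X (br Z W)))"
    unfolding killing_def jacobi[of X Y]
    using assms by (intro trace_on_diff fin_dim_lie linear_into_br3)
  moreover have "killing M X (br Y Z)
      = trace_on (lie_alg M) (\<lambda>W. br X (br Y (br Z W))) - trace_on (lie_alg M) (\<lambda>W. br X (br Z (br Y W)))"
    unfolding killing_def jacobi[of Y Z] br_simps
    using assms by (intro trace_on_diff fin_dim_lie linear_into_br3)
  moreover have "trace_on (lie_alg M) (\<lambda>W. br Y (br X (br Z W)))
      = trace_on (lie_alg M) (\<lambda>W. br X (br Z (br Y W)))"
    using assms by (intro trace_on_cyclic[OF fin_dim_lie fin_dim_lie] linear_into_br linear_into_br2)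
  ultimately show ?thesis by simp
qed

lemma killing_add:
  assumes "X \<in> lie_alg M" "Y \<in> lie_alg M" "Z \<in> lie_alg M"
  shows "killing M (X + Y) Z = killing M X Z + killing M Y Z"
  unfolding killing_def br_simps using assms by (intro trace_on_add fin_dim_lie linear_into_br2)

lemma linear_into_\<Phi>_cc: "linear_into (lie_alg M) (range \<Phi>) (\<lambda>X. \<Phi> (p_coords X))"
  using linear_into_compose[OF linear_into_p_coords linear_imp_linear_into[OF linear_\<Phi>]] by blast

lemma killing_blocks:
  assumes "X \<in> lie_alg M" "Y \<in> lie_alg M"
  shows "killing M X Y = trace_on (isotropy M) (\<lambda>Z. h_part (br X (br Y Z)))
      + trace_on (range \<Phi>) (\<lambda>Z. \<Phi> (p_coords (br X (br Y Z))))"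
  unfolding killing_def
  using assms \<Phi>_lie
  by (intro trace_on_blocks fin_dim_lie fin_dim_iso fin_dim_range iso_subset linear_into_h_part
      linear_into_\<Phi>_cc linear_into_br2) (auto simp: h_part_def)

definition killing_scale :: real where "killing_scale = 10 * real DIM('e) - 8"

lemma killing_scale_pos: "killing_scale > 0"
proof -
  have "real DIM('e) \<ge> 1" using DIM_positive[where 'a='e] by linarith
  then show ?thesis unfolding killing_scale_def by linarith
qed

text \<open>Cyclicity moves the diagonal block over \<open>\<hh>\<close> to \<open>\<pp>\<close>, where the brackets are explicit. For two vectors of one
  summand it then equals the contribution of that summand, \<open>-4 (d - 1)\<close> times their inner product,
  while the two other summands contribute \<open>-d\<close> each. Together this is \<open>-(10 d - 8)\<close>.\<close>

lemma killing_\<Phi>: "killing M (\<Phi> a) (\<Phi> b) = - killing_scale * (a \<bullet> b)"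
proof -
  let ?d = "real DIM('e)"
  have f: "linear_into (isotropy M) (range \<Phi>) (br (\<Phi> b))"
    by (rule linear_intoI) (auto simp: br_\<Phi>_iso)
  have g: "linear_into (range \<Phi>) (isotropy M) (\<lambda>Z. h_part (br (\<Phi> a) Z))"
    using linear_into_subset[OF linear_into_compose[OF linear_into_br[OF \<Phi>_lie] linear_into_h_part]] \<Phi>_lie
    by blast
  have "trace_on (isotropy M) (\<lambda>Z. h_part (br (\<Phi> a) (br (\<Phi> b) Z)))
      = trace_on (range \<Phi>) (\<lambda>Z. br (\<Phi> b) (h_part (br (\<Phi> a) Z)))"
    by (rule trace_on_cyclic[OF fin_dim_iso fin_dim_range f g])
  also have "\<dots> = (\<Sum>e\<in>Basis. h_action (h_bracket e a) b \<bullet> e)"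
    by (rule trace_range_\<Phi>)
      (simp_all add: linear_h_action_h_bracket br_\<Phi> h_bracket_iso br_\<Phi>_iso h_action_h_bracket_anti[of a])
  also have "\<dots> = - (4 * (?d - 1)) * (a \<bullet> b)" by (rule trace_h_action_h_bracket)
  finally have 1: "trace_on (isotropy M) (\<lambda>Z. h_part (br (\<Phi> a) (br (\<Phi> b) Z))) = - (4 * (?d - 1)) * (a \<bullet> b)" .
  have lin: "linear (\<lambda>c. \<beta> a (\<beta> b c))"
    using linear_compose[OF linear_\<beta>_right linear_\<beta>_right] by (simp add: o_def)
  have "trace_on (range \<Phi>) (\<lambda>Z. \<Phi> (p_coords (br (\<Phi> a) (br (\<Phi> b) Z))))
      = (\<Sum>e\<in>Basis. (\<beta> a (\<beta> b e) + h_action (h_bracket e b) a) \<bullet> e)"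
  proof (rule trace_range_\<Phi>)
    show "linear (\<lambda>c. \<beta> a (\<beta> b c) + h_action (h_bracket c b) a)"
      by (intro linear_compose_add lin linear_h_action_h_bracket)
    fix c
    have "br (\<Phi> a) (br (\<Phi> b) (\<Phi> c)) = h_bracket a (\<beta> b c) + \<Phi> (\<beta> a (\<beta> b c) - h_action (h_bracket b c) a)"
      by (simp add: br_\<Phi> h_bracket_iso br_\<Phi>_iso \<Phi>_simps)
    then show "\<Phi> (p_coords (br (\<Phi> a) (br (\<Phi> b) (\<Phi> c)))) = \<Phi> (\<beta> a (\<beta> b c) + h_action (h_bracket c b) a)"
      by (simp add: h_bracket_iso h_action_h_bracket_anti[of b c])
  qed
  also have "\<dots> = (\<Sum>e\<in>Basis. \<beta> a (\<beta> b e) \<bullet> e) - (4 * (?d - 1)) * (a \<bullet> b)"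
    by (simp add: inner_add_left sum.distrib trace_h_action_h_bracket inner_commute[of b a] algebra_simps)
  also have "(\<Sum>e\<in>Basis. \<beta> a (\<beta> b e) \<bullet> e) = - 2 * ?d * (a \<bullet> b)"
  proof -
    have "(\<Sum>e\<in>Basis. \<beta> a (\<beta> b (axis i e)) $ i \<bullet> e)
        = - ?d * (a $ (i + 2) \<bullet> b $ (i + 2)) - ?d * (a $ (i + 1) \<bullet> b $ (i + 1))" for i
    proof -
      have "(\<Sum>e\<in>Basis. \<beta> a (\<beta> b (axis i e)) $ i \<bullet> e)
        = (\<Sum>e\<in>Basis. - ((a $ (i + 2) \<star> (e \<star> b $ (i + 2))) \<bullet> e) - ((b $ (i + 1) \<star> e) \<star> a $ (i + 1)) \<bullet> e)"
        by (intro sum.cong refl) (simp add: \<beta>_def axis_def inner_simps)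
      also have "\<dots> = - ?d * (a $ (i + 2) \<bullet> b $ (i + 2)) - ?d * (a $ (i + 1) \<bullet> b $ (i + 1))"
        by (simp add: sum_subtractf sum_negf trace_star inner_commute[of "b $ (i + 1)" "a $ (i + 1)"])
      finally show ?thesis .
    qed
    then have "(\<Sum>e\<in>Basis. \<beta> a (\<beta> b e) \<bullet> e) = (\<Sum>i\<in>UNIV. - ?d * (a $ (i + 2) \<bullet> b $ (i + 2)) - ?d * (a $ (i + 1) \<bullet> b $ (i + 1)))"
      by (simp add: sum_Basis_vec inner_axis)
    also have "\<dots> = - 2 * ?d * (a \<bullet> b)"
      by (simp add: inner_vec_def sum_3 algebra_simps)
    finally show ?thesis .
  qed
  finally show ?thesis using 1 killing_blocks[OF \<Phi>_lie \<Phi>_lie, of a b] by (simp add: killing_scale_def algebra_simps)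
qed

text \<open>\<open>ad h\<close> preserves every summand of \<open>\<gg>\<close> and \<open>ad (\<Phi> b)\<close> preserves none, so their product has no
  diagonal blocks.\<close>

lemma killing_iso_\<Phi>:
  assumes "h \<in> isotropy M" shows "killing M h (\<Phi> b) = 0"
proof -
  have "h_part (br h (br (\<Phi> b) Z)) = 0" if "Z \<in> isotropy M" for Z
    using that assms by (simp add: br_\<Phi>_iso br_iso_\<Phi>)
  then have 1: "trace_on (isotropy M) (\<lambda>Z. h_part (br h (br (\<Phi> b) Z))) = 0"
    by (rule trace_on_eq_0[OF fin_dim_iso])
  have "trace_on (range \<Phi>) (\<lambda>Z. \<Phi> (p_coords (br h (br (\<Phi> b) Z)))) = (\<Sum>e\<in>Basis. h_action h (\<beta> b e) \<bullet> e)"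
  proof (rule trace_range_\<Phi>)
    show "linear (\<lambda>c. h_action h (\<beta> b c))"
      using linear_compose[OF linear_\<beta>_right linear_h_action[OF assms]] by (simp add: o_def)
    fix c show "\<Phi> (p_coords (br h (br (\<Phi> b) (\<Phi> c)))) = \<Phi> (h_action h (\<beta> b c))"
      using assms by (simp add: br_\<Phi> br_iso_\<Phi> iso_closed h_bracket_iso)
  qed
  also have "\<dots> = 0"
  proof -
    have "h_action h (\<beta> b (axis i e)) $ i = 0" for i e
      by (rule h_action_component[OF assms]) (simp add: \<beta>_def axis_def)
    then show ?thesis by (simp add: sum_Basis_vec inner_axis)
  qed
  finally show ?thesis
    using 1 killing_blocks[of h "\<Phi> b"] assms iso_subset \<Phi>_lie by auto
qed

text \<open>The nontrivial inclusion is nondegeneracy of the Killing form on \<open>\<hh>\<close>. For \<open>h\<close> in its radical,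
  invariance gives \<open>B([h, X], [h, X]) = B(h, [X, [h, X]]) = 0\<close> for \<open>X\<close> in a summand; the form is
  definite on \<open>\<pp>\<close>, so \<open>h\<close> acts trivially and vanishes by faithfulness.\<close>

lemma pp_eq: "pp M = range \<Phi>"
proof (intro equalityI subsetI)
  fix X assume "X \<in> range \<Phi>"
  then show "X \<in> pp M"
    using killing_iso_\<Phi> killing_sym iso_subset \<Phi>_lie by (auto simp: pp_def ip_def)
next
  fix X assume X: "X \<in> pp M"
  then obtain h a where h: "h \<in> isotropy M" "X = h + \<Phi> a"
    unfolding pp_def using lie_cases by blast
  have hY: "killing M h Y = 0" if "Y \<in> isotropy M" for Y
    using X h that killing_add[of h "\<Phi> a" Y] killing_iso_\<Phi>[OF that, of a] killing_sym[of Y "\<Phi> a"]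
      iso_subset \<Phi>_lie by (auto simp: pp_def ip_def)
  have "h = 0"
  proof (rule faithful[OF h(1)])
    fix i u
    obtain v where v: "br h (\<iota> i u) = \<iota> i v" using iso_action[OF h(1), of i u] by auto
    have "killing M h (br (\<iota> i u) (\<iota> i v)) = killing M (\<iota> i v) (\<iota> i v)"
      using killing_invariant[of h "\<iota> i u" "\<iota> i v"] h iso_subset \<iota>_mem v by auto
    then have "killing_scale * (v \<bullet> v) = 0"
      using hY[OF bracket_same] killing_\<Phi>[of "axis i v" "axis i v"] by (simp add: \<Phi>_axis inner_axis_axis)
    then show "br h (\<iota> i u) = 0" using v killing_scale_pos by simp
  qed
  then show "X \<in> range \<Phi>" using h by simp
qed

lemma ip_\<Phi>: "ip M (\<Phi> a) (\<Phi> b) = killing_scale * (a \<bullet> b)"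
  by (simp add: ip_def killing_\<Phi>)

lemma pmod_eq: "pmod M i = range (\<iota> i)"
proof (intro equalityI subsetI)
  fix X assume "X \<in> pmod M i"
  then obtain a where a: "X = \<Phi> a" "\<And>j. j \<noteq> i \<Longrightarrow> a $ j = 0"
    unfolding pmod_def pp_eq using intermediate_iff by (auto simp: \<Phi>_def)
  then have "a = axis i (a $ i)" by (auto simp: vec_eq_iff axis_def)
  then show "X \<in> range (\<iota> i)" using a(1) \<Phi>_axis by (metis rangeI)
next
  fix X assume "X \<in> range (\<iota> i)"
  then obtain u where "X = \<iota> i u" by auto
  moreover have "\<iota> i u \<in> intermediate M i"
    using intermediate_iff[of "axis i u" i] unfolding \<Phi>_def[symmetric] \<Phi>_axis
    by (simp add: axis_def)
  moreover have "\<iota> i u \<in> range \<Phi>" using \<Phi>_axis by (metis rangeI)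
  ultimately show "X \<in> pmod M i" unfolding pmod_def pp_eq by simp
qed

end

text \<open>The curvature \<open>r\<^sub>i\<close> in the direction of \<open>\<pp>\<^sub>i\<close> of the metric with parameters \<open>x\<close>.\<close>

definition principal_ricci :: "real \<Rightarrow> real ^ 3 \<Rightarrow> 3 \<Rightarrow> real" where
  "principal_ricci a x i =
     (x $ (i + 1) * x $ (i + 2) + a * ((x $ i)\<^sup>2 - (x $ (i + 1))\<^sup>2 - (x $ (i + 2))\<^sup>2))
      / (2 * x $ 1 * x $ 2 * x $ 3)"

context wallach_pair
begin

subsection \<open>Invariant metrics, their connection and Ricci curvature\<close>

lemma ip_\<iota>: "ip M (\<iota> i u) (\<iota> i v) = killing_scale * (u \<bullet> v)"
  by (simp only: \<Phi>_axis[symmetric] ip_\<Phi>) (simp add: inner_axis_axis)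

lemma metric_params_iff:
  "metric_params M m x \<longleftrightarrow> (\<forall>a b. m (\<Phi> a) (\<Phi> b) = (\<Sum>i\<in>UNIV. x $ i * (killing_scale * (a $ i \<bullet> b $ i))))"
  (is "?L \<longleftrightarrow> ?R")
proof
  assume L: ?L
  show ?R
  proof (intro allI)
    fix a b
    have "\<forall>i. \<iota> i (a $ i) \<in> pmod M i \<and> \<iota> i (b $ i) \<in> pmod M i" by (simp add: pmod_eq)
    then have "m (\<Phi> a) (\<Phi> b) = (\<Sum>i\<in>UNIV. x $ i * ip M (\<iota> i (a $ i)) (\<iota> i (b $ i)))"
      unfolding \<Phi>_def
      by (intro L[unfolded metric_params_def, rule_format, of "\<lambda>i. \<iota> i (a $ i)" "\<lambda>i. \<iota> i (b $ i)"]) simp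
    then show "m (\<Phi> a) (\<Phi> b) = (\<Sum>i\<in>UNIV. x $ i * (killing_scale * (a $ i \<bullet> b $ i)))"
      by (simp add: ip_\<iota>)
  qed
next
  assume R: ?R
  show ?L
    unfolding metric_params_def
  proof (intro allI impI)
    fix X Y :: "3 \<Rightarrow> 'v" assume "\<forall>i. X i \<in> pmod M i \<and> Y i \<in> pmod M i"
    then have "\<forall>i. \<exists>u. X i = \<iota> i u" "\<forall>i. \<exists>u. Y i = \<iota> i u" by (auto simp: pmod_eq)
    then obtain a b where ab: "\<And>i. X i = \<iota> i (a i)" "\<And>i. Y i = \<iota> i (b i)" by metis
    have "m (\<Phi> (\<chi> i. a i)) (\<Phi> (\<chi> i. b i)) = (\<Sum>i\<in>UNIV. x $ i * (killing_scale * (a i \<bullet> b i)))"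
      using R by simp
    then show "m (\<Sum>i\<in>UNIV. X i) (\<Sum>i\<in>UNIV. Y i) = (\<Sum>i\<in>UNIV. x $ i * ip M (X i) (Y i))"
      by (simp add: ab \<Phi>_def ip_\<iota>)
  qed
qed

lemma proj_p_eq: "X \<in> lie_alg M \<Longrightarrow> proj_p M X = \<Phi> (p_coords X)"
  unfolding proj_p_def pp_eq
proof (rule the_equality)
  assume X: "X \<in> lie_alg M"
  then show "\<Phi> (p_coords X) \<in> range \<Phi> \<and> X - \<Phi> (p_coords X) \<in> isotropy M"
    using h_part_iso[of X] by (simp add: h_part_def)
  fix Y assume "Y \<in> range \<Phi> \<and> X - Y \<in> isotropy M"
  then show "Y = \<Phi> (p_coords X)" using p_coords_eqI by auto
qed

lemma proj_br [simp]:
  "proj_p M (br (\<Phi> a) (\<Phi> b)) = \<Phi> (\<beta> a b)" "proj_h M (br (\<Phi> a) (\<Phi> b)) = h_bracket a b"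
  using lie_closed[OF \<Phi>_lie \<Phi>_lie] by (simp_all add: proj_h_def proj_p_eq) (simp_all add: br_\<Phi> h_bracket_iso)

text \<open>Invariance of the inner product makes the three terms of the Koszul formula for
  \<open>X \<in> \<pp>\<^sub>i\<close>, \<open>Y \<in> \<pp>\<^sub>j\<close>, \<open>Z \<in> \<pp>\<^sub>k\<close> multiples of \<open>\<langle>[X, Y], Z\<rangle>\<close>, with coefficients \<open>x\<^sub>k\<close>, \<open>- x\<^sub>i\<close> and \<open>x\<^sub>j\<close>.
  Hence \<open>\<Lambda>(X) Y = \<mu>\<^sub>i\<^sub>j [X, Y]\<close>, and \<open>\<Lambda>(X) Y = 0\<close> for \<open>i = j\<close>. In \<open>\<mu>\<close> the third index is minus the
  sum of the other two, modulo 3.\<close>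

definition \<mu> :: "real ^ 3 \<Rightarrow> 3 \<Rightarrow> 3 \<Rightarrow> real" where
  "\<mu> x i j = (let k = - i - j in (x $ k + x $ j - x $ i) / (2 * x $ k))"

definition \<Lambda> :: "real ^ 3 \<Rightarrow> 'e ^ 3 \<Rightarrow> 'e ^ 3 \<Rightarrow> 'e ^ 3" where
  "\<Lambda> x a b = (\<chi> l. \<mu> x (l + 2) (l + 1) *\<^sub>R (a $ (l + 2) \<star> b $ (l + 1))
                 - \<mu> x (l + 1) (l + 2) *\<^sub>R (b $ (l + 2) \<star> a $ (l + 1)))"

lemma \<mu>_simps:
  fixes i :: 3
  shows "\<mu> x (i + 2) (i + 1) = (x $ i + x $ (i + 1) - x $ (i + 2)) / (2 * x $ i)"
    "\<mu> x (i + 1) (i + 2) = (x $ i + x $ (i + 2) - x $ (i + 1)) / (2 * x $ i)"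
    "\<mu> x i (i + 1) = (x $ (i + 2) + x $ (i + 1) - x $ i) / (2 * x $ (i + 2))"
    "\<mu> x (i + 1) i = (x $ (i + 2) + x $ i - x $ (i + 1)) / (2 * x $ (i + 2))"
    "\<mu> x i (i + 2) = (x $ (i + 1) + x $ (i + 2) - x $ i) / (2 * x $ (i + 1))"
    "\<mu> x (i + 2) i = (x $ (i + 1) + x $ i - x $ (i + 2)) / (2 * x $ (i + 1))"
proof -
  have "- (i + 2) - (i + 1) = i" "- (i + 1) - (i + 2) = i" "- i - (i + 1) = i + 2"
    "- (i + 1) - i = i + 2" "- i - (i + 2) = i + 1" "- (i + 2) - i = i + 1"
    using exhaust_3[of i] by auto
  then show "\<mu> x (i + 2) (i + 1) = (x $ i + x $ (i + 1) - x $ (i + 2)) / (2 * x $ i)"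
    "\<mu> x (i + 1) (i + 2) = (x $ i + x $ (i + 2) - x $ (i + 1)) / (2 * x $ i)"
    "\<mu> x i (i + 1) = (x $ (i + 2) + x $ (i + 1) - x $ i) / (2 * x $ (i + 2))"
    "\<mu> x (i + 1) i = (x $ (i + 2) + x $ i - x $ (i + 1)) / (2 * x $ (i + 2))"
    "\<mu> x i (i + 2) = (x $ (i + 1) + x $ (i + 2) - x $ i) / (2 * x $ (i + 1))"
    "\<mu> x (i + 2) i = (x $ (i + 1) + x $ i - x $ (i + 2)) / (2 * x $ (i + 1))"
    by (simp_all only: \<mu>_def Let_def)
qed

lemma metric_nondegenerate:
  assumes m: "metric_params M m x" and x: "\<And>i. x $ i > 0"
    and eq: "\<And>c. m (\<Phi> a) (\<Phi> c) = m (\<Phi> b) (\<Phi> c)"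
  shows "a = b"
proof -
  have "a $ i \<bullet> u = b $ i \<bullet> u" for i u
    using eq[of "axis i u"] m x[of i] killing_scale_pos
    by (simp add: metric_params_iff axis_def if_distrib if_distribR cong: if_cong)
  then have "a $ i = b $ i" for i using vector_eq_rdot[of "a $ i" "b $ i"] by blast
  then show ?thesis by (simp add: vec_eq_iff)
qed

lemma star_cyclic: "(u \<star> v) \<bullet> w = (w \<star> u) \<bullet> v"
  using inner_star_assoc[of w u v] by (simp add: inner_commute)

text \<open>Each term of the Koszul formula is rewritten with the third argument \<open>c\<close> outside, so that the
  terms can be collected.\<close>

lemma inner_\<beta>:
  "\<beta> a b $ i \<bullet> c $ i = (a $ (i + 2) \<star> b $ (i + 1)) \<bullet> c $ i - (b $ (i + 2) \<star> a $ (i + 1)) \<bullet> c $ i"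
  "\<beta> c a $ i \<bullet> b $ i = (a $ (i + 1) \<star> b $ i) \<bullet> c $ (i + 2) - (b $ i \<star> a $ (i + 2)) \<bullet> c $ (i + 1)"
  "a $ i \<bullet> \<beta> c b $ i = (b $ (i + 1) \<star> a $ i) \<bullet> c $ (i + 2) - (a $ i \<star> b $ (i + 2)) \<bullet> c $ (i + 1)"
  using star_cyclic[of "a $ (i + 1)" "b $ i" "c $ (i + 2)"] star_cyclic[of "b $ (i + 1)" "a $ i" "c $ (i + 2)"]
    star_cyclic[of "a $ (i + 2)" "c $ (i + 1)" "b $ i"] star_cyclic[of "b $ (i + 2)" "c $ (i + 1)" "a $ i"]
  by (simp_all add: \<beta>_def inner_diff_left inner_diff_right inner_commute[of "a $ i"])

lemma levi_civita_\<Phi>: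
  assumes m: "metric_params M m x" and x: "\<And>i. x $ i > 0"
  shows "levi_civita M m (\<Phi> a) (\<Phi> b) = \<Phi> (\<Lambda> x a b)"
proof -
  have m\<Phi>: "m (\<Phi> a) (\<Phi> b) = killing_scale * (\<Sum>i\<in>UNIV. x $ i * (a $ i \<bullet> b $ i))" for a b
    using m by (simp add: metric_params_iff sum_distrib_left algebra_simps)
  have key: "2 * m (\<Phi> (\<Lambda> x a b)) (\<Phi> c)
      = m (\<Phi> (\<beta> a b)) (\<Phi> c) + m (\<Phi> (\<beta> c a)) (\<Phi> b) + m (\<Phi> a) (\<Phi> (\<beta> c b))" for c
  proof -
    have l: "2 * (x $ l * (\<Lambda> x a b $ l \<bullet> c $ l))
       = (x $ l + x $ (l + 1) - x $ (l + 2)) * ((a $ (l + 2) \<star> b $ (l + 1)) \<bullet> c $ l)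
       - (x $ l + x $ (l + 2) - x $ (l + 1)) * ((b $ (l + 2) \<star> a $ (l + 1)) \<bullet> c $ l)" for l
      using x[of l] by (simp add: \<Lambda>_def \<mu>_simps inner_simps field_simps)
    have "2 * (\<Sum>i\<in>UNIV. x $ i * (\<Lambda> x a b $ i \<bullet> c $ i)) = (\<Sum>i\<in>UNIV. 2 * (x $ i * (\<Lambda> x a b $ i \<bullet> c $ i)))"
      by (rule sum_distrib_left)
    also have "\<dots> = (\<Sum>i\<in>UNIV. x $ i * (\<beta> a b $ i \<bullet> c $ i)) + (\<Sum>i\<in>UNIV. x $ i * (\<beta> c a $ i \<bullet> b $ i))
      + (\<Sum>i\<in>UNIV. x $ i * (a $ i \<bullet> \<beta> c b $ i))"
      unfolding l inner_\<beta>[where a = a and b = b and c = c] sum_3 by (simp add: algebra_simps)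
    finally show ?thesis unfolding m\<Phi> by (simp add: algebra_simps)
  qed
  show ?thesis
    unfolding levi_civita_def pp_eq
  proof (rule the_equality)
    show "\<Phi> (\<Lambda> x a b) \<in> range \<Phi> \<and> (\<forall>Z\<in>range \<Phi>. 2 * m (\<Phi> (\<Lambda> x a b)) Z =
        m (proj_p M (br (\<Phi> a) (\<Phi> b))) Z + m (proj_p M (br Z (\<Phi> a))) (\<Phi> b) + m (\<Phi> a) (proj_p M (br Z (\<Phi> b))))"
      using key by auto
  next
    fix W assume W: "W \<in> range \<Phi> \<and> (\<forall>Z\<in>range \<Phi>. 2 * m W Z =
        m (proj_p M (br (\<Phi> a) (\<Phi> b))) Z + m (proj_p M (br Z (\<Phi> a))) (\<Phi> b) + m (\<Phi> a) (proj_p M (br Z (\<Phi> b))))"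
    then obtain w where w: "W = \<Phi> w" by auto
    have "2 * m (\<Phi> w) (\<Phi> c) = 2 * m (\<Phi> (\<Lambda> x a b)) (\<Phi> c)" for c
      using W w key[of c] by simp
    then have "w = \<Lambda> x a b" using metric_nondegenerate[OF m x] by simp
    then show "W = \<Phi> (\<Lambda> x a b)" using w by simp
  qed
qed

lemma linear_\<Lambda>_left: "linear (\<lambda>a. \<Lambda> x a b)"
  by (rule linearI) (simp_all add: \<Lambda>_def vec_eq_iff algebra_simps)

lemma linear_\<Lambda>_right: "linear (\<lambda>b. \<Lambda> x a b)"
  by (rule linearI) (simp_all add: \<Lambda>_def vec_eq_iff algebra_simps)

definition wallach_const :: real where "wallach_const = real DIM('e) / killing_scale"

text \<open>In the trace over \<open>e\<close>, the term \<open>\<Lambda>(e) \<Lambda>(b) c\<close> drops out because \<open>\<Lambda>(e)\<close> has no component in the summand of \<open>e\<close>.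
  The terms \<open>\<Lambda>(b) \<Lambda>(e) c\<close> and \<open>\<Lambda>([e, b]) c\<close> reduce to \<open>trace_star\<close>, and the isotropy term
  is \<open>trace_h_action_h_bracket\<close>. The coefficient of \<open>b\<^sub>i \<bullet> c\<^sub>i\<close> becomes
  \<open>4 (d - 1) + d + d (x\<^sub>i\<^sup>2 - x\<^sub>j\<^sup>2 - x\<^sub>k\<^sup>2) / (2 x\<^sub>j x\<^sub>k)\<close>, which is the Killing scale \<open>10 d - 8\<close>
  times \<open>x\<^sub>i r\<^sub>i\<close> for \<open>a = d / (10 d - 8)\<close>.\<close>

lemma Ric_\<Phi>:
  assumes m: "metric_params M m x" and x: "\<And>i. x $ i > 0"
  shows "Ric M m (\<Phi> b) (\<Phi> c) = (\<Sum>i\<in>UNIV. killing_scale * x $ i * principal_ricci wallach_const x i * (b $ i \<bullet> c $ i))"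
proof -
  let ?d = "real DIM('e)"
  define R where "R a = \<Lambda> x a (\<Lambda> x b c) - \<Lambda> x b (\<Lambda> x a c) - \<Lambda> x (\<beta> a b) c - h_action (h_bracket a b) c" for a
  have linR: "linear R"
    unfolding R_def
    using linear_compose[OF linear_\<Lambda>_left linear_\<Lambda>_right] linear_compose[OF linear_\<beta>_left linear_\<Lambda>_left]
    by (intro linear_compose_sub linear_h_action_h_bracket linear_\<Lambda>_left) (simp_all add: o_def)
  have cR: "curvature M m (\<Phi> a) (\<Phi> b) (\<Phi> c) = \<Phi> (R a)" for a
    unfolding curvature_def R_def
    by (simp add: levi_civita_\<Phi>[OF m x] br_iso_\<Phi> h_bracket_iso \<Phi>_simps)
  have "Ric M m (\<Phi> b) (\<Phi> c) = (\<Sum>e\<in>Basis. R e \<bullet> e)"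
    unfolding Ric_def pp_eq by (rule trace_range_\<Phi>[OF linR cR])
  also have "\<dots> = (\<Sum>e\<in>Basis. (\<Lambda> x e (\<Lambda> x b c) - \<Lambda> x b (\<Lambda> x e c) - \<Lambda> x (\<beta> e b) c) \<bullet> e) + 4 * (?d - 1) * (b \<bullet> c)"
  proof -
    have "R e \<bullet> e = (\<Lambda> x e (\<Lambda> x b c) - \<Lambda> x b (\<Lambda> x e c) - \<Lambda> x (\<beta> e b) c) \<bullet> e - h_action (h_bracket e b) c \<bullet> e" for e
      by (simp add: R_def inner_diff_left)
    then show ?thesis by (simp only: sum_subtractf trace_h_action_h_bracket)
  qed
  also have "(\<Sum>e\<in>Basis. (\<Lambda> x e (\<Lambda> x b c) - \<Lambda> x b (\<Lambda> x e c) - \<Lambda> x (\<beta> e b) c) \<bullet> e)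
     = (\<Sum>i\<in>UNIV. - \<mu> x (i + 2) (i + 1) * \<mu> x i (i + 2) * (?d * (b $ (i + 2) \<bullet> c $ (i + 2)))
         - \<mu> x (i + 1) (i + 2) * \<mu> x i (i + 1) * (?d * (b $ (i + 1) \<bullet> c $ (i + 1)))
         + \<mu> x (i + 2) (i + 1) * (?d * (b $ (i + 1) \<bullet> c $ (i + 1)))
         + \<mu> x (i + 1) (i + 2) * (?d * (b $ (i + 2) \<bullet> c $ (i + 2))))" (is "_ = (\<Sum>i\<in>UNIV. ?T i)")
  proof -
    have "(\<Sum>e\<in>Basis. (\<Lambda> x (axis i e) (\<Lambda> x b c) - \<Lambda> x b (\<Lambda> x (axis i e) c) - \<Lambda> x (\<beta> (axis i e) b) c) $ i \<bullet> e) = ?T i" for i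
    proof -
      have *: "(\<Lambda> x (axis i e) (\<Lambda> x b c) - \<Lambda> x b (\<Lambda> x (axis i e) c) - \<Lambda> x (\<beta> (axis i e) b) c) $ i \<bullet> e =
        - \<mu> x (i + 2) (i + 1) * \<mu> x i (i + 2) * ((b $ (i + 2) \<star> (e \<star> c $ (i + 2))) \<bullet> e)
         - \<mu> x (i + 1) (i + 2) * \<mu> x i (i + 1) * (((c $ (i + 1) \<star> e) \<star> b $ (i + 1)) \<bullet> e)
         + \<mu> x (i + 2) (i + 1) * (((b $ (i + 1) \<star> e) \<star> c $ (i + 1)) \<bullet> e)
         + \<mu> x (i + 1) (i + 2) * ((c $ (i + 2) \<star> (e \<star> b $ (i + 2))) \<bullet> e)" for e
        by (simp add: \<Lambda>_def \<beta>_def axis_def inner_simps)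
      show ?thesis
        unfolding * sum.distrib sum_subtractf sum_distrib_left[symmetric] trace_star
        by (simp add: inner_commute)
    qed
    then show ?thesis by (simp add: sum_Basis_vec inner_axis)
  qed
  also have "(\<Sum>i\<in>UNIV. ?T i) = (\<Sum>i\<in>UNIV. (- \<mu> x (i + 1) i * \<mu> x i (i + 2) - \<mu> x (i + 2) i * \<mu> x i (i + 1)
       + \<mu> x (i + 2) i + \<mu> x (i + 1) i) * (?d * (b $ i \<bullet> c $ i)))"
    by (simp add: sum_3 algebra_simps)
  also have "\<dots> + 4 * (?d - 1) * (b \<bullet> c) = (\<Sum>i\<in>UNIV. ((- \<mu> x (i + 1) i * \<mu> x i (i + 2) - \<mu> x (i + 2) i * \<mu> x i (i + 1)
       + \<mu> x (i + 2) i + \<mu> x (i + 1) i) * ?d + 4 * (?d - 1)) * (b $ i \<bullet> c $ i))"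
    unfolding inner_vec_def sum_distrib_left sum.distrib[symmetric] by (intro sum.cong) (simp_all add: algebra_simps)
  also have "\<dots> = (\<Sum>i\<in>UNIV. killing_scale * x $ i * principal_ricci wallach_const x i * (b $ i \<bullet> c $ i))"
  proof (rule sum.cong[OF refl])
    fix i :: 3
    have alg: "(- ((z + p - y) / (2 * z)) * ((y + z - p) / (2 * y)) - (y + p - z) / (2 * y) * ((z + y - p) / (2 * z))
       + (y + p - z) / (2 * y) + (z + p - y) / (2 * z)) * D + 4 * (D - 1)
      = K * p * ((y * z + D / K * (p\<^sup>2 - y\<^sup>2 - z\<^sup>2)) / (2 * (p * y * z)))"
      if "p > 0" "y > 0" "z > 0" "K > 0" "K = 10 * D - 8" for p y z D K :: real
    proof -
      have "K * p * ((y * z + D / K * (p\<^sup>2 - y\<^sup>2 - z\<^sup>2)) / (2 * (p * y * z)))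
          = (K * (y * z) + D * (p\<^sup>2 - y\<^sup>2 - z\<^sup>2)) / (2 * (y * z))"
        using that by (simp add: field_simps)
      also have "\<dots> = ((10 * D - 8) * (y * z) + D * (p\<^sup>2 - y\<^sup>2 - z\<^sup>2)) / (2 * (y * z))"
        using that by simp
      also have "\<dots> = (- ((z + p - y) / (2 * z)) * ((y + z - p) / (2 * y)) - (y + p - z) / (2 * y) * ((z + y - p) / (2 * z))
          + (y + p - z) / (2 * y) + (z + p - y) / (2 * z)) * D + 4 * (D - 1)"
        using that(1-3) by (simp add: field_simps power2_eq_square)
      finally show ?thesis by (rule sym)
    qed
    have prod: "x $ 1 * x $ 2 * x $ 3 = x $ i * x $ (i + 1) * x $ (i + 2)"
      using exhaust_3[of i] by auto
    have "(- \<mu> x (i + 1) i * \<mu> x i (i + 2) - \<mu> x (i + 2) i * \<mu> x i (i + 1)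
       + \<mu> x (i + 2) i + \<mu> x (i + 1) i) * ?d + 4 * (?d - 1) = killing_scale * x $ i * principal_ricci wallach_const x i"
      unfolding principal_ricci_def wallach_const_def \<mu>_simps
      using alg[of "x $ i" "x $ (i + 1)" "x $ (i + 2)" killing_scale ?d] x killing_scale_pos prod by (simp add: killing_scale_def mult.assoc)
    then show "((- \<mu> x (i + 1) i * \<mu> x i (i + 2) - \<mu> x (i + 2) i * \<mu> x i (i + 1)
       + \<mu> x (i + 2) i + \<mu> x (i + 1) i) * ?d + 4 * (?d - 1)) * (b $ i \<bullet> c $ i) = killing_scale * x $ i * principal_ricci wallach_const x i * (b $ i \<bullet> c $ i)"
      by simp
  qed
  finally show ?thesis .
qed

lemma ricci_operator_\<Phi>:
  assumes m: "metric_params M m x" and x: "\<And>i. x $ i > 0"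
  shows "ricci_operator M m (\<Phi> b) = \<Phi> (\<chi> i. principal_ricci wallach_const x i *\<^sub>R b $ i)"
  unfolding ricci_operator_def pp_eq
proof (rule the_equality)
  have key: "m (\<Phi> (\<chi> i. principal_ricci wallach_const x i *\<^sub>R b $ i)) (\<Phi> c) = Ric M m (\<Phi> b) (\<Phi> c)" for c
    using m unfolding metric_params_iff by (simp add: Ric_\<Phi>[OF m x] algebra_simps)
  then show "\<Phi> (\<chi> i. principal_ricci wallach_const x i *\<^sub>R b $ i) \<in> range \<Phi> \<and> (\<forall>Z\<in>range \<Phi>. m (\<Phi> (\<chi> i. principal_ricci wallach_const x i *\<^sub>R b $ i)) Z = Ric M m (\<Phi> b) Z)"
    by auto
  fix Y assume "Y \<in> range \<Phi> \<and> (\<forall>Z\<in>range \<Phi>. m Y Z = Ric M m (\<Phi> b) Z)"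
  then show "Y = \<Phi> (\<chi> i. principal_ricci wallach_const x i *\<^sub>R b $ i)"
    using metric_nondegenerate[OF m x] key by auto
qed

lemma scalar_curvature_eq:
  assumes m: "metric_params M m x" and x: "\<And>i. x $ i > 0"
  shows "scalar_curvature M m = real DIM('e) * (\<Sum>i\<in>UNIV. principal_ricci wallach_const x i)"
proof -
  have "scalar_curvature M m = (\<Sum>e\<in>Basis. ((\<chi> i. principal_ricci wallach_const x i *\<^sub>R e $ i) :: 'e ^ 3) \<bullet> e)"
    unfolding scalar_curvature_def pp_eq
    by (rule trace_range_\<Phi>)
      (auto intro!: linearI simp: ricci_operator_\<Phi>[OF m x] vec_eq_iff algebra_simps)
  also have "\<dots> = (\<Sum>i\<in>UNIV. \<Sum>e\<in>(Basis :: 'e set). principal_ricci wallach_const x i)"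
    unfolding sum_Basis_vec by (intro sum.cong refl) (simp add: inner_axis)
  finally show ?thesis by (simp add: sum_distrib_left)
qed

lemma dim_pp: "dim (pp M) = 3 * DIM('e)"
proof -
  have "dim (range \<Phi>) = dim (UNIV :: ('e ^ 3) set)"
    by (rule dim_image_eq[OF linear_\<Phi>]) (use inj_\<Phi> in \<open>auto simp: inj_on_def\<close>)
  then show ?thesis by (simp add: pp_eq)
qed

end

section \<open>Long-time behaviour of the three parameters\<close>

text \<open>For scalar functions ordered by size it is more convenient to name the three parameters than to
  index them; \<open>ric3 a p q s\<close> is the curvature in the direction whose parameter is \<open>p\<close>.\<close>

definition ric3 :: "real \<Rightarrow> real \<Rightarrow> real \<Rightarrow> real \<Rightarrow> real" where
  "ric3 a p q s = (q * s + a * (p\<^sup>2 - q\<^sup>2 - s\<^sup>2)) / (2 * p * q * s)"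

definition mean3 :: "real \<Rightarrow> real \<Rightarrow> real \<Rightarrow> real \<Rightarrow> real" where
  "mean3 a p q s = (ric3 a p q s + ric3 a q s p + ric3 a s p q) / 3"

definition lifespan :: "ereal \<Rightarrow> real set" where "lifespan T = {s. 0 \<le> s \<and> ereal s < T}"

lemma lifespan_down: "t \<in> lifespan T \<Longrightarrow> 0 \<le> s \<Longrightarrow> s \<le> t \<Longrightarrow> s \<in> lifespan T"
  unfolding lifespan_def by (auto intro: le_less_trans[of "ereal s" "ereal t"])

lemma lifespan_interval: "s \<in> lifespan T \<Longrightarrow> t \<in> lifespan T \<Longrightarrow> {s..t} \<subseteq> lifespan T"
  using lifespan_down by (auto simp: lifespan_def intro: le_less_trans)

lemma nonincreasing_on_lifespan:
  assumes d: "\<And>t. t \<in> lifespan T \<Longrightarrow> (f has_real_derivative f' t) (at t within lifespan T)"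
    and s: "s \<in> lifespan T" and t: "t \<in> lifespan T" "s \<le> t"
    and le: "\<And>u. s \<le> u \<Longrightarrow> u \<in> lifespan T \<Longrightarrow> f' u \<le> 0"
  shows "f t \<le> f s"
proof -
  have "\<exists>u\<in>{s..t}. f t - f s = (\<lambda>h. f' u * h) (t - s)"
  proof (rule mvt_very_simple[OF t(2), where f' = "\<lambda>u h. f' u * h"])
    fix u assume "s \<le> u" "u \<le> t"
    then have "u \<in> lifespan T" using lifespan_interval[OF s t(1)] by auto
    then show "(f has_derivative (\<lambda>h. f' u * h)) (at u within {s..t})"
      using has_field_derivative_subset[OF d lifespan_interval[OF s t(1)]]
      by (simp add: has_field_derivative_def)
  qed
  then obtain u where u: "u \<in> {s..t}" "f t - f s = f' u * (t - s)" by auto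
  then have "f' u \<le> 0" using le lifespan_interval[OF s t(1)] by auto
  then show ?thesis using u t(2) mult_nonpos_nonneg[of "f' u" "t - s"] by simp
qed

text \<open>A solution of the linear equation \<open>D' = g D\<close> never changes sign: \<open>D exp (-G)\<close> is constant for
  an antiderivative \<open>G\<close> of \<open>g\<close>.\<close>

lemma linear_ode_pos:
  fixes D g :: "real \<Rightarrow> real"
  assumes d: "\<And>s. s \<in> {0..t} \<Longrightarrow> (D has_real_derivative D s * g s) (at s within {0..t})"
    and g: "continuous_on {0..t} g" and t: "0 \<le> t" and D0: "D 0 > 0"
  shows "D t > 0"
proof -
  define G where "G s = integral {0..s} g" for s
  have G: "(G has_real_derivative g s) (at s within {0..t})" if "s \<in> {0..t}" for s
    unfolding G_def has_real_derivative_iff_has_vector_derivative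
    by (rule integral_has_vector_derivative[OF g that])
  have "((\<lambda>s. D s * exp (- G s)) has_real_derivative 0) (at s within {0..t})" if "s \<in> {0..t}" for s
    by (rule derivative_eq_intros d[OF that] G[OF that] refl | simp)+
  then have "\<exists>c. \<forall>s\<in>{0..t}. D s * exp (- G s) = c"
    by (intro has_field_derivative_zero_constant) auto
  then have "D t * exp (- G t) = D 0 * exp (- G 0)" using t by fastforce
  then have "D t * exp (- G t) > 0" using D0 by simp
  then show ?thesis by (simp add: zero_less_mult_iff)
qed

locale wallach_flow =
  fixes a :: real and T :: ereal and x y z :: "real \<Rightarrow> real"
  assumes T_pos: "0 < T"
    and pos: "t \<in> lifespan T \<Longrightarrow> 0 < x t" "t \<in> lifespan T \<Longrightarrow> 0 < y t" "t \<in> lifespan T \<Longrightarrow> 0 < z t"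
    and dx: "t \<in> lifespan T \<Longrightarrow> (x has_real_derivative
          - 2 * x t * (ric3 a (x t) (y t) (z t) - mean3 a (x t) (y t) (z t))) (at t within lifespan T)"
    and dy: "t \<in> lifespan T \<Longrightarrow> (y has_real_derivative
          - 2 * y t * (ric3 a (y t) (z t) (x t) - mean3 a (x t) (y t) (z t))) (at t within lifespan T)"
    and dz: "t \<in> lifespan T \<Longrightarrow> (z has_real_derivative
          - 2 * z t * (ric3 a (z t) (x t) (y t) - mean3 a (x t) (y t) (z t))) (at t within lifespan T)"
begin

lemma zero_mem: "0 \<in> lifespan T" using T_pos by (simp add: lifespan_def zero_ereal_def)

text \<open>The metrics with \<open>x = y\<close> are invariant under the flow: \<open>y - x\<close> solves a linear equation along
  any given solution.\<close>

lemma order_preserved: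
  assumes "x 0 < y 0" and t: "t \<in> lifespan T"
  shows "x t < y t"
proof -
  define g where "g s = 2 * mean3 a (x s) (y s) (z s)
    - a * ((x s + y s)\<^sup>2 - (z s)\<^sup>2) / (x s * y s * z s)" for s
  have sub: "{0..t} \<subseteq> lifespan T" using lifespan_interval[OF zero_mem t] .
  have c: "continuous_on {0..t} x" "continuous_on {0..t} y" "continuous_on {0..t} z"
    using dx dy dz sub
    by (meson DERIV_continuous continuous_on_eq_continuous_within continuous_on_subset)+
  have alg: "2 * (q * ric3 a q s p - p * ric3 a p q s) = (q - p) * (a * ((p + q)\<^sup>2 - s\<^sup>2) / (p * q * s))"
    if "p > 0" "q > 0" "s > 0" for p q s
    using that unfolding ric3_def by (simp add: field_simps power2_eq_square power3_eq_cube)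
  have alg2: "- 2 * q * (ric3 a q s p - m) - - 2 * p * (ric3 a p q s - m)
      = (q - p) * (2 * m - a * ((p + q)\<^sup>2 - s\<^sup>2) / (p * q * s))"
    if "p > 0" "q > 0" "s > 0" for p q s m
  proof -
    have "- 2 * q * (ric3 a q s p - m) - - 2 * p * (ric3 a p q s - m)
        = (q - p) * (2 * m) - 2 * (q * ric3 a q s p - p * ric3 a p q s)" by (simp add: algebra_simps)
    also have "\<dots> = (q - p) * (2 * m) - (q - p) * (a * ((p + q)\<^sup>2 - s\<^sup>2) / (p * q * s))"
      by (simp only: alg[OF that])
    finally show ?thesis by (simp only: right_diff_distrib)
  qed
  have "y t - x t > 0"
  proof (rule linear_ode_pos[where D = "\<lambda>s. y s - x s" and g = g])
    fix s assume "s \<in> {0..t}"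
    then have s: "s \<in> lifespan T" using sub by auto
    show "((\<lambda>s. y s - x s) has_real_derivative (y s - x s) * g s) (at s within {0..t})"
      unfolding g_def alg2[OF pos[OF s], symmetric]
      by (intro DERIV_diff has_field_derivative_subset[OF dx[OF s] sub]
          has_field_derivative_subset[OF dy[OF s] sub])
  next
    have "x s \<noteq> 0" "y s \<noteq> 0" "z s \<noteq> 0" if "s \<in> {0..t}" for s
      using pos[of s] sub that by fastforce+
    then show "continuous_on {0..t} g"
      unfolding g_def mean3_def ric3_def by (intro continuous_intros c ballI) auto
  qed (use assms t in \<open>auto simp: lifespan_def\<close>)
  then show ?thesis by simp
qed

lemma volume_const:
  assumes "t \<in> lifespan T" shows "x t * y t * z t = x 0 * y 0 * z 0"
proof -
  have "((\<lambda>s. x s * y s * z s) has_real_derivative 0) (at s within lifespan T)" if s: "s \<in> lifespan T" for s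
    by (rule derivative_eq_intros dx[OF s] dy[OF s] dz[OF s] refl)+
      (simp add: mean3_def field_simps)
  moreover have "convex (lifespan T)"
    unfolding is_interval_convex_1[symmetric] is_interval_1
    by (meson atLeastAtMost_iff lifespan_interval subsetD)
  ultimately have "\<exists>c. \<forall>s\<in>lifespan T. x s * y s * z s = c"
    by (intro has_field_derivative_zero_constant) auto
  then show ?thesis using assms zero_mem by metis
qed

end

text \<open>Up to scaling a metric is the point \<open>(u, v) = (x / z, y / z)\<close> of the triangle \<open>0 < u < v < 1\<close>. In
  the time \<open>\<tau>\<close> with \<open>d\<tau> = k dt\<close> its motion is autonomous:
  \<open>(ln u)' = - (1 - u) (v - 2 a (1 + u))\<close> and \<open>(ln v)' = (1 - v) (2 a (1 + v) - u)\<close>.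
  The quotient \<open>v / u\<close> always increases, so its logarithm \<open>L\<close> can replace \<open>\<tau>\<close> as a clock.\<close>

locale ordered_wallach_flow = wallach_flow +
  assumes ordered_0: "x 0 < y 0" "y 0 < z 0" and a: "0 < a" "a < 1 / 6"
begin

lemma ordered: assumes "t \<in> lifespan T" shows "x t < y t" "y t < z t"
proof -
  show "x t < y t" by (rule order_preserved[OF ordered_0(1) assms])
  have "wallach_flow a T y z x"
    using T_pos pos dx dy dz
    by unfold_locales (simp_all add: mean3_def add.commute add.left_commute)
  then show "y t < z t" using wallach_flow.order_preserved ordered_0(2) assms by blast
qed

definition V where "V = x 0 * y 0 * z 0"
definition u where "u t = x t / z t"
definition v where "v t = y t / z t"
definition k where "k t = (z t)\<^sup>2 / V"
definition L where "L t = ln (v t) - ln (u t)"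

lemma V_pos: "V > 0" unfolding V_def using pos[OF zero_mem] by simp

lemma k_pos: "t \<in> lifespan T \<Longrightarrow> k t > 0"
  unfolding k_def using pos(3)[of t] V_pos by simp

lemma uv: assumes "t \<in> lifespan T" shows "0 < u t" "u t < v t" "v t < 1"
  using ordered[OF assms] pos[OF assms] by (simp_all add: u_def v_def divide_strict_right_mono)

lemma ric_diff:
  assumes "t \<in> lifespan T"
  shows "2 * (ric3 a (x t) (y t) (z t) - ric3 a (z t) (x t) (y t)) = k t * ((1 - u t) * (v t - 2 * a * (1 + u t)))"
    and "2 * (ric3 a (y t) (z t) (x t) - ric3 a (z t) (x t) (y t)) = - k t * ((1 - v t) * (2 * a * (1 + v t) - u t))"
proof -
  have z: "z t \<noteq> 0" and x: "x t = u t * z t" and y: "y t = v t * z t"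
    using pos[OF assms] by (auto simp: u_def v_def)
  have nz: "u t \<noteq> 0" "v t \<noteq> 0" using uv[OF assms] by auto
  have V: "V = x t * y t * z t" unfolding V_def using volume_const[OF assms] by simp
  have k: "k t = 1 / (u t * v t * z t)"
    unfolding k_def V x y using z nz by (simp add: power2_eq_square)
  show "2 * (ric3 a (x t) (y t) (z t) - ric3 a (z t) (x t) (y t)) = k t * ((1 - u t) * (v t - 2 * a * (1 + u t)))"
    unfolding k ric3_def x y using z nz by (simp add: field_simps power2_eq_square)
  show "2 * (ric3 a (y t) (z t) (x t) - ric3 a (z t) (x t) (y t)) = - k t * ((1 - v t) * (2 * a * (1 + v t) - u t))"
    unfolding k ric3_def x y using z nz by (simp add: field_simps power2_eq_square)
qed

lemma ln_uv:
  assumes "t \<in> lifespan T" shows "ln (u t) = ln (x t) - ln (z t)" "ln (v t) = ln (y t) - ln (z t)"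
  using pos[OF assms] by (simp_all add: u_def v_def ln_div)

lemma d_ln_u:
  assumes t: "t \<in> lifespan T"
  shows "((\<lambda>t. ln (u t)) has_real_derivative - k t * ((1 - u t) * (v t - 2 * a * (1 + u t)))) (at t within lifespan T)"
proof -
  have "((\<lambda>t. ln (x t) - ln (z t)) has_real_derivative
      - 2 * (ric3 a (x t) (y t) (z t) - ric3 a (z t) (x t) (y t))) (at t within lifespan T)"
    by (rule derivative_eq_intros dx[OF t] dz[OF t] refl pos[OF t])+ (use pos[OF t] in \<open>simp add: field_simps\<close>)
  then have "((\<lambda>t. ln (x t) - ln (z t)) has_real_derivative
      - k t * ((1 - u t) * (v t - 2 * a * (1 + u t)))) (at t within lifespan T)"
    by (rule DERIV_cong) (use ric_diff(1)[OF t] in linarith)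
  then show ?thesis
    by (rule has_field_derivative_transform_within[OF _ zero_less_one t]) (simp add: ln_uv)
qed

lemma d_ln_v:
  assumes t: "t \<in> lifespan T"
  shows "((\<lambda>t. ln (v t)) has_real_derivative k t * ((1 - v t) * (2 * a * (1 + v t) - u t))) (at t within lifespan T)"
proof -
  have "((\<lambda>t. ln (y t) - ln (z t)) has_real_derivative
      - 2 * (ric3 a (y t) (z t) (x t) - ric3 a (z t) (x t) (y t))) (at t within lifespan T)"
    by (rule derivative_eq_intros dy[OF t] dz[OF t] refl pos[OF t])+ (use pos[OF t] in \<open>simp add: field_simps\<close>)
  then have "((\<lambda>t. ln (y t) - ln (z t)) has_real_derivative
      k t * ((1 - v t) * (2 * a * (1 + v t) - u t))) (at t within lifespan T)"
    by (rule DERIV_cong) (use ric_diff(2)[OF t] in linarith)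
  then show ?thesis
    by (rule has_field_derivative_transform_within[OF _ zero_less_one t]) (simp add: ln_uv)
qed

lemma d_L:
  assumes t: "t \<in> lifespan T"
  shows "(L has_real_derivative k t * ((v t - u t) * (1 - 2 * a * (u t + v t)))) (at t within lifespan T)"
  unfolding L_def[abs_def]
  by (rule DERIV_cong[OF DERIV_diff[OF d_ln_v[OF t] d_ln_u[OF t]]]) (simp add: algebra_simps)

lemma d_ln_w:
  assumes t: "t \<in> lifespan T"
  shows "((\<lambda>t. ln (1 - v t)) has_real_derivative - k t * (v t * (2 * a * (1 + v t) - u t))) (at t within lifespan T)"
proof -
  have ln: "((\<lambda>t. exp (ln (v t))) has_real_derivative v t * (k t * ((1 - v t) * (2 * a * (1 + v t) - u t)))) (at t within lifespan T)"
    by (rule DERIV_cong[OF DERIV_chain2[OF DERIV_exp d_ln_v[OF t]]]) (use uv[OF t] in simp)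
  have v: "(v has_real_derivative v t * (k t * ((1 - v t) * (2 * a * (1 + v t) - u t)))) (at t within lifespan T)"
    by (rule has_field_derivative_transform_within[OF ln zero_less_one t]) (use uv in force)
  have "((\<lambda>t. ln (1 - v t)) has_real_derivative
      (1 / (1 - v t)) * (0 - v t * (k t * ((1 - v t) * (2 * a * (1 + v t) - u t))))) (at t within lifespan T)"
    by (rule DERIV_chain2[where f = ln and g = "\<lambda>t. 1 - v t", OF _ DERIV_diff[OF DERIV_const v]])
      (use uv[OF t] in \<open>auto intro!: derivative_eq_intros\<close>)
  then show ?thesis by (rule DERIV_cong) (use uv[OF t] in \<open>simp add: field_simps\<close>)
qed

text \<open>The clock \<open>L\<close> compared with \<open>\<tau>\<close>: up to constants, \<open>L\<close> runs at the speed \<open>v\<close> (the lower bound is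
  \<open>L_rate_lower\<close>).\<close>

lemma L_rate:
  assumes t: "t \<in> lifespan T"
  shows "k t * ((v t - u t) * (1 - 2 * a * (u t + v t))) \<le> k t * v t"
    and "k t * ((v t - u t) * (1 - 4 * a)) \<le> k t * ((v t - u t) * (1 - 2 * a * (u t + v t)))"
    and "0 \<le> k t * ((v t - u t) * (1 - 2 * a * (u t + v t)))"
proof -
  have 1: "2 * a * (u t + v t) \<le> 2 * a * 2" using uv[OF t] a by (intro mult_left_mono) auto
  have 2: "0 \<le> a * (u t + v t)" using uv[OF t] a by simp
  have "(v t - u t) * (1 - 2 * a * (u t + v t)) \<le> v t * 1"
    using uv[OF t] 1 2 a by (intro mult_mono) linarith+
  then show "k t * ((v t - u t) * (1 - 2 * a * (u t + v t))) \<le> k t * v t"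
    using k_pos[OF t] by simp
  show le: "k t * ((v t - u t) * (1 - 4 * a)) \<le> k t * ((v t - u t) * (1 - 2 * a * (u t + v t)))"
    using uv[OF t] 1 k_pos[OF t] by (intro mult_left_mono) auto
  have "0 \<le> k t * ((v t - u t) * (1 - 4 * a))" using uv[OF t] k_pos[OF t] a by simp
  then show "0 \<le> k t * ((v t - u t) * (1 - 2 * a * (u t + v t)))" using le by linarith
qed

lemma L_mono: assumes "s \<in> lifespan T" "t \<in> lifespan T" "s \<le> t" shows "L s \<le> L t"
proof -
  have "- L t \<le> - L s"
    by (rule nonincreasing_on_lifespan[where f = "\<lambda>t. - L t", OF DERIV_minus[OF d_L] assms])
      (use L_rate(3) in auto)
  then show ?thesis by simp
qed

lemma L_0_pos: "L 0 > 0"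
  unfolding L_def using uv[OF zero_mem] by simp

lemma u_eq: "t \<in> lifespan T \<Longrightarrow> u t = v t * exp (- L t)"
  using uv[of t] unfolding L_def by (simp add: exp_diff exp_minus)

lemma z_lower: assumes t: "t \<in> lifespan T" shows "min 1 V \<le> z t"
proof (rule ccontr)
  assume "\<not> min 1 V \<le> z t"
  then have z: "z t < 1" "z t < V" by auto
  have "V = x t * y t * z t" unfolding V_def using volume_const[OF t] by simp
  also have "\<dots> \<le> 1 * 1 * z t"
    using ordered[OF t] pos[OF t] z by (intro mult_mono) auto
  finally show False using z by simp
qed

lemma gap_lower: "t \<in> lifespan T \<Longrightarrow> v t * (1 - exp (- L 0)) \<le> v t - u t"
proof -
  assume t: "t \<in> lifespan T"
  then have "L 0 \<le> L t" using L_mono[OF zero_mem t] by (simp add: lifespan_def)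
  then have "exp (- L t) \<le> exp (- L 0)" by simp
  then have "v t * exp (- L t) \<le> v t * exp (- L 0)" using uv[OF t] by (intro mult_left_mono) auto
  then show ?thesis using u_eq[OF t] by (simp add: algebra_simps)
qed

lemma L_rate_lower:
  assumes t: "t \<in> lifespan T"
  shows "(1 - exp (- L 0)) * (1 - 4 * a) * (k t * v t) \<le> k t * ((v t - u t) * (1 - 2 * a * (u t + v t)))"
proof -
  have "k t * ((v t * (1 - exp (- L 0))) * (1 - 4 * a)) \<le> k t * ((v t - u t) * (1 - 4 * a))"
    using gap_lower[OF t] k_pos[OF t] a by (intro mult_left_mono mult_right_mono) auto
  then show ?thesis using L_rate(2)[OF t] by (simp add: algebra_simps)
qed

text \<open>While the clock is bounded, \<open>u\<close> stays away from 0: by \<open>L_rate_lower\<close> and \<open>(ln u)' \<ge> - v\<close> in the time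
  \<open>\<tau>\<close>, the function \<open>ln u + C L\<close> is nondecreasing for a suitable \<open>C\<close>.\<close>

lemma u_lower:
  assumes L: "\<And>t. t \<in> lifespan T \<Longrightarrow> L t \<le> B"
  obtains e where "e > 0" "\<And>t. t \<in> lifespan T \<Longrightarrow> e \<le> u t"
proof -
  define C where "C = 1 / ((1 - exp (- L 0)) * (1 - 4 * a))"
  have c: "(1 - exp (- L 0)) * (1 - 4 * a) > 0" using L_0_pos a by simp
  then have C: "C > 0" unfolding C_def by simp
  have rate: "k t * v t \<le> C * (k t * ((v t - u t) * (1 - 2 * a * (u t + v t))))" if "t \<in> lifespan T" for t
    using L_rate_lower[OF that] c unfolding C_def by (simp add: field_simps)
  have "ln (u 0) + C * L 0 \<le> ln (u t) + C * L t" if t: "t \<in> lifespan T" for t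
  proof -
    have d: "((\<lambda>t. - (ln (u t) + C * L t)) has_real_derivative
        - (- k t * ((1 - u t) * (v t - 2 * a * (1 + u t))) + C * (k t * ((v t - u t) * (1 - 2 * a * (u t + v t))))))
        (at t within lifespan T)" if "t \<in> lifespan T" for t
      by (intro DERIV_minus DERIV_add DERIV_cmult d_L d_ln_u that)
    have "- (ln (u t) + C * L t) \<le> - (ln (u 0) + C * L 0)"
    proof (rule nonincreasing_on_lifespan[OF d zero_mem t])
      show "0 \<le> t" using t by (simp add: lifespan_def)
      fix s assume s: "s \<in> lifespan T"
      have "(1 - u s) * (v s - 2 * a * (1 + u s)) \<le> v s"
      proof -
        have "(1 - u s) * (v s - 2 * a * (1 + u s)) \<le> (1 - u s) * v s"
          using uv[OF s] a by (intro mult_left_mono) auto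
        also have "\<dots> \<le> 1 * v s" using uv[OF s] by (intro mult_right_mono) auto
        finally show ?thesis by simp
      qed
      then have "k s * ((1 - u s) * (v s - 2 * a * (1 + u s))) \<le> k s * v s" using k_pos[OF s] by simp
      then show "- (- k s * ((1 - u s) * (v s - 2 * a * (1 + u s))) + C * (k s * ((v s - u s) * (1 - 2 * a * (u s + v s))))) \<le> 0"
        using rate[OF s] by simp
    qed
    then show ?thesis by simp
  qed
  then have "ln (u 0) + C * L 0 - C * B \<le> ln (u t)" if "t \<in> lifespan T" for t
    using \<open>\<And>t. t \<in> lifespan T \<Longrightarrow> ln (u 0) + C * L 0 \<le> ln (u t) + C * L t\<close>[OF that]
      L[OF that] C mult_left_mono[of "L t" B C] by linarith
  then have "exp (ln (u 0) + C * L 0 - C * B) \<le> u t" if "t \<in> lifespan T" for t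
    using that uv[OF that] by (metis exp_le_cancel_iff exp_ln)
  then show thesis using that[of "exp (ln (u 0) + C * L 0 - C * B)"] by simp
qed

text \<open>If the clock were bounded then, by \<open>u_lower\<close> and the conservation of \<open>x y z\<close>, all three
  parameters would stay in a compact part of the positive octant. For finite \<open>T\<close> this is excluded by
  the hypothesis, which expresses maximality; for \<open>T = \<infinity>\<close> the rate of \<open>L\<close> would be bounded below by
  a positive constant.\<close>

lemma L_unbounded:
  assumes nc: "\<And>e K. T < \<infinity> \<Longrightarrow> e > 0 \<Longrightarrow>
      \<not> (\<forall>t\<in>lifespan T. e \<le> x t \<and> x t \<le> K \<and> e \<le> y t \<and> y t \<le> K \<and> e \<le> z t \<and> z t \<le> K)"
  shows "\<exists>t\<in>lifespan T. L t > B"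
proof (rule ccontr)
  assume "\<not> (\<exists>t\<in>lifespan T. L t > B)"
  then have LB: "\<And>t. t \<in> lifespan T \<Longrightarrow> L t \<le> B" by force
  obtain e where e: "e > 0" "\<And>t. t \<in> lifespan T \<Longrightarrow> e \<le> u t" using u_lower[OF LB] by blast
  have m: "min 1 V > 0" using V_pos by simp
  show False
  proof (cases "T < \<infinity>")
    case True
    have xl: "e * min 1 V \<le> x t" if t: "t \<in> lifespan T" for t
    proof -
      have "e * min 1 V \<le> u t * z t" using e(1) e(2)[OF t] z_lower[OF t] m uv[OF t] by (intro mult_mono) auto
      then show ?thesis using pos[OF t] by (simp add: u_def)
    qed
    have zu: "z t \<le> max 1 (V / e\<^sup>2)" if t: "t \<in> lifespan T" for t
    proof (rule ccontr)
      assume "\<not> z t \<le> max 1 (V / e\<^sup>2)"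
      then have z: "1 < z t" "V / e\<^sup>2 < z t" by auto
      have "e * e * z t \<le> u t * v t * z t"
        using e(2)[OF t] e(1) uv[OF t] pos[OF t] by (intro mult_right_mono mult_mono) auto
      also have "\<dots> \<le> u t * v t * z t * (z t * z t)"
        using uv[OF t] z mult_mono[of 1 "z t" 1 "z t"] by simp
      also have "\<dots> = x t * y t * z t" using pos[OF t] by (simp add: u_def v_def)
      also have "\<dots> = V" unfolding V_def by (rule volume_const[OF t])
      finally show False using z e(1) by (simp add: field_simps power2_eq_square)
    qed
    have "\<forall>t\<in>lifespan T. e * min 1 V \<le> x t \<and> x t \<le> max 1 (V / e\<^sup>2) \<and> e * min 1 V \<le> y t \<and> y t \<le> max 1 (V / e\<^sup>2)
        \<and> e * min 1 V \<le> z t \<and> z t \<le> max 1 (V / e\<^sup>2)"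
      using xl zu ordered by (meson less_eq_real_def order_trans)
    then show False using nc[OF True, of "e * min 1 V"] e(1) m by (meson mult_pos_pos)
  next
    case False
    then have T: "T = \<infinity>" by simp
    define c where "c = (1 - exp (- L 0)) * (1 - 4 * a) * ((min 1 V)\<^sup>2 / V * e)"
    have c0: "(1 - exp (- L 0)) * (1 - 4 * a) > 0" using L_0_pos a by simp
    have c: "c > 0" unfolding c_def using c0 m e V_pos by simp
    have grow: "c \<le> k t * ((v t - u t) * (1 - 2 * a * (u t + v t)))" if t: "t \<in> lifespan T" for t
    proof -
      have "(min 1 V)\<^sup>2 / V \<le> k t" unfolding k_def
        using z_lower[OF t] m V_pos by (intro divide_right_mono power_mono) auto
      moreover have "e \<le> v t" using e(2)[OF t] uv[OF t] by simp
      ultimately have "(min 1 V)\<^sup>2 / V * e \<le> k t * v t"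
        using e(1) k_pos[OF t] by (intro mult_mono) auto
      then have "c \<le> (1 - exp (- L 0)) * (1 - 4 * a) * (k t * v t)"
        unfolding c_def using c0 by (intro mult_left_mono) auto
      then show ?thesis using L_rate_lower[OF t] by linarith
    qed
    define t where "t = (\<bar>B\<bar> + 1) / c"
    have t: "t \<in> lifespan T" "0 \<le> t" using c by (auto simp: t_def lifespan_def T)
    have "c * t - L t \<le> c * 0 - L 0"
      by (rule nonincreasing_on_lifespan[OF DERIV_diff[OF DERIV_cmult_Id d_L] zero_mem t])
        (use grow in auto)
    then have "c * t \<le> B" using LB[OF t(1)] L_0_pos by simp
    then show False using c by (simp add: t_def)
  qed
qed

text \<open>As the clock \<open>L\<close> tends to infinity, \<open>u \<le> exp (- L)\<close> decays, and once \<open>u < a\<close> so does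
  \<open>w = 1 - v\<close>. Near the limit point \<open>(0, 1)\<close>, \<open>u\<close> decays in the time \<open>\<tau>\<close> with rate \<open>1 - 2 a\<close> and
  \<open>w\<close> only with rate \<open>4 a\<close>; as \<open>6 a < 1\<close>, the quotient \<open>u / w\<close> tends to 0. The middle curvature
  has the sign of \<open>u - a (w (1 + v) + u\<^sup>2)\<close> and is negative as soon as \<open>u < a w\<close>. The curvature in
  the direction of the largest parameter is always positive.\<close>

lemma eventually_mixed:
  assumes nc: "\<And>e K. T < \<infinity> \<Longrightarrow> e > 0 \<Longrightarrow>
      \<not> (\<forall>t\<in>lifespan T. e \<le> x t \<and> x t \<le> K \<and> e \<le> y t \<and> y t \<le> K \<and> e \<le> z t \<and> z t \<le> K)"
  shows "\<exists>t0. 0 < t0 \<and> ereal t0 < T \<and> (\<forall>t. t0 < t \<and> ereal t < T \<longrightarrow>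
      ric3 a (y t) (z t) (x t) < 0 \<and> ric3 a (z t) (x t) (y t) > 0)"
proof -
  note unb = L_unbounded[OF nc]
  obtain t1 where t1: "t1 \<in> lifespan T" "L t1 > - ln a" using unb by blast
  have u_small: "u t < a" if "t \<in> lifespan T" "t1 \<le> t" for t
  proof -
    have "exp (- L t) < exp (ln a)" using L_mono[OF t1(1) that] t1(2) by simp
    then have "exp (- L t) < a" using a by simp
    then have "v t * exp (- L t) < 1 * a" using uv[OF that(1)] a by (intro mult_strict_mono) auto
    then show ?thesis using u_eq[OF that(1)] by simp
  qed
  have w_decay: "ln (1 - v t) + a * L t \<le> ln (1 - v t1) + a * L t1" if "t \<in> lifespan T" "t1 \<le> t" for t
  proof (rule nonincreasing_on_lifespan[OF DERIV_add[OF d_ln_w DERIV_cmult[OF d_L]] t1(1) that])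
    fix s assume s: "t1 \<le> s" "s \<in> lifespan T"
    have "a \<le> 2 * a * (1 + v s) - u s" using u_small[OF s(2,1)] uv[OF s(2)] a
      by (smt (verit) mult_less_cancel_left2 mult_pos_pos)
    then have "k s * v s * a \<le> k s * v s * (2 * a * (1 + v s) - u s)"
      using k_pos[OF s(2)] uv[OF s(2)] by (intro mult_left_mono) auto
    moreover have "a * (k s * ((v s - u s) * (1 - 2 * a * (u s + v s)))) \<le> a * (k s * v s)"
      by (rule mult_left_mono[OF L_rate(1)[OF s(2)]]) (use a in simp)
    ultimately show "- k s * (v s * (2 * a * (1 + v s) - u s)) + a * (k s * ((v s - u s) * (1 - 2 * a * (u s + v s)))) \<le> 0"
      by (simp add: algebra_simps)
  qed
  \<comment> \<open>Half of the limiting rate \<open>1 - 6 a\<close> of \<open>u / w\<close>; this much is available as soon as \<open>w < c\<close>.\<close>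
  define c where "c = (1 - 6 * a) / 2"
  have c: "c > 0" using a by (simp add: c_def)
  obtain t2' where t2': "t2' \<in> lifespan T" "L t2' > (ln (1 - v t1) + a * L t1 - ln c) / a" using unb by blast
  define t2 where "t2 = max t1 t2'"
  have t2: "t2 \<in> lifespan T" "t1 \<le> t2" "t2' \<le> t2" using t1 t2' by (auto simp: t2_def max_def)
  have w_small: "1 - v t < c" if "t \<in> lifespan T" "t2 \<le> t" for t
  proof -
    have "L t2' \<le> L t" using that t2 L_mono[OF t2'(1) that(1)] by simp
    then have "(ln (1 - v t1) + a * L t1 - ln c) / a < L t" using t2'(2) by simp
    then have "ln (1 - v t1) + a * L t1 - ln c < a * L t" using a by (simp add: field_simps)
    then have "ln (1 - v t) < ln c" using w_decay[OF that(1)] that t2 by simp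
    then show ?thesis using uv[OF that(1)] c by simp
  qed
  have q_decay: "ln (u t) - ln (1 - v t) + c * L t \<le> ln (u t2) - ln (1 - v t2) + c * L t2"
    if "t \<in> lifespan T" "t2 \<le> t" for t
  proof (rule nonincreasing_on_lifespan[OF DERIV_add[OF DERIV_diff[OF d_ln_u d_ln_w] DERIV_cmult[OF d_L]] t2(1) that])
    fix s assume s: "t2 \<le> s" "s \<in> lifespan T"
    have sq: "v s * v s \<le> 1 * 1" using uv[OF s(2)] by (intro mult_mono) auto
    have "a * (1 + v s + v s * v s - u s * u s) \<le> a * 3"
      using uv[OF s(2)] a sq zero_le_square[of "u s"] by (intro mult_left_mono) linarith+
    then have "2 * a * (1 + v s + v s * v s - u s * u s) - v s \<le> - c"
      using w_small[OF s(2,1)] unfolding c_def by (simp add: field_simps)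
    then have "k s * (2 * a * (1 + v s + v s * v s - u s * u s) - v s) \<le> k s * (- c)"
      using k_pos[OF s(2)] by (intro mult_left_mono) auto
    moreover have "c * (k s * ((v s - u s) * (1 - 2 * a * (u s + v s)))) \<le> c * (k s * 1)"
    proof -
      have "k s * v s \<le> k s * 1" using uv[OF s(2)] k_pos[OF s(2)] by (intro mult_left_mono) auto
      then have "k s * ((v s - u s) * (1 - 2 * a * (u s + v s))) \<le> k s * 1"
        using L_rate(1)[OF s(2)] by linarith
      then show ?thesis by (rule mult_left_mono) (use c in simp)
    qed
    moreover have "k s * (- c) = - (k s * c)" "c * (k s * 1) = k s * c" by simp_all
    moreover have eq: "- k s * ((1 - u s) * (v s - 2 * a * (1 + u s))) - - k s * (v s * (2 * a * (1 + v s) - u s))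
       = k s * (2 * a * (1 + v s + v s * v s - u s * u s) - v s)" by (simp add: algebra_simps)
    ultimately show "- k s * ((1 - u s) * (v s - 2 * a * (1 + u s))) - - k s * (v s * (2 * a * (1 + v s) - u s))
        + c * (k s * ((v s - u s) * (1 - 2 * a * (u s + v s)))) \<le> 0"
      unfolding eq by linarith
  qed
  obtain t3' where t3': "t3' \<in> lifespan T" "L t3' > (ln (u t2) - ln (1 - v t2) + c * L t2 - ln a) / c" using unb by blast
  obtain r where r: "0 < r" "ereal r < T"
    using T_pos by (metis ereal_dense2 ereal_less(2) zero_ereal_def)
  \<comment> \<open>Including the arbitrary time \<open>r\<close> ensures \<open>t0 > 0\<close>.\<close>
  define t0 where "t0 = max r (max t2 t3')"
  have t0: "t0 \<in> lifespan T" "t2 \<le> t0" "t3' \<le> t0" "0 < t0"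
    using t2 t3' r by (auto simp: t0_def max_def lifespan_def)
  have "ric3 a (y t) (z t) (x t) < 0 \<and> ric3 a (z t) (x t) (y t) > 0" if "t0 < t" "ereal t < T" for t
  proof
    have t: "t \<in> lifespan T" using that t0 by (simp add: lifespan_def)
    have "L t3' \<le> L t" using that t0 L_mono[OF t3'(1) t] by simp
    then have "(ln (u t2) - ln (1 - v t2) + c * L t2 - ln a) / c < L t" using t3'(2) by simp
    then have "ln (u t2) - ln (1 - v t2) + c * L t2 - ln a < c * L t" using c by (simp add: field_simps)
    then have "ln (u t) < ln a + ln (1 - v t)" using q_decay[OF t] that t0 by simp
    also have "\<dots> = ln (a * (1 - v t))" using a uv[OF t] by (simp add: ln_mult)
    finally have "u t < a * (1 - v t)" using a uv[OF t] by simp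
    moreover have "0 \<le> a * (1 - v t) * v t" using a uv[OF t] by simp
    moreover have "0 \<le> a * (u t * u t)" using a by simp
    ultimately have "u t + a * (v t * v t - 1 - u t * u t) < 0" by (simp add: algebra_simps)
    then have "(z t)\<^sup>2 * (u t + a * (v t * v t - 1 - u t * u t)) < 0"
      using pos[OF t] by (simp add: mult_less_0_iff)
    moreover have "(z t)\<^sup>2 * (u t + a * (v t * v t - 1 - u t * u t))
        = z t * x t + a * ((y t)\<^sup>2 - (z t)\<^sup>2 - (x t)\<^sup>2)"
      using pos[OF t] by (simp add: u_def v_def field_simps power2_eq_square)
    ultimately show "ric3 a (y t) (z t) (x t) < 0"
      unfolding ric3_def using pos[OF t] by (simp add: divide_neg_pos)
    have "a * (x t * x t) \<le> 1 * (x t * y t)"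
      using a ordered[OF t] pos[OF t] by (intro mult_mono) auto
    moreover have "0 < a * (z t * z t - y t * y t)"
      using a ordered[OF t] pos[OF t] by (simp add: mult_strict_mono)
    ultimately have "0 < x t * y t + a * ((z t)\<^sup>2 - (x t)\<^sup>2 - (y t)\<^sup>2)"
      by (simp add: algebra_simps power2_eq_square)
    then show "ric3 a (z t) (x t) (y t) > 0"
      unfolding ric3_def using pos[OF t] by simp
  qed
  then show ?thesis using t0 by (auto simp: lifespan_def)
qed

end

section \<open>Prolonging solutions of ordinary differential equations\<close>

text \<open>Precomposing \<open>F\<close> with the nearest-point projection onto the ball makes it bounded and globally
  Lipschitz. Clamping the time to \<open>[0, \<delta>]\<close> makes Picard's operator a self-map of the space of all bounded continuous
  functions on the line, where Banach's fixed point theorem applies; the fixed point cannot leave the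
  ball before time \<open>\<delta>\<close>, so the projection has no effect on it.\<close>

lemma local_solution_exists:
  fixes F :: "'a::euclidean_space \<Rightarrow> 'a"
  assumes \<rho>: "\<rho> > 0" and lip: "C-lipschitz_on (cball p \<rho>) F"
  shows "\<exists>\<delta>>0. \<exists>Z. Z 0 = p \<and> (\<forall>t\<in>{0..\<delta>}. Z t \<in> cball p \<rho> \<and>
     (Z has_vector_derivative F (Z t)) (at t within {0..\<delta>}))"
proof -
  define G where "G q = F (closest_point (cball p \<rho>) q)" for q
  have cp: "closest_point (cball p \<rho>) q \<in> cball p \<rho>" for q
    using \<rho> by (intro closest_point_in_set) auto
  have C: "C \<ge> 0" using lip by (rule lipschitz_on_nonneg)
  have G_lip: "norm (G q - G r) \<le> C * dist q r" for q r
  proof -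
    have "dist (closest_point (cball p \<rho>) q) (closest_point (cball p \<rho>) r) \<le> dist q r"
      using \<rho> by (intro closest_point_lipschitz) auto
    then show ?thesis
      using lipschitz_onD[OF lip cp[of q] cp[of r]] C unfolding G_def dist_norm[symmetric]
      by (meson mult_left_mono order_trans)
  qed
  have G_cont: "continuous_on S G" for S
  proof -
    have "C-lipschitz_on S G" by (rule lipschitz_onI[OF _ C]) (use G_lip in \<open>simp add: dist_norm\<close>)
    then show ?thesis by (rule lipschitz_on_continuous_on)
  qed
  define B where "B = norm (F p) + C * \<rho>"
  have B: "B \<ge> 0" unfolding B_def using C \<rho> by simp
  have G_bound: "norm (G q) \<le> B" for q
  proof -
    have "norm (G q - F p) \<le> C * dist (closest_point (cball p \<rho>) q) p"
      using lipschitz_onD[OF lip cp[of q], of p] \<rho> unfolding G_def by (simp add: dist_norm)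
    also have "\<dots> \<le> C * \<rho>" using cp[of q] C by (intro mult_left_mono) (auto simp: dist_commute)
    finally show ?thesis unfolding B_def using norm_triangle_sub[of "G q" "F p"] by simp
  qed
  \<comment> \<open>The first bound makes the operator a contraction by \<open>1/2\<close>, the second one confines the solution
    to the ball.\<close>
  define \<delta> where "\<delta> = min (1 / (2 * (C + 1))) (\<rho> / (B + 1))"
  have \<delta>: "\<delta> > 0" "C * \<delta> \<le> 1 / 2" "B * \<delta> \<le> \<rho>"
  proof -
    show \<delta>: "\<delta> > 0" unfolding \<delta>_def using C B \<rho> by simp
    have "C * \<delta> \<le> (C + 1) * (1 / (2 * (C + 1)))"
      unfolding \<delta>_def using C B \<rho> by (intro mult_mono) auto
    also have "\<dots> = 1 / 2" using C by (simp add: field_simps)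
    finally show "C * \<delta> \<le> 1 / 2" .
    have "B * \<delta> \<le> (B + 1) * (\<rho> / (B + 1))"
      unfolding \<delta>_def using C B \<rho> by (intro mult_mono) auto
    then show "B * \<delta> \<le> \<rho>" using B by simp
  qed
  define c where "c t = max 0 (min t \<delta>)" for t
  have c: "c t \<in> {0..\<delta>}" for t using \<delta> by (auto simp: c_def)
  have c_cont: "continuous_on UNIV c" unfolding c_def by (intro continuous_intros)
  define J where "J f t = integral {0..t} (\<lambda>s. G (apply_bcontfun f s))"
    for f :: "real \<Rightarrow>\<^sub>C 'a" and t :: real
  have Gf_cont: "continuous_on S (\<lambda>s. G (apply_bcontfun f s))" for f and S :: "real set"
    by (rule continuous_on_compose2[OF G_cont[of UNIV]]) auto
  have J_bound: "norm (J f t) \<le> B * \<delta>" if "t \<in> {0..\<delta>}" for f t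
  proof -
    have "norm (J f t) \<le> B * (t - 0)"
      unfolding J_def using that by (intro integral_bound Gf_cont G_bound) auto
    also have "\<dots> \<le> B * \<delta>" using that B by (intro mult_left_mono) auto
    finally show ?thesis .
  qed
  have J_cont: "continuous_on {0..\<delta>} (J f)" for f
    unfolding J_def by (intro indefinite_integral_continuous_1 integrable_continuous_interval Gf_cont)
  define P where "P f = Bcontfun (\<lambda>t. p + J f (c t))" for f
  have P: "apply_bcontfun (P f) = (\<lambda>t. p + J f (c t))" for f
    unfolding P_def
  proof (rule Bcontfun_inverse, rule bcontfun_normI)
    show "continuous_on UNIV (\<lambda>t. p + J f (c t))"
      by (intro continuous_intros continuous_on_compose2[OF J_cont c_cont]) (use c in auto)
    fix t show "norm (p + J f (c t)) \<le> norm p + B * \<delta>"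
      using J_bound[OF c, of f t] norm_triangle_ineq[of p "J f (c t)"] by linarith
  qed
  have "dist (P f) (P g) \<le> 1 / 2 * dist f g" for f g
  proof (rule dist_bound)
    fix t
    have "dist (P f t) (P g t) = norm (J f (c t) - J g (c t))"
      by (simp add: P dist_norm)
    also have "J f (c t) - J g (c t)
        = integral {0..c t} (\<lambda>s. G (apply_bcontfun f s) - G (apply_bcontfun g s))"
      unfolding J_def
      by (intro integral_diff[symmetric] integrable_continuous_interval Gf_cont)
    also have "norm \<dots> \<le> C * dist f g * (c t - 0)"
    proof (intro integral_bound continuous_intros Gf_cont)
      show "0 \<le> c t" using c[of t] by simp
      fix s
      have "norm (G (apply_bcontfun f s) - G (apply_bcontfun g s)) \<le> C * dist (f s) (g s)" by (rule G_lip)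
      also have "\<dots> \<le> C * dist f g" using C by (intro mult_left_mono dist_bounded)
      finally show "norm (G (apply_bcontfun f s) - G (apply_bcontfun g s)) \<le> C * dist f g" .
    qed
    also have "\<dots> \<le> C * dist f g * \<delta>" using c[of t] C by (intro mult_left_mono) auto
    also have "\<dots> = (C * \<delta>) * dist f g" by simp
    also have "\<dots> \<le> 1 / 2 * dist f g" using \<delta>(2) by (intro mult_right_mono) auto
    finally show "dist (P f t) (P g t) \<le> 1 / 2 * dist f g" .
  qed
  then obtain z where z: "P z = z"
    using banach_fix_type[of "1 / 2" P] by auto
  define Z where "Z = apply_bcontfun z"
  have Z: "Z t = p + J z t" if "t \<in> {0..\<delta>}" for t
    using that P[of z] unfolding z Z_def c_def by (simp add: max_def min_def)
  have Z_ball: "Z t \<in> cball p \<rho>" if "t \<in> {0..\<delta>}" for t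
    using J_bound[OF that, of z] \<delta>(3) by (simp add: Z[OF that] dist_norm)
  have "(Z has_vector_derivative F (Z t)) (at t within {0..\<delta>})" if t: "t \<in> {0..\<delta>}" for t
  proof -
    have "(J z has_vector_derivative G (Z t)) (at t within {0..\<delta>})"
      unfolding J_def Z_def by (rule integral_has_vector_derivative[OF Gf_cont t])
    then have "((\<lambda>t. p + J z t) has_vector_derivative 0 + G (Z t)) (at t within {0..\<delta>})"
      by (intro has_vector_derivative_add has_vector_derivative_const)
    from has_vector_derivative_transform[OF t Z this]
    have "(Z has_vector_derivative G (Z t)) (at t within {0..\<delta>})" by simp
    moreover have "G (Z t) = F (Z t)" unfolding G_def using Z_ball[OF t] by (simp add: closest_point_self)
    ultimately show ?thesis by simp
  qed
  moreover have "Z 0 = p" using Z[of 0] \<delta> by (simp add: J_def)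
  ultimately show ?thesis using \<delta> Z_ball by blast
qed

text \<open>The velocity is bounded on \<open>K\<close>, so the solution is Lipschitz and has a limit at \<open>T\<close>, from which it
  is continued by \<open>local_solution_exists\<close>. Differentiability at the junction \<open>T\<close> is obtained indirectly: the
  glued curve satisfies the integral equation, where one exceptional point is harmless, and that
  equation is then differentiated.\<close>

lemma ode_extension:
  fixes F :: "'a::euclidean_space \<Rightarrow> 'a" and X :: "real \<Rightarrow> 'a"
  assumes T: "T > 0" and K: "compact K" "K \<subseteq> U" and FU: "continuous_on U F"
    and lip: "\<And>p. p \<in> K \<Longrightarrow> \<exists>\<rho>>0. \<exists>C. cball p \<rho> \<subseteq> U \<and> C-lipschitz_on (cball p \<rho>) F"
    and XK: "\<And>t. t \<in> {0..<T} \<Longrightarrow> X t \<in> K"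
    and dX: "\<And>t. t \<in> {0..<T} \<Longrightarrow> (X has_vector_derivative F (X t)) (at t within {0..<T})"
  shows "\<exists>T'>T. \<exists>Y. (\<forall>t\<in>{0..<T}. Y t = X t) \<and>
     (\<forall>t\<in>{0..<T'}. Y t \<in> U \<and> (Y has_vector_derivative F (Y t)) (at t within {0..<T'}))"
proof -
  have "bounded (F ` K)"
    using K FU by (intro compact_imp_bounded compact_continuous_image) (auto intro: continuous_on_subset)
  then obtain B where B: "B > 0" "\<And>q. q \<in> K \<Longrightarrow> norm (F q) \<le> B"
    unfolding bounded_pos by auto
  have "B-lipschitz_on {0..<T} X"
  proof (rule bounded_derivative_imp_lipschitz)
    show "(X has_derivative (\<lambda>h. h *\<^sub>R F (X t))) (at t within {0..<T})" if "t \<in> {0..<T}" for t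
      using dX[OF that] by (simp add: has_vector_derivative_def)
    show "onorm (\<lambda>h. h *\<^sub>R F (X t)) \<le> B" if "t \<in> {0..<T}" for t
    proof (rule onorm_bound)
      show "norm (h *\<^sub>R F (X t)) \<le> B * norm h" for h :: real
        using B(2)[OF XK[OF that]] by (simp add: mult.commute[of B] mult_left_mono)
    qed (use B in simp)
  qed (use B in auto)
  then obtain g where g: "B-lipschitz_on (closure {0..<T}) g" "\<And>t. t \<in> {0..<T} \<Longrightarrow> g t = X t"
    using lipschitz_extend_closure by blast
  have cl: "closure {0..<T} = {0..T}" using T by simp
  have g_cont: "continuous_on {0..T} g" using g(1) lipschitz_on_continuous_on cl by metis
  have gT: "g T \<in> K"
  proof -
    have "g ` closure {0..<T} \<subseteq> K"
      using g(2) XK K(1) g_cont cl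
      by (intro image_closure_subset compact_imp_closed) auto
    then show ?thesis using cl T by auto
  qed
  obtain \<rho> C where \<rho>: "\<rho> > 0" "cball (g T) \<rho> \<subseteq> U" "C-lipschitz_on (cball (g T) \<rho>) F"
    using lip[OF gT] by auto
  obtain \<delta> Z where \<delta>: "\<delta> > 0" and Z0: "Z 0 = g T"
    and Z: "\<And>t. t \<in> {0..\<delta>} \<Longrightarrow> Z t \<in> cball (g T) \<rho>"
           "\<And>t. t \<in> {0..\<delta>} \<Longrightarrow> (Z has_vector_derivative F (Z t)) (at t within {0..\<delta>})"
    using local_solution_exists[OF \<rho>(1,3)] by auto
  define T' where "T' = T + \<delta>"
  define Y where "Y t = (if t \<le> T then g t else Z (t - T))" for t
  have Y_U: "Y t \<in> U" if "t \<in> {0..T'}" for t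
  proof (cases "t < T")
    case True then show ?thesis using that g(2)[of t] XK[of t] K(2) by (auto simp: Y_def)
  next
    case False
    show ?thesis
    proof (cases "t = T")
      case True then show ?thesis using gT K(2) by (auto simp: Y_def)
    next
      case neq: False
      then show ?thesis using False Z(1)[of "t - T"] \<rho>(2) that by (auto simp: Y_def T'_def)
    qed
  qed
  have Z_cont: "continuous_on {0..\<delta>} Z"
    unfolding continuous_on_eq_continuous_within
    using has_vector_derivative_continuous[OF Z(2)] by blast
  have Y_cont: "continuous_on {0..T'} Y"
  proof -
    have "continuous_on ({0..T} \<union> {T..T'}) Y"
      unfolding Y_def
    proof (rule continuous_on_cases)
      show "continuous_on {T..T'} (\<lambda>t. Z (t - T))"
        by (rule continuous_on_compose2[OF Z_cont]) (auto simp: T'_def intro!: continuous_intros)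
    qed (use g_cont Z0 in auto)
    moreover have "{0..T} \<union> {T..T'} = {0..T'}" using T \<delta> by (auto simp: T'_def)
    ultimately show ?thesis by simp
  qed
  have FY: "continuous_on {0..T'} (\<lambda>t. F (Y t))"
    by (rule continuous_on_compose2[OF FU Y_cont]) (use Y_U in auto)
  have dY: "(Y has_vector_derivative F (Y t)) (at t)" if t: "t \<in> {0<..<T'} - {T}" for t
  proof (cases "t < T")
    case True
    then have "(X has_vector_derivative F (X t)) (at t)"
      using dX[of t] t at_within_interior[of t "{0..<T}"] by (simp add: interior_atLeastLessThan)
    then show ?thesis
      by (rule has_vector_derivative_transform_within_open[where S = "{0<..<T}", THEN back_subst[where P = "\<lambda>q. (Y has_vector_derivative F q) (at t)"]])
        (use True t g(2) in \<open>auto simp: Y_def\<close>)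
  next
    case False
    then have tT: "t - T \<in> {0<..<\<delta>}" using t by (auto simp: T'_def)
    then have "(Z has_vector_derivative F (Z (t - T))) (at (t - T))"
      using Z(2)[of "t - T"] at_within_Icc_at[of 0 "t - T" \<delta>] by simp
    then have "((Z \<circ> (\<lambda>t. t - T)) has_vector_derivative 1 *\<^sub>R F (Z (t - T))) (at t)"
      by (intro vector_diff_chain_at) (auto intro!: derivative_eq_intros)
    then have "((\<lambda>t. Z (t - T)) has_vector_derivative F (Z (t - T))) (at t)" by (simp add: o_def)
    then have "(Y has_vector_derivative F (Z (t - T))) (at t)"
      by (rule has_vector_derivative_transform_within_open[where S = "{T<..}"])
        (use False t in \<open>auto simp: Y_def\<close>)
    then show ?thesis using False t by (simp add: Y_def)
  qed
  have int: "Y t = Y 0 + integral {0..t} (\<lambda>s. F (Y s))" if t: "t \<in> {0..T'}" for t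
  proof -
    have "((\<lambda>s. F (Y s)) has_integral (Y t - Y 0)) {0..t}"
      by (rule fundamental_theorem_of_calculus_interior_strong[of "{T}"])
        (use t dY continuous_on_subset[OF Y_cont, of "{0..t}"] in auto)
    then show ?thesis by (simp add: integral_unique)
  qed
  have "(Y has_vector_derivative F (Y t)) (at t within {0..T'})" if t: "t \<in> {0..T'}" for t
  proof -
    have "((\<lambda>t. Y 0 + integral {0..t} (\<lambda>s. F (Y s))) has_vector_derivative 0 + F (Y t)) (at t within {0..T'})"
      by (intro has_vector_derivative_add has_vector_derivative_const integral_has_vector_derivative[OF FY t])
    from has_vector_derivative_transform[OF t int this] show ?thesis by simp
  qed
  then have "(Y has_vector_derivative F (Y t)) (at t within {0..<T'})" if "t \<in> {0..<T'}" for t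
    using that by (auto intro: has_vector_derivative_within_subset[of Y "F (Y t)" t "{0..T'}"])
  moreover have "Y t = X t" if "t \<in> {0..<T}" for t using that g(2) by (simp add: Y_def)
  moreover have "T' > T" using \<delta> by (simp add: T'_def)
  ultimately show ?thesis using Y_U by (intro exI[of _ T'] conjI exI[of _ Y]) auto
qed

section \<open>The Ricci flow as an ordinary differential equation\<close>

definition flow_field :: "real \<Rightarrow> real ^ 3 \<Rightarrow> real ^ 3" where
  "flow_field a x = (\<chi> i. - 2 * x $ i * (principal_ricci a x i - (\<Sum>j\<in>UNIV. principal_ricci a x j) / 3))"

text \<open>Boundedness is included because products of Lipschitz functions are Lipschitz only together
  with it.\<close>

definition bounded_lipschitz :: "'a::metric_space set \<Rightarrow> ('a \<Rightarrow> real) \<Rightarrow> bool" where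
  "bounded_lipschitz S f \<longleftrightarrow> (\<exists>C. C-lipschitz_on S f) \<and> bounded (f ` S)"

lemma bounded_lipschitz_const [intro]: "bounded_lipschitz S (\<lambda>x. c)"
  unfolding bounded_lipschitz_def using lipschitz_on_constant[of S c] by (auto simp: image_constant_conv)

lemma bounded_lipschitz_add [intro]: "bounded_lipschitz S f \<Longrightarrow> bounded_lipschitz S g \<Longrightarrow> bounded_lipschitz S (\<lambda>x. f x + g x)"
  unfolding bounded_lipschitz_def by (blast intro: lipschitz_on_add bounded_plus_comp)

lemma bounded_lipschitz_mult [intro]:
  assumes "bounded_lipschitz S f" "bounded_lipschitz S g" shows "bounded_lipschitz S (\<lambda>x. f x * g x)"
proof -
  obtain C D A B where C: "C-lipschitz_on S f" and D: "D-lipschitz_on S g"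
    and A: "\<forall>x\<in>S. \<bar>f x\<bar> \<le> A" and B: "\<forall>x\<in>S. \<bar>g x\<bar> \<le> B"
    using assms unfolding bounded_lipschitz_def bounded_iff by auto
  have "bounded ((\<lambda>x. f x * g x) ` S)"
    unfolding bounded_iff
  proof (intro exI ballI)
    fix r assume "r \<in> (\<lambda>x. f x * g x) ` S"
    then obtain x where "x \<in> S" "r = f x * g x" by auto
    then show "norm r \<le> A * B" using A B by (auto simp: abs_mult intro!: mult_mono order_trans[OF abs_ge_zero])
  qed
  moreover have "(\<bar>A\<bar> * D + \<bar>B\<bar> * C)-lipschitz_on S (\<lambda>x. f x * g x)"
  proof (rule lipschitz_onI)
    show "0 \<le> \<bar>A\<bar> * D + \<bar>B\<bar> * C" using lipschitz_on_nonneg[OF C] lipschitz_on_nonneg[OF D] by simp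
    fix x y assume x: "x \<in> S" and y: "y \<in> S"
    have "f x * g x - f y * g y = f x * (g x - g y) + g y * (f x - f y)" by (simp add: algebra_simps)
    then have "\<bar>f x * g x - f y * g y\<bar> \<le> \<bar>f x\<bar> * \<bar>g x - g y\<bar> + \<bar>g y\<bar> * \<bar>f x - f y\<bar>"
      by (metis abs_mult abs_triangle_ineq)
    also have "\<dots> \<le> \<bar>A\<bar> * (D * dist x y) + \<bar>B\<bar> * (C * dist x y)"
      using lipschitz_onD[OF C x y] lipschitz_onD[OF D x y] A B x y
      by (intro add_mono mult_mono) (force simp: dist_real_def)+
    finally show "dist (f x * g x) (f y * g y) \<le> (\<bar>A\<bar> * D + \<bar>B\<bar> * C) * dist x y"
      by (simp add: dist_real_def algebra_simps)
  qed
  ultimately show ?thesis unfolding bounded_lipschitz_def by blast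
qed

lemma bounded_lipschitz_diff [intro]: "bounded_lipschitz S f \<Longrightarrow> bounded_lipschitz S g \<Longrightarrow> bounded_lipschitz S (\<lambda>x. f x - g x)"
  using bounded_lipschitz_add[of S f "\<lambda>x. (- 1) * g x"] bounded_lipschitz_mult[OF bounded_lipschitz_const, of S g "- 1"] by simp

lemma bounded_lipschitz_inverse:
  assumes "bounded_lipschitz S f" "0 < c" "\<And>x. x \<in> S \<Longrightarrow> c \<le> f x" shows "bounded_lipschitz S (\<lambda>x. inverse (f x))"
proof -
  obtain C where C: "C-lipschitz_on S f" using assms unfolding bounded_lipschitz_def by auto
  have pos: "0 < f x" if "x \<in> S" for x using assms(2,3) that by fastforce
  have "bounded ((\<lambda>x. inverse (f x)) ` S)"
    unfolding bounded_iff using assms pos by (intro exI[of _ "inverse c"]) (auto simp: le_imp_inverse_le less_imp_le)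
  moreover have "(C / c\<^sup>2)-lipschitz_on S (\<lambda>x. inverse (f x))"
  proof (rule lipschitz_onI)
    show "0 \<le> C / c\<^sup>2" using lipschitz_on_nonneg[OF C] by simp
    fix x y assume x: "x \<in> S" and y: "y \<in> S"
    have "dist (inverse (f x)) (inverse (f y)) = \<bar>f x - f y\<bar> / (f x * f y)"
      using pos[OF x] pos[OF y] by (simp add: dist_real_def inverse_diff_inverse abs_mult field_simps)
    also have "\<dots> \<le> (C * dist x y) / (c * c)"
      using lipschitz_onD[OF C x y] assms x y lipschitz_on_nonneg[OF C] pos[OF x] pos[OF y]
      by (intro frac_le mult_mono) (auto simp: dist_real_def less_imp_le)
    finally show "dist (inverse (f x)) (inverse (f y)) \<le> C / c\<^sup>2 * dist x y"
      by (simp add: power2_eq_square)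
  qed
  ultimately show ?thesis unfolding bounded_lipschitz_def by blast
qed

lemma bounded_lipschitz_component: "bounded S \<Longrightarrow> bounded_lipschitz S (\<lambda>x :: real ^ 3. x $ i)"
  unfolding bounded_lipschitz_def
  by (intro conjI exI[of _ 1] lipschitz_onI bounded_linear_image bounded_linear_vec_nth)
    (auto simp: dist_vec_nth_le)

lemma lipschitz_on_vec:
  fixes F :: "'a::metric_space \<Rightarrow> real ^ 3"
  assumes "\<And>i. bounded_lipschitz S (\<lambda>x. F x $ i)" shows "\<exists>C. C-lipschitz_on S F"
proof -
  have "\<forall>i :: 3. \<exists>C. C-lipschitz_on S (\<lambda>x. F x $ i)" using assms unfolding bounded_lipschitz_def by blast
  then obtain C where C: "\<And>i. (C i)-lipschitz_on S (\<lambda>x. F x $ i)" by metis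
  have "(\<Sum>i\<in>UNIV. C i)-lipschitz_on S F"
  proof (rule lipschitz_onI)
    show "0 \<le> (\<Sum>i\<in>UNIV. C i)" by (intro sum_nonneg lipschitz_on_nonneg[OF C])
    fix x y assume "x \<in> S" "y \<in> S"
    then have "(\<Sum>i\<in>UNIV. \<bar>(F x - F y) $ i\<bar>) \<le> (\<Sum>i\<in>UNIV. C i * dist x y)"
      using lipschitz_onD[OF C] by (intro sum_mono) (simp add: dist_real_def)
    then show "dist (F x) (F y) \<le> (\<Sum>i\<in>UNIV. C i) * dist x y"
      using norm_le_l1_cart[of "F x - F y"] by (simp add: dist_norm sum_distrib_right)
  qed
  then show ?thesis by blast
qed

lemma flow_field_lipschitz:
  assumes e: "0 < e" and p: "\<And>i. e \<le> p $ i"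
  shows "cball p (e / 2) \<subseteq> {x. \<forall>i. 0 < x $ i}" "\<exists>C. C-lipschitz_on (cball p (e / 2)) (flow_field a)"
proof -
  have low: "e / 2 \<le> x $ i" if "x \<in> cball p (e / 2)" for x i
    using dist_vec_nth_le[of p i x] that p[of i] by (simp add: dist_real_def abs_le_iff)
  then show "cball p (e / 2) \<subseteq> {x. \<forall>i. 0 < x $ i}" using e by (auto intro: less_le_trans[of 0 "e / 2"])
  define S where "S = cball p (e / 2)"
  have comp: "bounded_lipschitz S (\<lambda>x. x $ i)" for i unfolding S_def by (intro bounded_lipschitz_component) simp
  have inv: "bounded_lipschitz S (\<lambda>x. inverse (2 * x $ 1 * x $ 2 * x $ 3))"
  proof (rule bounded_lipschitz_inverse)
    show "bounded_lipschitz S (\<lambda>x. 2 * x $ 1 * x $ 2 * x $ 3)" by (intro bounded_lipschitz_mult bounded_lipschitz_const comp)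
    show "0 < 2 * (e / 2) * (e / 2) * (e / 2)" using e by simp
    show "2 * (e / 2) * (e / 2) * (e / 2) \<le> 2 * x $ 1 * x $ 2 * x $ 3" if "x \<in> S" for x
      using low[OF that[unfolded S_def]] e order_trans[OF _ low[OF that[unfolded S_def]], of 0] by (intro mult_mono) auto
  qed
  have r: "bounded_lipschitz S (\<lambda>x. principal_ricci a x i)" for i
    unfolding principal_ricci_def divide_inverse power2_eq_square
    by (intro bounded_lipschitz_mult bounded_lipschitz_add bounded_lipschitz_diff bounded_lipschitz_const comp inv)
  have "\<exists>C. C-lipschitz_on S (flow_field a)"
    unfolding flow_field_def
    by (rule lipschitz_on_vec, unfold vec_lambda_beta sum_3 divide_inverse)
      (intro bounded_lipschitz_mult bounded_lipschitz_add bounded_lipschitz_diff bounded_lipschitz_const comp r)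
  then show "\<exists>C. C-lipschitz_on (cball p (e / 2)) (flow_field a)" by (simp add: S_def)
qed

lemma flow_field_continuous: "continuous_on {x. \<forall>i. 0 < x $ i} (flow_field a)"
  unfolding flow_field_def principal_ricci_def
  by (intro continuous_intros) (auto simp: less_imp_neq[symmetric])

lemma has_vector_derivative_vec:
  fixes X :: "real \<Rightarrow> real ^ 3"
  shows "(X has_vector_derivative D) (at t within S) \<longleftrightarrow> (\<forall>i. ((\<lambda>s. X s $ i) has_real_derivative D $ i) (at t within S))"
  unfolding has_real_derivative_iff_has_vector_derivative has_vector_derivative_def
    has_derivative_componentwise_within[of X]
  by (auto simp: Basis_vec_def inner_axis)

lemma principal_ricci_ric3:
  assumes "p \<noteq> q" "q \<noteq> s" "p \<noteq> s"
  shows "principal_ricci a x p = ric3 a (x $ p) (x $ q) (x $ s)"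
    and "(\<Sum>j\<in>UNIV. principal_ricci a x j) / 3 = mean3 a (x $ p) (x $ q) (x $ s)"
proof -
  have *: "principal_ricci a x p = ric3 a (x $ p) (x $ q) (x $ s)" if "p \<noteq> q" "q \<noteq> s" "p \<noteq> s" for p q s
    using that exhaust_3[of p] exhaust_3[of q] exhaust_3[of s]
    unfolding principal_ricci_def ric3_def by (elim disjE) (simp_all add: mult_ac diff_diff_eq add.commute)
  then show "principal_ricci a x p = ric3 a (x $ p) (x $ q) (x $ s)" using assms by blast
  have "(\<Sum>j\<in>UNIV. principal_ricci a x j) = principal_ricci a x p + principal_ricci a x q + principal_ricci a x s"
    using assms exhaust_3[of p] exhaust_3[of q] exhaust_3[of s] by (auto simp: sum_3)
  then show "(\<Sum>j\<in>UNIV. principal_ricci a x j) / 3 = mean3 a (x $ p) (x $ q) (x $ s)"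
    using *[of p q s] *[of q s p] *[of s p q] assms by (simp add: mean3_def)
qed

lemma obtain_increasing_3:
  fixes f :: "3 \<Rightarrow> real"
  assumes "\<And>i j. i \<noteq> j \<Longrightarrow> f i \<noteq> f j"
  obtains p q s where "p \<noteq> q" "q \<noteq> s" "p \<noteq> s" "f p < f q" "f q < f s"
proof -
  have "f 1 \<noteq> f 2" "f 2 \<noteq> f 3" "f 1 \<noteq> f 3" using assms by simp_all
  then have "f 1 < f 2 \<and> f 2 < f 3 \<or> f 1 < f 3 \<and> f 3 < f 2 \<or> f 2 < f 1 \<and> f 1 < f 3
    \<or> f 2 < f 3 \<and> f 3 < f 1 \<or> f 3 < f 1 \<and> f 1 < f 2 \<or> f 3 < f 2 \<and> f 2 < f 1"
    by linarith
  then show ?thesis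
proof (elim disjE)
    assume "f 1 < f 2 \<and> f 2 < f 3" then show ?thesis by (intro that[of 1 2 3]) simp_all
  next
    assume "f 1 < f 3 \<and> f 3 < f 2" then show ?thesis by (intro that[of 1 3 2]) simp_all
  next
    assume "f 2 < f 1 \<and> f 1 < f 3" then show ?thesis by (intro that[of 2 1 3]) simp_all
  next
    assume "f 2 < f 3 \<and> f 3 < f 1" then show ?thesis by (intro that[of 2 3 1]) simp_all
  next
    assume "f 3 < f 1 \<and> f 1 < f 2" then show ?thesis by (intro that[of 3 1 2]) simp_all
  next
    assume "f 3 < f 2 \<and> f 2 < f 1" then show ?thesis by (intro that[of 3 2 1]) simp_all
  qed
qed

context wallach_pair
begin

definition unit_vec :: 'e where "unit_vec = (SOME e. e \<in> Basis)"

lemma unit_vec: "unit_vec \<bullet> unit_vec = 1"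
proof -
  have "unit_vec \<in> Basis" unfolding unit_vec_def by (rule SOME_Basis)
  then show ?thesis by simp
qed

text \<open>The parameters are read off from one unit vector in each summand.\<close>

definition params :: "('v \<Rightarrow> 'v \<Rightarrow> real) \<Rightarrow> real ^ 3" where
  "params m = (\<chi> i. m (\<iota> i unit_vec) (\<iota> i unit_vec) / killing_scale)"

lemma params_eq: assumes "metric_params M m x" shows "x = params m"
proof -
  have "m (\<iota> i unit_vec) (\<iota> i unit_vec) = x $ i * killing_scale" for i
  proof -
    have "m (\<Phi> (axis i unit_vec)) (\<Phi> (axis i unit_vec)) = (\<Sum>j\<in>UNIV. if j = i then x $ j * killing_scale else 0)"
      unfolding metric_params_iff[THEN iffD1, OF assms, rule_format]
      by (intro sum.cong) (auto simp: axis_def unit_vec)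
    then show ?thesis by (simp add: \<Phi>_axis)
  qed
  then show ?thesis using killing_scale_pos by (simp add: params_def vec_eq_iff)
qed

lemma params_curve:
  assumes flow: "normalized_ricci_flow M g T" and t: "t \<in> lifespan T"
  shows "metric_params M (g t) (params (g t))" "\<And>i. params (g t) $ i > 0"
    "((\<lambda>s. params (g s)) has_vector_derivative flow_field wallach_const (params (g t))) (at t within lifespan T)"
proof -
  have inv: "invariant_metric M (g t)" using flow t unfolding normalized_ricci_flow_def lifespan_def by auto
  then show m: "metric_params M (g t) (params (g t))" and p: "\<And>i. params (g t) $ i > 0"
    unfolding invariant_metric_def using params_eq by auto
  let ?x = "params (g t)"
  have d: "((\<lambda>s. g s X X) has_real_derivative - 2 * Ric M (g t) X X
      + 2 * g t X X * (scalar_curvature M (g t) / real (dim (pp M)))) (at t within lifespan T)" if "X \<in> pp M" for X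
    using flow t that unfolding normalized_ricci_flow_def lifespan_def by auto
  have "((\<lambda>s. params (g s) $ i) has_real_derivative flow_field wallach_const ?x $ i) (at t within lifespan T)" for i
  proof -
    have X: "\<iota> i unit_vec \<in> pp M" unfolding pp_eq using \<Phi>_axis by (metis rangeI)
    have gt: "g t (\<iota> i unit_vec) (\<iota> i unit_vec) = ?x $ i * killing_scale" using killing_scale_pos by (simp add: params_def)
    have "Ric M (g t) (\<Phi> (axis i unit_vec)) (\<Phi> (axis i unit_vec)) = (\<Sum>j\<in>UNIV. if j = i then killing_scale * ?x $ j * principal_ricci wallach_const ?x j else 0)"
      unfolding Ric_\<Phi>[OF m p] by (intro sum.cong) (auto simp: axis_def unit_vec)
    then have ric: "Ric M (g t) (\<iota> i unit_vec) (\<iota> i unit_vec) = killing_scale * ?x $ i * principal_ricci wallach_const ?x i"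
      by (simp add: \<Phi>_axis)
    have sc: "scalar_curvature M (g t) / real (dim (pp M)) = (\<Sum>j\<in>UNIV. principal_ricci wallach_const ?x j) / 3"
      by (simp add: scalar_curvature_eq[OF m p] dim_pp)
    have "((\<lambda>s. g s (\<iota> i unit_vec) (\<iota> i unit_vec) / killing_scale) has_real_derivative
        (- 2 * (killing_scale * ?x $ i * principal_ricci wallach_const ?x i) + 2 * (?x $ i * killing_scale) * ((\<Sum>j\<in>UNIV. principal_ricci wallach_const ?x j) / 3)) / killing_scale)
        (at t within lifespan T)"
      using DERIV_cdivide[OF d[OF X], of killing_scale] unfolding ric gt sc .
    moreover have "(- 2 * (killing_scale * ?x $ i * principal_ricci wallach_const ?x i) + 2 * (?x $ i * killing_scale) * ((\<Sum>j\<in>UNIV. principal_ricci wallach_const ?x j) / 3)) / killing_scale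
        = flow_field wallach_const ?x $ i"
      using killing_scale_pos by (simp add: flow_field_def field_simps)
    ultimately show ?thesis by (simp add: params_def)
  qed
  then show "((\<lambda>s. params (g s)) has_vector_derivative flow_field wallach_const ?x) (at t within lifespan T)"
    unfolding has_vector_derivative_vec by blast
qed

definition diag_metric :: "real ^ 3 \<Rightarrow> 'v \<Rightarrow> 'v \<Rightarrow> real" where
  "diag_metric x X Y = (\<Sum>i\<in>UNIV. x $ i * (killing_scale * (p_coords X $ i \<bullet> p_coords Y $ i)))"

lemma metric_params_diag: "metric_params M (diag_metric x) x"
  unfolding metric_params_iff diag_metric_def by simp

text \<open>The converse of \<open>params_curve\<close>: a prolonged solution of the equation for the parameters is a
  prolonged Ricci flow.\<close>

lemma flow_of_params:
  assumes "0 < T" and Y: "\<And>t i. t \<in> lifespan T \<Longrightarrow> 0 < Y t $ i"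
    and d: "\<And>t. t \<in> lifespan T \<Longrightarrow> (Y has_vector_derivative flow_field wallach_const (Y t)) (at t within lifespan T)"
  shows "normalized_ricci_flow M (\<lambda>t. diag_metric (Y t)) T"
  unfolding normalized_ricci_flow_def
proof (intro conjI allI impI ballI)
  fix t assume "0 \<le> t \<and> ereal t < T"
  then have t: "t \<in> lifespan T" by (simp add: lifespan_def)
  note m = metric_params_diag[of "Y t"]
  show "invariant_metric M (diag_metric (Y t))"
    unfolding invariant_metric_def using Y[OF t] m by blast
  fix X Z assume "X \<in> pp M" "Z \<in> pp M"
  then obtain a b where ab: "X = \<Phi> a" "Z = \<Phi> b" unfolding pp_eq by auto
  have "((\<lambda>s. \<Sum>i\<in>UNIV. Y s $ i * (killing_scale * (a $ i \<bullet> b $ i))) has_real_derivative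
      (\<Sum>i\<in>UNIV. flow_field wallach_const (Y t) $ i * (killing_scale * (a $ i \<bullet> b $ i)))) (at t within lifespan T)"
    by (intro DERIV_sum DERIV_cmult_right) (use d[OF t] in \<open>auto simp: has_vector_derivative_vec\<close>)
  moreover have "(\<Sum>i\<in>UNIV. flow_field wallach_const (Y t) $ i * (killing_scale * (a $ i \<bullet> b $ i)))
      = - 2 * Ric M (diag_metric (Y t)) X Z + 2 * diag_metric (Y t) X Z * (scalar_curvature M (diag_metric (Y t)) / real (dim (pp M)))"
    unfolding ab Ric_\<Phi>[OF m Y[OF t]] scalar_curvature_eq[OF m Y[OF t]] dim_pp
    unfolding diag_metric_def sum_distrib_left sum_distrib_right sum.distrib[symmetric]
    by (simp add: flow_field_def sum_3 field_simps)
  ultimately show "((\<lambda>s. diag_metric (Y s) X Z) has_real_derivative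
      - 2 * Ric M (diag_metric (Y t)) X Z + 2 * diag_metric (Y t) X Z * (scalar_curvature M (diag_metric (Y t)) / real (dim (pp M))))
      (at t within {s. 0 \<le> s \<and> ereal s < T})"
    unfolding ab by (simp add: diag_metric_def lifespan_def)
qed (rule assms)

text \<open>Otherwise \<open>ode_extension\<close> would prolong the flow beyond \<open>T\<close>.\<close>

lemma maximal_flow_not_compact:
  assumes max: "maximal_ricci_flow M g T" and T: "T < \<infinity>" and e: "0 < e"
  shows "\<not> (\<forall>t\<in>lifespan T. \<forall>i. e \<le> params (g t) $ i \<and> params (g t) $ i \<le> K)"
proof
  assume bd: "\<forall>t\<in>lifespan T. \<forall>i. e \<le> params (g t) $ i \<and> params (g t) $ i \<le> K"
  have flow: "normalized_ricci_flow M g T" using max unfolding maximal_ricci_flow_def by auto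
  then have "0 < T" unfolding normalized_ricci_flow_def by auto
  then obtain T1 where T1: "T = ereal T1" "0 < T1" using T by (cases T) auto
  have lifespan: "lifespan (ereal S) = {0..<S}" for S by (auto simp: lifespan_def)
  let ?U = "{x :: real ^ 3. \<forall>i. 0 < x $ i}"
  let ?K = "cbox (\<chi> i. e) (\<chi> i. K) :: (real ^ 3) set"
  have "\<exists>T'>T1. \<exists>Y. (\<forall>t\<in>{0..<T1}. Y t = params (g t)) \<and>
     (\<forall>t\<in>{0..<T'}. Y t \<in> ?U \<and> (Y has_vector_derivative flow_field wallach_const (Y t)) (at t within {0..<T'}))"
  proof (rule ode_extension[OF T1(2) compact_cbox _ flow_field_continuous])
    show "?K \<subseteq> ?U" using e by (auto simp: mem_box_cart intro: less_le_trans)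
    show "params (g t) \<in> ?K" if "t \<in> {0..<T1}" for t
      using bd that by (simp add: mem_box_cart T1 lifespan)
    show "((\<lambda>t. params (g t)) has_vector_derivative flow_field wallach_const (params (g t))) (at t within {0..<T1})"
      if "t \<in> {0..<T1}" for t
      using params_curve(3)[OF flow] that by (simp add: T1 lifespan)
    fix p assume "p \<in> ?K"
    then have "\<And>i. e \<le> p $ i" by (simp add: mem_box_cart)
    then show "\<exists>\<rho>>0. \<exists>C. cball p \<rho> \<subseteq> ?U \<and> C-lipschitz_on (cball p \<rho>) (flow_field wallach_const)"
      using flow_field_lipschitz[OF e, of p] e by (intro exI[of _ "e / 2"]) auto
  qed
  then obtain T' Y where T': "T' > T1" and Y0: "\<forall>t\<in>{0..<T1}. Y t = params (g t)"
    "\<forall>t\<in>{0..<T'}. Y t \<in> ?U \<and> (Y has_vector_derivative flow_field wallach_const (Y t)) (at t within {0..<T'})"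
    by blast
  then have Y: "\<And>t. t \<in> {0..<T1} \<Longrightarrow> Y t = params (g t)"
    "\<And>t i. t \<in> {0..<T'} \<Longrightarrow> 0 < Y t $ i"
    "\<And>t. t \<in> {0..<T'} \<Longrightarrow> (Y has_vector_derivative flow_field wallach_const (Y t)) (at t within {0..<T'})"
    by simp_all
  have "normalized_ricci_flow M (\<lambda>t. diag_metric (Y t)) (ereal T')"
    by (rule flow_of_params) (use T' T1 Y in \<open>auto simp: lifespan\<close>)
  moreover have "diag_metric (Y t) X Z = g t X Z"
    if "0 \<le> t" "ereal t < T" "X \<in> pp M" "Z \<in> pp M" for t X Z
  proof -
    have t: "t \<in> lifespan T" using that by (simp add: lifespan_def)
    have "Y t = params (g t)" using Y(1)[of t] that T1 by simp
    then show ?thesis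
      using params_curve(1)[OF flow t] metric_params_diag[of "Y t"] that(3,4)
      unfolding metric_params_iff pp_eq by auto
  qed
  moreover have "T < ereal T'" using T' T1 by simp
  ultimately show False using max unfolding maximal_ricci_flow_def by blast
qed

text \<open>The flow equations are symmetric in the three parameters, so the indices can be named by the
  initial order. The directions of negative and positive Ricci curvature are then the summands with
  the middle and with the largest parameter.\<close>

theorem generic_flow_becomes_mixed:
  assumes a: "wallach_const < 1 / 6" and max: "maximal_ricci_flow M g T" and gen: "generic_metric M (g 0)"
  shows "\<exists>t0. 0 < t0 \<and> ereal t0 < T \<and> (\<forall>t. t0 < t \<and> ereal t < T \<longrightarrow> mixed_ricci M (g t))"
proof -
  let ?x = "\<lambda>t. params (g t)"
  have flow: "normalized_ricci_flow M g T" using max unfolding maximal_ricci_flow_def by auto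
  then have T: "0 < T" unfolding normalized_ricci_flow_def by auto
  have distinct: "\<And>i j. i \<noteq> j \<Longrightarrow> ?x 0 $ i \<noteq> ?x 0 $ j"
    using gen params_eq unfolding generic_metric_def by blast
  obtain p q s where pqs: "p \<noteq> q" "q \<noteq> s" "p \<noteq> s" "?x 0 $ p < ?x 0 $ q" "?x 0 $ q < ?x 0 $ s"
    by (rule obtain_increasing_3[of "\<lambda>i. ?x 0 $ i", OF distinct])
  have all: "(\<forall>i. Q i) \<longleftrightarrow> Q p \<and> Q q \<and> Q s" for Q
    using pqs(1-3) exhaust_3[of p] exhaust_3[of q] exhaust_3[of s] by (auto simp: forall_3)
  note r = principal_ricci_ric3[OF pqs(1-3)]
    principal_ricci_ric3(1)[OF pqs(2) pqs(3)[symmetric] pqs(1)[symmetric]]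
    principal_ricci_ric3(1)[OF pqs(3)[symmetric] pqs(1) pqs(2)[symmetric]]
  have d: "((\<lambda>t. ?x t $ i) has_real_derivative - 2 * ?x t $ i *
      (principal_ricci wallach_const (?x t) i - mean3 wallach_const (?x t $ p) (?x t $ q) (?x t $ s))) (at t within lifespan T)"
    if "t \<in> lifespan T" for t i
    using params_curve(3)[OF flow that] unfolding has_vector_derivative_vec flow_field_def
    by (simp add: r(2))
  interpret ordered_wallach_flow wallach_const T "\<lambda>t. ?x t $ p" "\<lambda>t. ?x t $ q" "\<lambda>t. ?x t $ s"
  proof
    show "0 < wallach_const" unfolding wallach_const_def using killing_scale_pos by simp
    fix t assume t: "t \<in> lifespan T"
    show "0 < ?x t $ p" "0 < ?x t $ q" "0 < ?x t $ s" using params_curve(2)[OF flow t] by auto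
    show "((\<lambda>t. ?x t $ p) has_real_derivative - 2 * ?x t $ p *
       (ric3 wallach_const (?x t $ p) (?x t $ q) (?x t $ s) - mean3 wallach_const (?x t $ p) (?x t $ q) (?x t $ s))) (at t within lifespan T)"
      using d[OF t, of p] unfolding r .
    show "((\<lambda>t. ?x t $ q) has_real_derivative - 2 * ?x t $ q *
       (ric3 wallach_const (?x t $ q) (?x t $ s) (?x t $ p) - mean3 wallach_const (?x t $ p) (?x t $ q) (?x t $ s))) (at t within lifespan T)"
      using d[OF t, of q] unfolding r .
    show "((\<lambda>t. ?x t $ s) has_real_derivative - 2 * ?x t $ s *
       (ric3 wallach_const (?x t $ s) (?x t $ p) (?x t $ q) - mean3 wallach_const (?x t $ p) (?x t $ q) (?x t $ s))) (at t within lifespan T)"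
      using d[OF t, of s] unfolding r .
  qed (use T pqs a in auto)
  have "\<not> (\<forall>t\<in>lifespan T. e \<le> ?x t $ p \<and> ?x t $ p \<le> K \<and> e \<le> ?x t $ q \<and> ?x t $ q \<le> K
      \<and> e \<le> ?x t $ s \<and> ?x t $ s \<le> K)" if "T < \<infinity>" "e > 0" for e K
    using maximal_flow_not_compact[OF max that, of K] unfolding all by blast
  then obtain t0 where t0: "0 < t0" "ereal t0 < T" and
    mixed: "\<And>t. t0 < t \<Longrightarrow> ereal t < T \<Longrightarrow> ric3 wallach_const (?x t $ q) (?x t $ s) (?x t $ p) < 0
       \<and> ric3 wallach_const (?x t $ s) (?x t $ p) (?x t $ q) > 0"
    using eventually_mixed by blast
  have "mixed_ricci M (g t)" if "t0 < t" "ereal t < T" for t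
  proof -
    have t: "t \<in> lifespan T" using that t0 by (simp add: lifespan_def)
    note m = params_curve(1,2)[OF flow t]
    have ric: "Ric M (g t) (\<iota> i unit_vec) (\<iota> i unit_vec) = killing_scale * ?x t $ i * principal_ricci wallach_const (?x t) i" for i
    proof -
      have "Ric M (g t) (\<Phi> (axis i unit_vec)) (\<Phi> (axis i unit_vec))
          = (\<Sum>j\<in>UNIV. if j = i then killing_scale * ?x t $ j * principal_ricci wallach_const (?x t) j else 0)"
        unfolding Ric_\<Phi>[OF m] by (intro sum.cong) (auto simp: axis_def unit_vec)
      then show ?thesis by (simp add: \<Phi>_axis)
    qed
    have "Ric M (g t) (\<iota> q unit_vec) (\<iota> q unit_vec) < 0" "Ric M (g t) (\<iota> s unit_vec) (\<iota> s unit_vec) > 0"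
      unfolding ric r using mixed[OF that] m(2) killing_scale_pos by (simp_all add: mult_pos_neg)
    moreover have "\<iota> i unit_vec \<in> pp M" for i unfolding pp_eq using \<Phi>_axis by (metis rangeI)
    ultimately show ?thesis unfolding mixed_ricci_def by blast
  qed
  then show ?thesis using t0 by blast
qed

end

section \<open>Quaternions, octonions and their para-products\<close>

lemmas quat_expand = complex_eq_iff inner_prod_def inner_complex_def

lemma qmul_bilinear: "bilinear qmul"
  unfolding bilinear_def by (auto intro!: linearI simp: complex_eq_iff algebra_simps)

lemma omul_bilinear: "bilinear omul"
proof -
  have l: "qcnj (a + b) = qcnj a + qcnj b" "qcnj (c *\<^sub>R a) = c *\<^sub>R qcnj a" for a b c
    by (cases a; cases b; simp add: complex_eq_iff)+
  note q = bilinear_ladd[OF qmul_bilinear] bilinear_radd[OF qmul_bilinear] bilinear_lmul[OF qmul_bilinear]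
    bilinear_rmul[OF qmul_bilinear]
  show ?thesis unfolding bilinear_def by (auto intro!: linearI simp: l q algebra_simps)
qed

lemmas qmul_simps [simp] =
  bilinear_ladd[OF qmul_bilinear] bilinear_radd[OF qmul_bilinear]
  bilinear_lmul[OF qmul_bilinear] bilinear_rmul[OF qmul_bilinear]
  bilinear_lneg[OF qmul_bilinear] bilinear_rneg[OF qmul_bilinear]
  bilinear_lsub[OF qmul_bilinear] bilinear_rsub[OF qmul_bilinear]
  bilinear_lzero[OF qmul_bilinear] bilinear_rzero[OF qmul_bilinear]

lemma linear_qcnj: "linear qcnj"
  by (rule linearI) (auto simp: complex_eq_iff)

lemmas qcnj_simps [simp] = linear_add[OF linear_qcnj] linear_diff[OF linear_qcnj]
  linear_neg[OF linear_qcnj] linear_0[OF linear_qcnj] linear_scale[OF linear_qcnj]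

lemma qcnj_qcnj [simp]: "qcnj (qcnj a) = a"
  by (cases a) simp

lemma qcnj_eq_0 [simp]: "qcnj a = 0 \<longleftrightarrow> a = 0"
  by (metis qcnj_qcnj qcnj_simps(4))

lemma qcnj_qmul [simp]: "qcnj (qmul a b) = qmul (qcnj b) (qcnj a)"
  by (cases a; cases b) (simp add: algebra_simps)

lemma qmul_assoc: "qmul (qmul a b) c = qmul a (qmul b c)"
  by (cases a; cases b; cases c) (simp add: algebra_simps)

lemma inner_qcnj: "qcnj a \<bullet> qcnj b = a \<bullet> b"
  by (cases a; cases b) (simp add: quat_expand)

lemma inner_qmul_left: "qmul a b \<bullet> c = b \<bullet> qmul (qcnj a) c"
  by (cases a; cases b; cases c) (simp add: quat_expand algebra_simps)

lemma inner_qmul_right: "qmul a b \<bullet> c = a \<bullet> qmul c (qcnj b)"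
  by (cases a; cases b; cases c) (simp add: quat_expand algebra_simps)

lemma qmul_qcnj_absorb: "qmul (qcnj a) (qmul a b) = (a \<bullet> a) *\<^sub>R b" "qmul (qmul b a) (qcnj a) = (a \<bullet> a) *\<^sub>R b"
  by (cases a; cases b; simp add: quat_expand algebra_simps)+

text \<open>The para-Hurwitz product of quaternions.\<close>

definition qstar :: "quat \<Rightarrow> quat \<Rightarrow> quat" where "qstar u v = qmul (qcnj u) (qcnj v)"

lemma norm_eq_from_inner: "u \<bullet> u = (a \<bullet> a) * (b \<bullet> b) \<Longrightarrow> norm u = norm a * norm b"
  for u :: "'u::real_inner" and a :: "'a::real_inner" and b :: "'b::real_inner"
  by (simp add: norm_eq_sqrt_inner real_sqrt_mult)

lemma inner_qmul_same: "qmul a b \<bullet> qmul a b = (a \<bullet> a) * (b \<bullet> b)"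
  by (simp add: inner_qmul_left qmul_qcnj_absorb)

interpretation quat: symmetric_composition qstar
proof
  show "bilinear qstar"
    unfolding bilinear_def qstar_def by (intro conjI allI linearI) (simp_all add: algebra_simps)
  fix u v w
  show "qstar u v \<bullet> w = u \<bullet> qstar v w"
    using inner_qcnj[of u "qmul (qcnj v) (qcnj w)"] by (simp add: qstar_def inner_qmul_right)
  show "norm (qstar u v) = norm u * norm v"
    by (rule norm_eq_from_inner) (simp add: qstar_def inner_qmul_same inner_qcnj)
qed

lemmas omul_simps [simp] =
  bilinear_ladd[OF omul_bilinear] bilinear_radd[OF omul_bilinear]
  bilinear_lmul[OF omul_bilinear] bilinear_rmul[OF omul_bilinear]
  bilinear_lneg[OF omul_bilinear] bilinear_rneg[OF omul_bilinear]
  bilinear_lsub[OF omul_bilinear] bilinear_rsub[OF omul_bilinear]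
  bilinear_lzero[OF omul_bilinear] bilinear_rzero[OF omul_bilinear]

lemma linear_ocnj: "linear ocnj"
  by (rule linearI) auto

lemmas ocnj_simps [simp] = linear_add[OF linear_ocnj] linear_diff[OF linear_ocnj]
  linear_neg[OF linear_ocnj] linear_0[OF linear_ocnj] linear_scale[OF linear_ocnj]

lemma ocnj_ocnj [simp]: "ocnj (ocnj a) = a"
  by (cases a) simp

lemma ocnj_omul [simp]: "ocnj (omul a b) = omul (ocnj b) (ocnj a)"
  by (cases a rule: prod.exhaust; cases b rule: prod.exhaust) (simp add: minus_prod_def[symmetric] algebra_simps del: qmul.simps qcnj.simps)

lemma inner_ocnj: "ocnj a \<bullet> ocnj b = a \<bullet> b"
  by (cases a rule: prod.exhaust; cases b rule: prod.exhaust) (simp add: inner_qcnj)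

lemma inner_omul_right: "omul a b \<bullet> c = a \<bullet> omul c (ocnj b)"
proof (cases a rule: prod.exhaust; cases b rule: prod.exhaust; cases c rule: prod.exhaust)
  fix a1 a2 b1 b2 c1 c2 assume "a = (a1, a2)" "b = (b1, b2)" "c = (c1, c2)"
  then show ?thesis
    using inner_qmul_left[of "qcnj b2" a2 c1] inner_qmul_left[of b2 a1 c2]
      inner_qmul_right[of a1 b1 c1] inner_qmul_right[of a2 "qcnj b1" c2]
    by (simp add: inner_simps inner_commute)
qed

text \<open>In the Cayley--Dickson double the two mixed terms cancel by the adjointness of quaternion
  multiplications; this is where associativity of the quaternions enters.\<close>

lemma inner_omul_same: "omul a b \<bullet> omul a b = (a \<bullet> a) * (b \<bullet> b)"
proof (cases a rule: prod.exhaust; cases b rule: prod.exhaust)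
  fix a1 a2 b1 b2 assume ab: "a = (a1, a2)" "b = (b1, b2)"
  have "qmul a1 b1 \<bullet> qmul (qcnj b2) a2 = qmul b2 a1 \<bullet> qmul a2 (qcnj b1)"
    using inner_qmul_right[of "qmul b2 a1" b1 a2] inner_qmul_left[of b2 "qmul a1 b1" a2]
      inner_qmul_right[of "qmul b2 a1" "b1" "a2"]
    by (simp add: qmul_assoc)
  then show ?thesis
    using inner_qmul_same[of a1 b1] inner_qmul_same[of "qcnj b2" a2] inner_qmul_same[of b2 a1]
      inner_qmul_same[of a2 "qcnj b1"]
    unfolding ab by (simp add: inner_simps inner_qcnj inner_commute algebra_simps)
qed

definition ostar :: "oct \<Rightarrow> oct \<Rightarrow> oct" where "ostar u v = omul (ocnj u) (ocnj v)"

interpretation oct: symmetric_composition ostar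
proof
  show "bilinear ostar"
    unfolding bilinear_def ostar_def by (intro conjI allI linearI) (simp_all add: algebra_simps)
  fix u v w
  show "ostar u v \<bullet> w = u \<bullet> ostar v w"
    using inner_ocnj[of u "omul (ocnj v) (ocnj w)"] by (simp add: ostar_def inner_omul_right)
  show "norm (ostar u v) = norm u * norm v"
    by (rule norm_eq_from_inner) (simp add: ostar_def inner_omul_same inner_ocnj)
qed

section \<open>The space of dimension 12\<close>

lemma bilinear_qmat_mult: "bilinear qmat_mult"
  unfolding bilinear_def
  by (intro conjI allI linearI) (simp_all add: qmat_mult_def vec_eq_iff sum.distrib scaleR_right.sum)

lemma qmat_mult_assoc: "qmat_mult (qmat_mult A B) C = qmat_mult A (qmat_mult B C)"
  by (simp add: qmat_mult_def vec_eq_iff sum_3 qmul_assoc algebra_simps)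

lemma jacobi_commutator:
  assumes "bilinear f" "\<And>a b c. f (f a b) c = f a (f b c)"
  defines "b \<equiv> \<lambda>X Y. f X Y - f Y X"
  shows "bilinear b" "b X Y = - b Y X" "b (b X Y) Z = b X (b Y Z) - b Y (b X Z)"
proof -
  note s = bilinear_ladd[OF assms(1)] bilinear_radd[OF assms(1)] bilinear_lmul[OF assms(1)]
    bilinear_rmul[OF assms(1)] bilinear_lsub[OF assms(1)] bilinear_rsub[OF assms(1)]
  show "bilinear b" unfolding bilinear_def b_def by (auto intro!: linearI simp: s algebra_simps)
  show "b X Y = - b Y X" by (simp add: b_def)
  show "b (b X Y) Z = b X (b Y Z) - b Y (b X Z)" by (simp add: b_def s assms(2))
qed

text \<open>The skew-Hermitian matrices with \<open>u\<close> at \<open>(i + 1, i + 2)\<close>. With this cyclic choice of positions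
  all three brackets take the same form \<open>[qmat i u, qmat (i + 1) v] = - qmat (i + 2) (v \<star> u)\<close>,
  the conjugations being absorbed into the para-Hurwitz product.\<close>

definition qmat :: "3 \<Rightarrow> quat \<Rightarrow> quat ^ 3 ^ 3" where
  "qmat i u = (\<chi> r c. if r = i + 1 \<and> c = i + 2 then u else if r = i + 2 \<and> c = i + 1 then - qcnj u else 0)"

text \<open>The entry at \<open>(i + 1, i + 2)\<close> of the double commutator of three matrices \<open>qmat i\<close>.\<close>

lemma q_triple:
  "qmul u (qmul (qcnj w) v) + qmul v (qmul (qcnj w) u) - qmul u (qmul (qcnj v) w) - qmul w (qmul (qcnj v) u)
    = (4 * (w \<bullet> u)) *\<^sub>R v - (4 * (v \<bullet> u)) *\<^sub>R w"
  by (cases u; cases v; cases w) (simp add: quat_expand algebra_simps)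

lemma sum_qmat: "(\<Sum>j\<in>UNIV. qmat j (a $ j)) =
  (\<chi> r c. if c = r + 1 then a $ (r + 2) else if c = r + 2 then - qcnj (a $ (r + 1)) else 0)"
  by (simp add: vec_eq_iff forall_3 sum_3 qmat_def)

interpretation W12: wallach_pair qstar W12 qmat
proof (intro wallach_pair.intro wallach_pair_axioms.intro quat.symmetric_composition_axioms)
  note c = jacobi_commutator[OF bilinear_qmat_mult qmat_mult_assoc]
  have br: "bracket W12 = (\<lambda>A B. qmat_mult A B - qmat_mult B A)" by (simp add: W12_def)
  have lie: "lie_alg W12 = sp3" and iso: "isotropy W12 = {A \<in> sp3. \<forall>i j. i \<noteq> j \<longrightarrow> A $ i $ j = 0}"
    by (simp_all add: W12_def)
  show "bilinear (bracket W12)" unfolding br by (rule c)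
  show "bracket W12 X Y = - bracket W12 Y X" for X Y by (simp add: br)
  show "bracket W12 (bracket W12 X Y) Z = bracket W12 X (bracket W12 Y Z) - bracket W12 Y (bracket W12 X Z)" for X Y Z
    unfolding br by (rule c)
  have sub: "subspace sp3"
  proof -
    have eq: "sp3 = {A. (\<chi> i j. A $ j $ i + qcnj (A $ i $ j)) = 0}"
      by (simp add: sp3_def vec_eq_iff eq_neg_iff_add_eq_0)
    have lin: "linear (\<lambda>A :: quat ^ 3 ^ 3. (\<chi> i j. A $ j $ i + qcnj (A $ i $ j)) :: quat ^ 3 ^ 3)"
      by (rule linearI) (simp_all add: vec_eq_iff algebra_simps)
    show ?thesis unfolding eq by (rule linear_subspace_kernel[OF lin])
  qed
  then show "fin_dim (lie_alg W12)" unfolding lie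
    by (rule fin_dim_subset[of _ Basis]) auto
  show "subspace (isotropy W12)" unfolding iso using sub by (auto simp: subspace_def)
  show "isotropy W12 \<subseteq> lie_alg W12" by (auto simp: iso lie)
  have closed: "qmat_mult X Y - qmat_mult Y X \<in> sp3" if "X \<in> sp3" "Y \<in> sp3" for X Y
  proof -
    have X: "X $ j $ i = - qcnj (X $ i $ j)" and Y: "Y $ j $ i = - qcnj (Y $ i $ j)" for i j
      using that unfolding sp3_def by blast+
    have "(qmat_mult X Y - qmat_mult Y X) $ j $ i = - qcnj ((qmat_mult X Y - qmat_mult Y X) $ i $ j)" for i j
      by (simp add: qmat_mult_def linear_sum[OF linear_qcnj] X[of _ j] X[of i] Y[of _ j] Y[of i] sum_subtractf[symmetric] sum_negf[symmetric])
    then show ?thesis unfolding sp3_def by blast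
  qed
  show "bracket W12 X Y \<in> lie_alg W12" if "X \<in> lie_alg W12" "Y \<in> lie_alg W12" for X Y
    using closed that by (simp add: br lie)
  show "bracket W12 X Y \<in> isotropy W12" if "X \<in> isotropy W12" "Y \<in> isotropy W12" for X Y
    using closed[of X Y] that by (simp add: br iso) (simp add: qmat_mult_def sum_3 forall_3)
  show "linear (qmat i)" for i by (rule linearI) (simp_all add: qmat_def vec_eq_iff)
  have mem: "qmat i u \<in> sp3" for i u
    by (auto simp: sp3_def qmat_def)
  show "qmat i u \<in> lie_alg W12" for i u by (simp add: mem lie)
  show "\<exists>a. X - (\<Sum>i\<in>UNIV. qmat i (a $ i)) \<in> isotropy W12" if "X \<in> lie_alg W12" for X
  proof (intro exI[of _ "\<chi> i. X $ (i + 1) $ (i + 2)"])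
    have X: "X $ j $ i = - qcnj (X $ i $ j)" for i j using that unfolding lie sp3_def by blast
    have "(\<Sum>i\<in>UNIV. qmat i ((\<chi> i. X $ (i + 1) $ (i + 2)) $ i)) \<in> sp3"
      by (intro subspace_sum sub mem)
    then have "X - (\<Sum>i\<in>UNIV. qmat i ((\<chi> i. X $ (i + 1) $ (i + 2)) $ i)) \<in> sp3"
      using that sub by (simp add: lie subspace_diff)
    moreover have "(X - (\<Sum>i\<in>UNIV. qmat i ((\<chi> i. X $ (i + 1) $ (i + 2)) $ i))) $ r $ s = 0" if ne: "r \<noteq> s" for r s
    proof -
      consider "s = r + 1" | "s = r + 2" by (cases rule: cases_cyclic_3[of s r]) (use ne in auto)
      then show ?thesis
      proof cases
        case 1 then show ?thesis unfolding sum_qmat by simp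
      next
        case 2 then show ?thesis unfolding sum_qmat by (simp add: X[of r "r + 2"])
      qed
    qed
    ultimately show "X - (\<Sum>i\<in>UNIV. qmat i ((\<chi> i. X $ (i + 1) $ (i + 2)) $ i)) \<in> isotropy W12"
      by (simp add: iso)
  qed
  show "a = 0" if "(\<Sum>i\<in>UNIV. qmat i (a $ i)) \<in> isotropy W12" for a
    using that unfolding iso sum_qmat by (simp add: forall_3 vec_eq_iff)
  show "bracket W12 (qmat i u) (qmat i v) \<in> isotropy W12" for i u v
    using closed[OF mem mem, of i u i v] exhaust_3[of i]
    by (auto simp: br iso) (auto simp: qmat_mult_def qmat_def sum_3 forall_3)
  show "bracket W12 (qmat i u) (bracket W12 (qmat i v) (qmat i w))
      = qmat i ((4 * (w \<bullet> u)) *\<^sub>R v - (4 * (v \<bullet> u)) *\<^sub>R w)" for i u v w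
    using exhaust_3[of i] unfolding q_triple[symmetric]
    by (elim disjE) (simp_all add: br qmat_mult_def qmat_def sum_3 forall_3 vec_eq_iff qmul_assoc algebra_simps)
  show "bracket W12 (qmat i u) (qmat (i + 1) v) = - qmat (i + 2) (qstar v u)" for i u v
    using exhaust_3[of i]
    by (elim disjE) (simp_all add: br qmat_mult_def qmat_def sum_3 forall_3 vec_eq_iff qstar_def)
  show "bracket W12 h (qmat i u) \<in> range (qmat i)" if "h \<in> isotropy W12" for h i u
  proof
    have "h $ j $ i = - qcnj (h $ i $ j)" for i j using that unfolding iso sp3_def by blast
    then have h: "qcnj (h $ i $ i) = - h $ i $ i" for i by (metis add.inverse_inverse)
    have off: "h $ r $ s = 0" if "r \<noteq> s" for r s using that \<open>h \<in> isotropy W12\<close> by (simp add: iso)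
    show "bracket W12 h (qmat i u) = qmat i (qmul (h $ (i + 1) $ (i + 1)) u - qmul u (h $ (i + 2) $ (i + 2)))"
      using exhaust_3[of i]
      by (elim disjE) (simp_all add: br qmat_mult_def qmat_def sum_3 forall_3 vec_eq_iff off h)
  qed simp
  show "h = 0" if "h \<in> isotropy W12" and z: "\<And>i u. bracket W12 h (qmat i u) = 0" for h
  proof -
    have off: "h $ r $ s = 0" if "r \<noteq> s" for r s using that \<open>h \<in> isotropy W12\<close> by (simp add: iso)
    have comm: "qmul (h $ (i + 1) $ (i + 1)) u = qmul u (h $ (i + 2) $ (i + 2))" for i u
    proof -
      have "bracket W12 h (qmat i u) $ (i + 1) $ (i + 2) = 0" by (simp add: z)
      then show ?thesis using exhaust_3[of i]
        by (elim disjE) (simp_all add: br qmat_mult_def qmat_def sum_3 off)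
    qed
    have one: "qmul (1, 0) q = q" "qmul q (1, 0) = q" for q by (cases q; simp)+
    have eq: "h $ (i + 1) $ (i + 1) = h $ (i + 2) $ (i + 2)" for i
      using comm[of i "(1, 0)"] by (simp add: one)
    \<comment> \<open>The three diagonal entries agree and commute with all quaternions, so they are real; they are
      also imaginary.\<close>
    have "h $ i $ i = 0" for i
    proof -
      obtain a b where ab: "h $ i $ i = (a, b)" by (cases "h $ i $ i")
      have "qmul (h $ i $ i) u = qmul u (h $ i $ i)" for u
        using comm[of "i + 2" u] eq[of "i + 2"] by simp
      from this[of "(\<i>, 0)"] this[of "(0, 1)"] have c: "b = 0" "cnj a = a"
        by (simp_all add: ab complex_eq_iff)
      have "h $ i $ i = - qcnj (h $ i $ i)" using that(1) unfolding iso sp3_def by blast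
      then show ?thesis using c by (simp add: ab complex_eq_iff zero_prod_def)
    qed
    then show ?thesis using off by (simp add: vec_eq_iff) metis
  qed
  show "(\<Sum>j\<in>UNIV. qmat j (a $ j)) \<in> intermediate W12 i \<longleftrightarrow> (\<forall>j. j \<noteq> i \<longrightarrow> a $ j = 0)" for a i
  proof -
    have "(\<Sum>j\<in>UNIV. qmat j (a $ j)) \<in> sp3" by (intro subspace_sum sub mem)
    moreover have "intermediate W12 i = {A \<in> sp3. \<forall>j. j \<noteq> i \<longrightarrow> A $ i $ j = 0}" by (simp add: W12_def)
    ultimately show ?thesis
      unfolding sum_qmat using exhaust_3[of i] by (elim disjE) (auto simp: forall_3)
  qed
qed

section \<open>The space of dimension 24\<close>

abbreviation ostar_infix :: "oct \<Rightarrow> oct \<Rightarrow> oct" (infixl "\<star>" 70) where "u \<star> v \<equiv> ostar u v"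

lemma omul_of_real: "omul (oct_of_real r) a = r *\<^sub>R a" "omul a (oct_of_real r) = r *\<^sub>R a"
proof -
  have q: "qmul (of_real r, 0) q = r *\<^sub>R q" "qmul q (of_real r, 0) = r *\<^sub>R q" for q
    by (cases q; simp add: scaleR_conv_of_real mult.commute)+
  have z: "((0, 0) :: quat) = 0" by (simp add: zero_prod_def)
  show "omul (oct_of_real r) a = r *\<^sub>R a" "omul a (oct_of_real r) = r *\<^sub>R a"
    by (cases a rule: prod.exhaust; simp add: oct_of_real_def z q del: qmul.simps)+
qed

lemma oct_Re_inner: "oct_Re a = a \<bullet> oct_of_real 1"
  by (cases a rule: prod.exhaust) (simp add: oct_Re_def oct_of_real_def inner_prod_def inner_complex_def)

lemma oct_Re_simps [simp]:
  "oct_Re (a + b) = oct_Re a + oct_Re b" "oct_Re (c *\<^sub>R a) = c * oct_Re a"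
  "oct_Re (oct_of_real r) = r"
  by (simp_all add: oct_Re_def oct_of_real_def)

lemma oct_Re_omul: "oct_Re (omul a (ocnj b)) = a \<bullet> b" "oct_Re (omul (ocnj a) b) = a \<bullet> b"
  by (simp_all add: oct_Re_inner inner_omul_right omul_of_real inner_ocnj)

text \<open>In the coordinates of the Albert algebra the Jordan product involves the octonions only through
  their inner product and their para-Hurwitz product. All further properties
  of the algebra are derived from these two formulas.\<close>

lemma fst_jordan: "fst (jordan a b) $ i = fst a $ i * fst b $ i
    + snd a $ (i + 1) \<bullet> snd b $ (i + 1) + snd a $ (i + 2) \<bullet> snd b $ (i + 2)"
  using exhaust_3[of i]
  by (elim disjE) (simp_all add: jordan_def herm_coords_def omat_mult_def herm_def sum_3 oct_Re_omul
    omul_of_real inner_commute field_simps)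

lemma snd_jordan: "snd (jordan a b) $ i = (1 / 2) *\<^sub>R ((fst a $ (i + 1) + fst a $ (i + 2)) *\<^sub>R snd b $ i
    + (fst b $ (i + 1) + fst b $ (i + 2)) *\<^sub>R snd a $ i
    + snd a $ (i + 2) \<star> snd b $ (i + 1) + snd b $ (i + 2) \<star> snd a $ (i + 1))"
  using exhaust_3[of i]
  by (elim disjE) (simp_all add: jordan_def herm_coords_def omat_mult_def herm_def sum_3
    omul_of_real ostar_def algebra_simps)

lemma albert_eqI:
  fixes a b :: albert and i :: 3
  assumes "fst a $ i = fst b $ i" "fst a $ (i + 1) = fst b $ (i + 1)" "fst a $ (i + 2) = fst b $ (i + 2)"
    "snd a $ i = snd b $ i" "snd a $ (i + 1) = snd b $ (i + 1)" "snd a $ (i + 2) = snd b $ (i + 2)"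
  shows "a = b"
proof (rule prod_eqI; unfold vec_eq_iff; intro allI)
  fix j show "fst a $ j = fst b $ j" "snd a $ j = snd b $ j"
    using assms by (cases rule: cases_cyclic_3[of j i]; simp)+
qed

text \<open>Formally the commutator with the skew-Hermitian matrix that has \<open>u\<close> at \<open>(i + 1, i + 2)\<close>. Octonion
  matrices do not associate, so the derivation property has to be checked on components.\<close>

definition rot_fun :: "3 \<Rightarrow> oct \<Rightarrow> albert \<Rightarrow> albert" where
  "rot_fun i u a =
    (\<chi> j. if j = i + 1 then 2 * (u \<bullet> snd a $ i) else if j = i + 2 then - 2 * (u \<bullet> snd a $ i) else 0,
     \<chi> j. if j = i then (fst a $ (i + 2) - fst a $ (i + 1)) *\<^sub>R u
          else if j = i + 1 then - (u \<star> snd a $ (i + 2)) else snd a $ (i + 1) \<star> u)"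

definition rot :: "3 \<Rightarrow> oct \<Rightarrow> albert \<Rightarrow>\<^sub>L albert" where "rot i u = Blinfun (rot_fun i u)"

lemma rot_apply: "blinfun_apply (rot i u) = rot_fun i u"
proof -
  have "linear (rot_fun i u)"
    by (rule linearI; rule albert_eqI[of _ i]) (simp_all add: rot_fun_def inner_simps algebra_simps)
  then show ?thesis
    unfolding rot_def by (intro bounded_linear_Blinfun_apply) (simp add: linear_conv_bounded_linear)
qed

lemma rot_fun_simps [simp]:
  "fst (rot_fun i u a) $ i = 0" "fst (rot_fun i u a) $ (i + 1) = 2 * (u \<bullet> snd a $ i)"
  "fst (rot_fun i u a) $ (i + 2) = - 2 * (u \<bullet> snd a $ i)"
  "snd (rot_fun i u a) $ i = (fst a $ (i + 2) - fst a $ (i + 1)) *\<^sub>R u"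
  "snd (rot_fun i u a) $ (i + 1) = - (u \<star> snd a $ (i + 2))"
  "snd (rot_fun i u a) $ (i + 2) = snd a $ (i + 1) \<star> u"
  by (simp_all add: rot_fun_def)

text \<open>On the diagonal components this is the associativity of the inner product, on the off-diagonal
  ones the polarized absorption laws. Testing vector identities against an arbitrary vector reduces
  them to identities of real numbers.\<close>

lemma rot_f4: "rot i u \<in> f4"
proof -
  have "rot_fun i u (jordan a b) = jordan (rot_fun i u a) b + jordan a (rot_fun i u b)" for a b
  proof (rule albert_eqI[of _ i])
    let ?x = "\<lambda>j. snd a $ (i + j)" and ?y = "\<lambda>j. snd b $ (i + j)"
    let ?L = "rot_fun i u (jordan a b)" and ?R = "jordan (rot_fun i u a) b + jordan a (rot_fun i u b)"
    note rot = oct.inner_star_assoc[of u "?x 2" "?y 1"] oct.inner_star_assoc[of u "?y 2" "?x 1"]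
      oct.inner_star_assoc[of "?x 1" u "?y 2"] oct.inner_star_assoc[of "?y 1" u "?x 2"]
    show "fst ?L $ i = fst ?R $ i" "fst ?L $ (i + 1) = fst ?R $ (i + 1)" "fst ?L $ (i + 2) = fst ?R $ (i + 2)"
      using rot by (simp_all add: fst_jordan snd_jordan) (simp_all add: inner_simps inner_commute algebra_simps)
    have fl: "(u' \<star> v) \<star> w = (2 * (u' \<bullet> w)) *\<^sub>R v - (w \<star> v) \<star> u'"
      and fr: "u' \<star> (v \<star> w) = (2 * (u' \<bullet> w)) *\<^sub>R v - w \<star> (v \<star> u')" for u' v w
      using oct.star_flip_left[of u' v w] oct.star_flip_right[of u' v w] by (simp_all add: algebra_simps)
    show "snd ?L $ i = snd ?R $ i"
      unfolding vector_eq_rdot[of "snd ?L $ i", symmetric]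
      using fl[of "?x 1" u "?y 1"] fr[of "?x 2" u "?y 2"]
      by (simp add: fst_jordan snd_jordan) (simp add: inner_simps inner_commute field_simps)
    show "snd ?L $ (i + 1) = snd ?R $ (i + 1)"
      unfolding vector_eq_rdot[of "snd ?L $ (i + 1)", symmetric]
      using fr[of "?x 0" "?y 1" u] fr[of "?y 0" "?x 1" u]
      by (simp add: fst_jordan snd_jordan) (simp add: inner_simps inner_commute field_simps)
    show "snd ?L $ (i + 2) = snd ?R $ (i + 2)"
      unfolding vector_eq_rdot[of "snd ?L $ (i + 2)", symmetric]
      using fl[of u "?y 2" "?x 0"] fl[of u "?x 2" "?y 0"]
      by (simp add: fst_jordan snd_jordan) (simp add: inner_simps inner_commute field_simps)
  qed
  then show ?thesis unfolding f4_def mem_Collect_eq rot_apply by blast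
qed

lemma bilinear_jordan: "bilinear jordan"
  unfolding bilinear_def
  by (intro conjI allI linearI; rule prod_eqI; unfold vec_eq_iff; intro allI)
    (simp_all add: fst_jordan snd_jordan inner_simps bilinear_ladd[OF oct.bilinear_star]
      bilinear_radd[OF oct.bilinear_star] bilinear_lmul[OF oct.bilinear_star]
      bilinear_rmul[OF oct.bilinear_star], simp_all add: algebra_simps)

lemmas jordan_simps = bilinear_ladd[OF bilinear_jordan] bilinear_radd[OF bilinear_jordan]
  bilinear_lmul[OF bilinear_jordan] bilinear_rmul[OF bilinear_jordan]
  bilinear_lsub[OF bilinear_jordan] bilinear_rsub[OF bilinear_jordan]
  bilinear_lneg[OF bilinear_jordan] bilinear_rneg[OF bilinear_jordan]
  bilinear_lzero[OF bilinear_jordan] bilinear_rzero[OF bilinear_jordan]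

lemma f4D: "D \<in> f4 \<Longrightarrow> blinfun_apply D (jordan a b) = jordan (blinfun_apply D a) b + jordan a (blinfun_apply D b)"
  unfolding f4_def by blast

lemma f4I: "(\<And>a b. blinfun_apply D (jordan a b) = jordan (blinfun_apply D a) b + jordan a (blinfun_apply D b)) \<Longrightarrow> D \<in> f4"
  unfolding f4_def by blast

lemma idem_simps [simp]: "fst (idem i) $ j = (if j = i then 1 else 0)" "snd (idem i) $ j = 0"
  by (simp_all add: idem_def axis_def)

definition slot :: "3 \<Rightarrow> oct \<Rightarrow> albert" where "slot i v = (0, axis i v)"

lemma slot_simps [simp]: "fst (slot i v) $ j = 0" "snd (slot i v) $ j = (if j = i then v else 0)"
  by (simp_all add: slot_def axis_def)

lemma jordan_idem:
  "fst (jordan (idem i) v) $ j = (if j = i then fst v $ j else 0)"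
  "snd (jordan (idem i) v) $ j = (if j = i then 0 else (1 / 2) *\<^sub>R snd v $ j)"
  by (cases rule: cases_cyclic_3[of j i]; simp add: fst_jordan snd_jordan)+

lemma jordan_idem_right:
  "fst (jordan v (idem i)) $ j = (if j = i then fst v $ j else 0)"
  "snd (jordan v (idem i)) $ j = (if j = i then 0 else (1 / 2) *\<^sub>R snd v $ j)"
  by (cases rule: cases_cyclic_3[of j i]; simp add: fst_jordan snd_jordan)+

lemma jordan_idem_idem: "jordan (idem i) (idem j) = (if i = j then idem i else 0)"
  by (rule albert_eqI[of _ i]) (auto simp: jordan_idem)

lemma rot_fun_idem: "fst (rot_fun i u (idem j)) $ l = 0"
  "snd (rot_fun i u (idem j)) $ l = (if l = i then (if j = i + 2 then u else if j = i + 1 then - u else 0) else 0)"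
  by (auto simp: rot_fun_def)

text \<open>Differentiating \<open>e\<^sub>i \<circ> e\<^sub>i = e\<^sub>i\<close> places the derivative of an idempotent in its Peirce space for
  \<open>1/2\<close>, and differentiating \<open>e\<^sub>j \<circ> e\<^sub>k = 0\<close> relates the remaining slots. So the values of a derivation
  on the idempotents are those of a unique sum of elements \<open>rot i (a\<^sub>i)\<close>.\<close>

lemma f4_idem:
  assumes D: "D \<in> f4"
  shows "fst (blinfun_apply D (idem i)) = 0" "snd (blinfun_apply D (idem i)) $ i = 0"
    and "snd (blinfun_apply D (idem (i + 1))) $ i = - snd (blinfun_apply D (idem (i + 2))) $ i"
proof -
  let ?w = "blinfun_apply D (idem i)"
  have w: "?w = jordan ?w (idem i) + jordan (idem i) ?w"
    using f4D[OF D, of "idem i" "idem i"] by (simp add: jordan_idem_idem)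
  have "fst ?w $ j = 0" for j
    using arg_cong[OF w, of "\<lambda>v. fst v $ j"] by (auto simp: jordan_idem jordan_idem_right split: if_splits)
  then show "fst ?w = 0" by (simp add: vec_eq_iff)
  show "snd ?w $ i = 0"
    using arg_cong[OF w, of "\<lambda>v. snd v $ i"] by (simp add: jordan_idem jordan_idem_right)
  have "0 = jordan (blinfun_apply D (idem (i + 1))) (idem (i + 2)) + jordan (idem (i + 1)) (blinfun_apply D (idem (i + 2)))"
    using f4D[OF D, of "idem (i + 1)" "idem (i + 2)"] by (simp add: jordan_idem_idem blinfun.zero_right)
  from arg_cong[OF this, of "\<lambda>v. snd v $ i"]
  have "(1 / 2) *\<^sub>R (snd (blinfun_apply D (idem (i + 1))) $ i + snd (blinfun_apply D (idem (i + 2))) $ i) = 0"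
    by (simp add: jordan_idem jordan_idem_right algebra_simps)
  then show "snd (blinfun_apply D (idem (i + 1))) $ i = - snd (blinfun_apply D (idem (i + 2))) $ i"
    by (simp add: eq_neg_iff_add_eq_0)
qed

lemma albert_sum: "(a :: albert) = (\<Sum>i\<in>UNIV. fst a $ i *\<^sub>R idem i) + (\<Sum>i\<in>UNIV. slot i (snd a $ i))"
  by (rule albert_eqI[of _ 1]) (simp_all add: sum_3)

definition spin8 :: "(albert \<Rightarrow>\<^sub>L albert) set" where
  "spin8 = {D \<in> f4. \<forall>i. blinfun_apply D (idem i) = 0}"

definition triality :: "(albert \<Rightarrow>\<^sub>L albert) \<Rightarrow> 3 \<Rightarrow> oct \<Rightarrow> oct" where
  "triality h i v = snd (blinfun_apply h (slot i v)) $ i"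

context
  fixes h assumes h: "h \<in> spin8"
begin

lemma spin8_f4: "h \<in> f4" and spin8_idem: "blinfun_apply h (idem i) = 0"
  using h by (auto simp: spin8_def)

text \<open>A derivation that annihilates the idempotents commutes with multiplication by them and so
  preserves the Peirce spaces; the \<open>i\<close>-th slot is the one annihilated by \<open>e\<^sub>i\<close> and halved by the
  other two.\<close>

lemma spin8_slot: "blinfun_apply h (slot i v) = slot i (triality h i v)"
proof -
  let ?w = "blinfun_apply h (slot i v)"
  have e: "blinfun_apply h (jordan (idem j) (slot i v)) = jordan (idem j) ?w" for j
    using f4D[OF spin8_f4, of "idem j" "slot i v"] by (simp add: spin8_idem jordan_simps)
  have "jordan (idem i) (slot i v) = 0" "jordan (idem (i + 1)) (slot i v) = (1 / 2) *\<^sub>R slot i v"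
    by (rule albert_eqI[of _ i]; simp add: jordan_idem)+
  then have w: "0 = jordan (idem i) ?w" "(1 / 2) *\<^sub>R ?w = jordan (idem (i + 1)) ?w"
    using e[of i] e[of "i + 1"] by (simp_all add: blinfun.zero_right blinfun.scaleR_right)
  show ?thesis
    by (rule albert_eqI[of _ i])
      (use arg_cong[OF w(1), of "\<lambda>v. fst v $ i"] arg_cong[OF w(1), of "\<lambda>v. snd v $ (i + 1)"]
        arg_cong[OF w(1), of "\<lambda>v. snd v $ (i + 2)"] arg_cong[OF w(2), of "\<lambda>v. fst v $ (i + 1)"]
        arg_cong[OF w(2), of "\<lambda>v. fst v $ (i + 2)"] in \<open>simp_all add: jordan_idem triality_def\<close>)
qed

lemma spin8_apply: "fst (blinfun_apply h a) $ j = 0" "snd (blinfun_apply h a) $ j = triality h j (snd a $ j)"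
proof -
  have "blinfun_apply h a = (\<Sum>i\<in>UNIV. slot i (triality h i (snd a $ i)))"
    by (subst albert_sum) (simp add: blinfun.add_right blinfun.sum_right blinfun.scaleR_right spin8_idem spin8_slot)
  then show "fst (blinfun_apply h a) $ j = 0" "snd (blinfun_apply h a) $ j = triality h j (snd a $ j)"
    using exhaust_3[of j] by (auto simp: sum_3)
qed

lemma triality_scale: "triality h i (c *\<^sub>R v) = c *\<^sub>R triality h i v"
proof -
  have "slot i (c *\<^sub>R v) = c *\<^sub>R slot i v" by (rule albert_eqI[of _ i]) simp_all
  then show ?thesis by (simp add: triality_def blinfun.scaleR_right)
qed

lemma triality_skew: "triality h i v \<bullet> w + v \<bullet> triality h i w = 0"
  using arg_cong[OF f4D[OF spin8_f4, of "slot i v" "slot i w"], of "\<lambda>a. fst a $ (i + 1)"]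
  by (simp add: spin8_apply spin8_slot fst_jordan)

text \<open>Infinitesimal triality: the action on one slot determines the other two through the
  product.\<close>

lemma triality_star: "triality h i (v \<star> w) = triality h (i + 2) v \<star> w + v \<star> triality h (i + 1) w"
  using arg_cong[OF f4D[OF spin8_f4, of "slot (i + 2) v" "slot (i + 1) w"], of "\<lambda>a. snd a $ i"]
  by (simp add: spin8_apply spin8_slot snd_jordan triality_scale scaleR_add_right[symmetric])

lemma spin8_rot: "(h o\<^sub>L rot i u) - (rot i u o\<^sub>L h) = rot i (triality h i u)"
proof (rule blinfun_eqI)
  fix a
  show "blinfun_apply ((h o\<^sub>L rot i u) - (rot i u o\<^sub>L h)) a = blinfun_apply (rot i (triality h i u)) a"
    using triality_skew[of i u "snd a $ i"] triality_star[of "i + 1" u "snd a $ (i + 2)"]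
      triality_star[of "i + 2" "snd a $ (i + 1)" u] triality_scale[of "i + 1" "- 1"]
    by (intro albert_eqI[of _ i]) (simp_all add: rot_apply blinfun.diff_left spin8_apply triality_scale)
qed

end

lemmas rot_fun_simps_1 = rot_fun_simps[of "i + 1" for i, simplified]
lemmas rot_fun_simps_2 = rot_fun_simps[of "i + 2" for i, simplified]

abbreviation commutator :: "(albert \<Rightarrow>\<^sub>L albert) \<Rightarrow> (albert \<Rightarrow>\<^sub>L albert) \<Rightarrow> (albert \<Rightarrow>\<^sub>L albert)" where
  "commutator C D \<equiv> (C o\<^sub>L D) - (D o\<^sub>L C)"

text \<open>The two sides agree on every component by the absorption laws and the associativity of the inner
  product.\<close>

lemma rot_rot_next: "commutator (rot i u) (rot (i + 1) v) = - rot (i + 2) (v \<star> u)"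
proof (rule blinfun_eqI)
  fix a :: albert
  let ?x = "\<lambda>j. snd a $ (i + j)"
  show "blinfun_apply (commutator (rot i u) (rot (i + 1) v)) a = blinfun_apply (- rot (i + 2) (v \<star> u)) a"
    using oct.inner_star_assoc[of v u "?x 2"] oct.inner_star_assoc[of u "?x 2" v]
      oct.star_flip_left[of v u "?x 1"] oct.star_flip_right[of u v "?x 0"]
    by (intro albert_eqI[of _ i])
      (simp_all add: rot_apply blinfun.diff_left blinfun.minus_left rot_fun_simps_1 rot_fun_simps_2
        inner_simps bilinear_lmul[OF oct.bilinear_star] bilinear_rmul[OF oct.bilinear_star]
        bilinear_lneg[OF oct.bilinear_star] bilinear_rneg[OF oct.bilinear_star],
       simp_all add: algebra_simps inner_commute)
qed

lemma f4_commutator: "C \<in> f4 \<Longrightarrow> D \<in> f4 \<Longrightarrow> commutator C D \<in> f4"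
  by (rule f4I) (simp add: f4D blinfun.add_right blinfun.diff_left jordan_simps)

lemma subspace_f4: "subspace f4"
  unfolding subspace_def
  by (intro conjI ballI allI f4I)
    (simp_all add: f4D blinfun.zero_left blinfun.add_left blinfun.scaleR_left jordan_simps algebra_simps)

lemma fin_dim_blinfun:
  fixes V :: "('a::euclidean_space \<Rightarrow>\<^sub>L 'b::euclidean_space) set"
  assumes "subspace V" shows "fin_dim V"
proof (rule fin_dim_subset[OF assms])
  define E where "E i j = Blinfun (\<lambda>x :: 'a. (x \<bullet> j) *\<^sub>R i)" for i :: 'b and j
  have E: "blinfun_apply (E i j) x = (x \<bullet> j) *\<^sub>R i" for i j x
    unfolding E_def by (subst bounded_linear_Blinfun_apply) (auto intro!: bounded_linear_intros)
  show "finite (case_prod E ` (Basis \<times> Basis))" by simp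
  show "V \<subseteq> span (case_prod E ` (Basis \<times> Basis))"
  proof
    fix D
    have "D = (\<Sum>j\<in>Basis. \<Sum>i\<in>Basis. (blinfun_apply D j \<bullet> i) *\<^sub>R E i j)"
    proof (rule blinfun_eqI)
      fix x
      have "blinfun_apply D x = blinfun_apply D (\<Sum>j\<in>Basis. (x \<bullet> j) *\<^sub>R j)"
        by (simp add: euclidean_representation)
      also have "\<dots> = (\<Sum>j\<in>Basis. (x \<bullet> j) *\<^sub>R blinfun_apply D j)"
        by (simp only: blinfun.sum_right blinfun.scaleR_right)
      also have "\<dots> = (\<Sum>j\<in>Basis. (x \<bullet> j) *\<^sub>R (\<Sum>i\<in>Basis. (blinfun_apply D j \<bullet> i) *\<^sub>R i))"
        by (simp only: euclidean_representation)
      finally show "blinfun_apply D x = blinfun_apply (\<Sum>j\<in>Basis. \<Sum>i\<in>Basis. (blinfun_apply D j \<bullet> i) *\<^sub>R E i j) x"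
        by (simp add: blinfun.sum_left blinfun.scaleR_left E scaleR_right.sum mult.commute)
    qed
    also have "\<dots> \<in> span (case_prod E ` (Basis \<times> Basis))"
      by (intro span_sum span_scale span_base) auto
    finally show "D \<in> span (case_prod E ` (Basis \<times> Basis))" .
  qed
qed

lemma linear_rot: "linear (rot i)"
  by (rule linearI; rule blinfun_eqI; rule albert_eqI[of _ i])
    (simp_all add: rot_apply blinfun.add_left blinfun.scaleR_left inner_simps
      bilinear_ladd[OF oct.bilinear_star] bilinear_radd[OF oct.bilinear_star]
      bilinear_lmul[OF oct.bilinear_star] bilinear_rmul[OF oct.bilinear_star], simp_all add: algebra_simps)

lemma sum_rot_idem:
  "fst (blinfun_apply (\<Sum>i\<in>UNIV. rot i (a $ i)) (idem j)) = 0"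
  "snd (blinfun_apply (\<Sum>i\<in>UNIV. rot i (a $ i)) (idem j)) $ i
     = (if j = i + 2 then a $ i else if j = i + 1 then - a $ i else 0)"
  unfolding blinfun.sum_left rot_apply using exhaust_3[of i]
  by (auto simp: vec_eq_iff rot_fun_idem sum_3)

lemma spin8_commutator_rot: "commutator (rot i u) (rot i v) \<in> spin8"
proof -
  have "blinfun_apply (commutator (rot i u) (rot i v)) (idem j) = 0" for j
    by (rule albert_eqI[of _ i]) (simp_all add: blinfun.diff_left rot_apply rot_fun_idem inner_commute)
  then show ?thesis using f4_commutator[OF rot_f4 rot_f4] by (simp add: spin8_def)
qed

interpretation W24: wallach_pair ostar W24 rot
proof (intro wallach_pair.intro wallach_pair_axioms.intro oct.symmetric_composition_axioms)
  have br: "bracket W24 = commutator" and lie: "lie_alg W24 = f4" and iso: "isotropy W24 = spin8"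
    by (simp_all add: W24_def spin8_def)
  show bil: "bilinear (bracket W24)"
    unfolding br bilinear_def
    by (intro conjI allI linearI; rule blinfun_eqI)
      (simp_all add: blinfun.bilinear_simps algebra_simps)
  show anti: "bracket W24 X Y = - bracket W24 Y X" for X Y by (simp add: br)
  show "bracket W24 (bracket W24 X Y) Z = bracket W24 X (bracket W24 Y Z) - bracket W24 Y (bracket W24 X Z)" for X Y Z
    unfolding br by (rule blinfun_eqI) (simp add: blinfun.bilinear_simps)
  show "fin_dim (lie_alg W24)" unfolding lie by (rule fin_dim_blinfun[OF subspace_f4])
  show "subspace (isotropy W24)"
    unfolding iso spin8_def using subspace_f4
    by (auto simp: subspace_def blinfun.zero_left blinfun.add_left blinfun.scaleR_left)
  show "isotropy W24 \<subseteq> lie_alg W24" by (auto simp: iso lie spin8_def)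
  show "bracket W24 X Y \<in> lie_alg W24" if "X \<in> lie_alg W24" "Y \<in> lie_alg W24" for X Y
    using that f4_commutator by (simp add: br lie)
  show "bracket W24 X Y \<in> isotropy W24" if "X \<in> isotropy W24" "Y \<in> isotropy W24" for X Y
    using that f4_commutator[of X Y] by (simp add: br iso spin8_def blinfun.diff_left blinfun.zero_right)
  show "linear (rot i)" for i by (rule linear_rot)
  show "rot i u \<in> lie_alg W24" for i u by (simp add: lie rot_f4)
  show "\<exists>a. X - (\<Sum>i\<in>UNIV. rot i (a $ i)) \<in> isotropy W24" if "X \<in> lie_alg W24" for X
  proof (intro exI[of _ "\<chi> i. snd (blinfun_apply X (idem (i + 2))) $ i"])
    have X: "X \<in> f4" using that by (simp add: lie)
    let ?S = "\<Sum>i\<in>UNIV. rot i ((\<chi> i. snd (blinfun_apply X (idem (i + 2))) $ i) $ i)"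
    have "?S \<in> f4" by (intro subspace_sum subspace_f4 rot_f4)
    then have "X - ?S \<in> f4" by (intro subspace_diff subspace_f4 X)
    moreover have "blinfun_apply (X - ?S) (idem j) = 0" for j
    proof (rule prod_eqI)
      show "fst (blinfun_apply (X - ?S) (idem j)) = fst 0"
        unfolding blinfun.diff_left fst_diff sum_rot_idem using f4_idem(1)[OF X] by simp
      have "snd (blinfun_apply (X - ?S) (idem j)) $ i = 0" for i
        unfolding blinfun.diff_left snd_diff vector_minus_component sum_rot_idem
        by (cases rule: cases_cyclic_3[of j i]) (simp_all add: f4_idem(2)[OF X] f4_idem(3)[OF X])
      then show "snd (blinfun_apply (X - ?S) (idem j)) = snd 0" by (simp add: vec_eq_iff)
    qed
    ultimately show "X - ?S \<in> isotropy W24" by (simp add: iso spin8_def)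
  qed
  show "a = 0" if "(\<Sum>i\<in>UNIV. rot i (a $ i)) \<in> isotropy W24" for a
  proof -
    have "a $ i = 0" for i
      using that sum_rot_idem(2)[of a "i + 2" i] by (simp add: iso spin8_def)
    then show ?thesis by (simp add: vec_eq_iff)
  qed
  show "bracket W24 (rot i u) (rot i v) \<in> isotropy W24" for i u v
    by (simp add: br iso spin8_commutator_rot)
  show "bracket W24 (rot i u) (bracket W24 (rot i v) (rot i w))
      = rot i ((4 * (w \<bullet> u)) *\<^sub>R v - (4 * (v \<bullet> u)) *\<^sub>R w)" for i u v w
  proof -
    \<comment> \<open>An element of \<open>spin8\<close> acts on \<open>rot i u\<close> through its action on the \<open>i\<close>-th slot, and for a
      commutator that action is evaluated on a single vector.\<close>
    let ?h = "commutator (rot i v) (rot i w)"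
    have "triality ?h i u = - ((4 * (w \<bullet> u)) *\<^sub>R v - (4 * (v \<bullet> u)) *\<^sub>R w)"
      by (simp add: triality_def blinfun.diff_left rot_apply)
    moreover have "commutator (rot i u) ?h = - rot i (triality ?h i u)"
    proof -
      have "commutator (rot i u) ?h = - commutator ?h (rot i u)" by simp
      also have "commutator ?h (rot i u) = rot i (triality ?h i u)" by (rule spin8_rot[OF spin8_commutator_rot])
      finally show ?thesis .
    qed
    ultimately show ?thesis by (simp only: br linear_neg[OF linear_rot] minus_minus)
  qed
  show "bracket W24 (rot i u) (rot (i + 1) v) = - rot (i + 2) (v \<star> u)" for i u v
    by (simp add: br rot_rot_next)
  show "bracket W24 h (rot i u) \<in> range (rot i)" if "h \<in> isotropy W24" for h i u
    using spin8_rot[of h i u] that by (simp add: br iso)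
  show "h = 0" if "h \<in> isotropy W24" and z: "\<And>i u. bracket W24 h (rot i u) = 0" for h
  proof -
    have h: "h \<in> spin8" using that by (simp add: iso)
    have "triality h i u = 0" for i u
    proof -
      have "rot i (triality h i u) = 0" using z[of i u] spin8_rot[OF h] by (simp add: br)
      then have "snd (blinfun_apply (rot i (triality h i u)) (idem (i + 2))) $ i = 0" by (simp add: blinfun.zero_left)
      then show ?thesis by (simp add: rot_apply)
    qed
    then show ?thesis
      by (intro blinfun_eqI albert_eqI[of _ 1]) (simp_all add: spin8_apply[OF h] blinfun.zero_left)
  qed
  show "(\<Sum>j\<in>UNIV. rot j (a $ j)) \<in> intermediate W24 i \<longleftrightarrow> (\<forall>j. j \<noteq> i \<longrightarrow> a $ j = 0)" for a i
  proof -
    let ?w = "blinfun_apply (\<Sum>j\<in>UNIV. rot j (a $ j)) (idem i)"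
    have "(\<Sum>j\<in>UNIV. rot j (a $ j)) \<in> f4" by (intro subspace_sum subspace_f4 rot_f4)
    moreover have "?w = 0 \<longleftrightarrow> (\<forall>j. snd ?w $ j = 0)"
      using sum_rot_idem(1)[of a i] by (auto simp: prod_eq_iff vec_eq_iff)
    moreover have "(\<forall>j. snd ?w $ j = 0) \<longleftrightarrow> (\<forall>j. j \<noteq> i \<longrightarrow> a $ j = 0)"
      unfolding sum_rot_idem using exhaust_3[of i] by (elim disjE) (auto simp: forall_3)
    ultimately show ?thesis by (simp add: W24_def)
  qed
qed

section \<open>Generic metrics on the two spaces\<close>

lemma wallach_constants: "W12.wallach_const = 1 / 8" "W24.wallach_const = 1 / 9"
  by (simp_all add: W12.wallach_const_def W12.killing_scale_def W24.wallach_const_def W24.killing_scale_def)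

theorem theorem2:
  shows "(\<forall>g T. maximal_ricci_flow W12 g T \<and> generic_metric W12 (g 0) \<and> positive_ricci W12 (g 0)
            \<longrightarrow> (\<exists>t0. 0 < t0 \<and> ereal t0 < T \<and>
                  (\<forall>t. t0 < t \<and> ereal t < T \<longrightarrow> mixed_ricci W12 (g t))))
       \<and> (\<forall>g T. maximal_ricci_flow W24 g T \<and> generic_metric W24 (g 0) \<and> positive_ricci W24 (g 0)
            \<longrightarrow> (\<exists>t0. 0 < t0 \<and> ereal t0 < T \<and>
                  (\<forall>t. t0 < t \<and> ereal t < T \<longrightarrow> mixed_ricci W24 (g t))))"
  using W12.generic_flow_becomes_mixed W24.generic_flow_becomes_mixed
  unfolding wallach_constants by simp

end
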